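(* The Markov process $(Y_t)_{t\ge0}$ on $[0,+\infty)$ with generator $$Lf(y)=p_B\,y\,\frac{f(y+g)-f(y)}{g}+(1-p_A-p_A y)f'(y),\qquad y\ge 0,$$ has a unique stationary probability distribution $\nu$. Moreover, $\nu$ has a density on $[0,+\infty)$ which vanishes on $(0,r_A]$, where $r_A=(1-p_A)/p_A$, and is positive and continuous on the open interval $(r_A,+\infty)$. The stationary distribution $\nu$ also satisfies the following property: for every compact set $K$ in $[0,+\infty)$ and every bounded continuous function $f$, $$\lim_{t\to\infty}\sup_{y\in K}\left|\mathbb{E}_y\left(f(Y_t)\right)-\int f\,d\nu\right|=0.$$
   Context: Here $0<p_B<p_A<1$ and $g>0$ are fixed constants. The operator $L$ acts on continuously differentiable functions $f$ with compact support in $[0,+\infty)$. The Markov process with generator $L$ is the càdlàg Markov process $(Y_t)_{t\ge0}$ on $[0,+\infty)$ solving the martingale problem for $L$: for every such $f$, $f(Y_t)-f(Y_0)-\int_0^tLf(Y_s)\,ds$ is a martingale. $\mathbb{E}_y$ denotes expectation for the process started at $Y_0=y$. *)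

theory Defs
  imports "HOL-Probability.Probability"
begin

definition state_space :: "real measure" where
  "state_space = restrict_space borel {0..}"

text \<open>
  Test functions are of class \<open>C\<^sup>1\<close> on the closed half-line, with a one-sided derivative at \<open>0\<close>,
  and may be nonzero at \<open>0\<close>. A function is represented by a total function on the reals whose
  values at negative arguments play no role.
\<close>

definition test_function :: "(real \<Rightarrow> real) \<Rightarrow> bool" where
  "test_function f \<longleftrightarrow>
     f differentiable_on {0..} \<and>
     continuous_on {0..} (\<lambda>y. vector_derivative f (at y within {0..})) \<and>
     compact (closure {y\<in>{0..}. f y \<noteq> 0})"

definition gen :: "real \<Rightarrow> real \<Rightarrow> real \<Rightarrow> (real \<Rightarrow> real) \<Rightarrow> real \<Rightarrow> real" where
  "gen p\<^sub>A p\<^sub>B g f y =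
     p\<^sub>B * y * ((f (y + g) - f y) / g)
     + (1 - p\<^sub>A - p\<^sub>A * y) * vector_derivative f (at y within {0..})"

definition cadlag :: "(real \<Rightarrow> real) \<Rightarrow> bool" where
  "cadlag x \<longleftrightarrow>
     (\<forall>t\<ge>0. (x \<longlongrightarrow> x t) (at_right t)) \<and>
     (\<forall>t>0. \<exists>l. (x \<longlongrightarrow> l) (at_left t))"

definition natural_filtration ::
    "'w measure \<Rightarrow> (real \<Rightarrow> 'w \<Rightarrow> real) \<Rightarrow> real \<Rightarrow> 'w measure" where
  "natural_filtration \<Omega> Y t =
     sigma (space \<Omega>) {Y s -` A \<inter> space \<Omega> | s A. 0 \<le> s \<and> s \<le> t \<and> A \<in> sets state_space}"

definition martingale ::
    "'w measure \<Rightarrow> (real \<Rightarrow> 'w measure) \<Rightarrow> (real \<Rightarrow> 'w \<Rightarrow> real) \<Rightarrow> bool" where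
  "martingale M F X \<longleftrightarrow>
     (\<forall>t\<ge>0. X t \<in> borel_measurable (F t) \<and> integrable M (X t)) \<and>
     (\<forall>s\<ge>0. \<forall>t\<ge>s. AE \<omega> in M. real_cond_exp M (F s) (X t) \<omega> = X s \<omega>)"

definition transition ::
    "(real \<Rightarrow> 'w measure) \<Rightarrow> (real \<Rightarrow> 'w \<Rightarrow> real) \<Rightarrow> real \<Rightarrow> real \<Rightarrow> real measure" where
  "transition P Y t y = distr (P y) state_space (Y t)"

text \<open>
  A time-homogeneous Markov process with cadlag paths in \<open>[0, \<infinity>)\<close>, given as a family of
  probability measures \<open>P y\<close>, for the starting points \<open>y \<ge> 0\<close>, on one measurable space. Only the
  space and the \<open>\<sigma>\<close>-algebra of \<open>\<Omega>\<close> are used; times and starting points below \<open>0\<close> are unconstrained.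
\<close>

definition cadlag_markov_process ::
    "'w measure \<Rightarrow> (real \<Rightarrow> 'w measure) \<Rightarrow> (real \<Rightarrow> 'w \<Rightarrow> real) \<Rightarrow> bool" where
  "cadlag_markov_process \<Omega> P Y \<longleftrightarrow>
     (\<forall>t\<ge>0. Y t \<in> measurable \<Omega> state_space) \<and>
     (\<forall>\<omega>\<in>space \<Omega>. cadlag (\<lambda>t. Y t \<omega>)) \<and>
     (\<forall>y\<ge>0. prob_space (P y) \<and> sets (P y) = sets \<Omega> \<and> (AE \<omega> in P y. Y 0 \<omega> = y)) \<and>
     (\<forall>t\<ge>0. transition P Y t \<in> measurable state_space (prob_algebra state_space)) \<and>
     (\<forall>y\<ge>0. \<forall>s\<ge>0. \<forall>t\<ge>0. \<forall>A\<in>sets state_space.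
        AE \<omega> in P y.
          real_cond_exp (P y) (natural_filtration \<Omega> Y s) (\<lambda>\<omega>'. indicator A (Y (s + t) \<omega>')) \<omega>
          = measure (transition P Y t (Y s \<omega>)) A)"

definition solves_martingale_problem ::
    "((real \<Rightarrow> real) \<Rightarrow> real \<Rightarrow> real) \<Rightarrow> 'w measure \<Rightarrow> (real \<Rightarrow> 'w measure) \<Rightarrow> (real \<Rightarrow> 'w \<Rightarrow> real) \<Rightarrow> bool"
  where
  "solves_martingale_problem L \<Omega> P Y \<longleftrightarrow>
     (\<forall>f. test_function f \<longrightarrow>
       (\<forall>y\<ge>0. martingale (P y) (natural_filtration \<Omega> Y)
          (\<lambda>t \<omega>. f (Y t \<omega>) - f (Y 0 \<omega>) - (LINT s:{0..t}|lborel. L f (Y s \<omega>)))))"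

definition markov_process_with_generator ::
    "((real \<Rightarrow> real) \<Rightarrow> real \<Rightarrow> real) \<Rightarrow> 'w measure \<Rightarrow> (real \<Rightarrow> 'w measure) \<Rightarrow> (real \<Rightarrow> 'w \<Rightarrow> real) \<Rightarrow> bool"
  where
  "markov_process_with_generator L \<Omega> P Y \<longleftrightarrow>
     cadlag_markov_process \<Omega> P Y \<and> solves_martingale_problem L \<Omega> P Y"

text \<open>
  The measure \<open>\<nu> \<bind> transition P Y t\<close> is the law at time \<open>t\<close> of the process with initial law \<open>\<nu>\<close>.
\<close>

definition stationary_distribution ::
    "(real \<Rightarrow> 'w measure) \<Rightarrow> (real \<Rightarrow> 'w \<Rightarrow> real) \<Rightarrow> real measure \<Rightarrow> bool" where
  "stationary_distribution P Y \<nu> \<longleftrightarrow>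
     prob_space \<nu> \<and> sets \<nu> = sets state_space \<and>
     (\<forall>t\<ge>0. \<nu> \<bind> transition P Y t = \<nu>)"

end

theory Submission
  imports Defs
begin

text \<open>
  The drift and the jump rate of the process are affine functions of its position, so the generator acts on
  the exponentials \<open>e\<^sub>l y = exp (- l * y)\<close> in closed form: with
  \<open>R l = p\<^sub>A * l - p\<^sub>B * (1 - exp (- l * g)) / g\<close> one has
  \<open>L e\<^sub>l y = (R l * y - (1 - p\<^sub>A) * l) * e\<^sub>l y\<close>. Hence the Laplace transform of the law of
  \<open>Y t\<close> solves a first-order linear equation in \<open>(t, l)\<close> whose characteristics are the orbits of
  the scalar equation \<open>\<psi>' = - R \<psi>\<close>. Integrating along them gives (lemma \<open>laplace_formula\<close>)

    \<open>E\<^sub>y (exp (- l * Y t)) = exp (- y * \<psi> t) * exp ((1 - p\<^sub>A) * (Q (\<psi> t) - Q l))\<close>,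

  where \<open>\<psi> 0 = l\<close> and \<open>Q' l = l / R l\<close>, \<open>Q 0 = 0\<close>. Because \<open>p\<^sub>B < p\<^sub>A\<close>, \<open>R l \<ge> (p\<^sub>A - p\<^sub>B) * l\<close>, so
  \<open>\<psi> t\<close> tends to \<open>0\<close> and the transform converges to \<open>\<Lambda> l = exp (- (1 - p\<^sub>A) * Q l)\<close>, uniformly for
  \<open>y\<close> in a bounded set.

  Everything about stationarity and convergence follows from this. The laws of \<open>Y n\<close> are tight, and a
  limit point has Laplace transform \<open>\<Lambda>\<close>; a law is stationary iff its transform is \<open>\<Lambda>\<close>. For a
  bounded continuous \<open>f\<close> and small \<open>l\<close>, the function \<open>f * e\<^sub>l\<close> vanishes at infinity, so by the
  Weierstrass theorem in the variable \<open>exp (- y)\<close> it is uniformly close to a linear combination of the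
  exponentials \<open>e\<^sub>k\<close>, and the error \<open>f - f * e\<^sub>l\<close> is controlled by \<open>1 - e\<^sub>l\<close>, itself a function
  whose expectation is known.

  For the density, the differential equation \<open>R l * \<Lambda>' l = - (1 - p\<^sub>A) * l * \<Lambda> l\<close>, divided by \<open>l\<close>, says that
  two signed measures have the same Laplace transform (lemma \<open>balance\<close>):

    \<open>p\<^sub>A * (x - r) \<nu>(dx) = G x dx\<close>,  where  \<open>G x = p\<^sub>B / g * \<integral>z 1{z \<le> x \<le> z + g} \<nu>(dz) \<ge> 0\<close>

  and \<open>r = (1 - p\<^sub>A) / p\<^sub>A\<close>; both sides are the flux through \<open>x\<close>, by drift and by jumps. The sign of the left side
  forces \<open>\<nu> {..<r} = 0\<close>, an atom at \<open>r\<close> would make \<open>G x / (p\<^sub>A * (x - r))\<close> non-integrable, so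
  \<open>\<nu>\<close> has this quotient as its density on \<open>{r<..}\<close>. Without atoms \<open>G\<close> is continuous; it is positive because the
  same identity, read as a Volterra inequality, prevents \<open>\<nu>\<close> from having a gap to the right of \<open>r\<close>.
\<close>

section \<open>Approximation by exponential polynomials and uniqueness of Laplace transforms\<close>

text \<open>
  The substitution \<open>x = exp (- y)\<close> turns a continuous function on the half-line that vanishes at infinity
  into a continuous function on \<open>{0..1}\<close>, to which the Weierstrass theorem applies.
\<close>

lemma exp_poly_approx:
  fixes f :: "real \<Rightarrow> real"
  assumes cont: "continuous_on {0..} f" and lim: "(f \<longlongrightarrow> 0) at_top" and e: "0 < e"
  obtains a :: "nat \<Rightarrow> real" and n :: nat
    where "\<And>y. 0 \<le> y \<Longrightarrow> \<bar>f y - (\<Sum>k\<le>n. a k * exp (- real k * y))\<bar> < e"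
proof -
  define \<phi> where "\<phi> x = (if x = 0 then 0 else f (- ln x))" for x :: real
  have "continuous (at x within {0..1}) \<phi>" if x: "x \<in> {0..1}" for x
  proof (cases "x = 0")
    case True
    have "filterlim (\<lambda>x::real. - ln x) at_top (at_right 0)"
      using ln_at_0 by (subst filterlim_uminus_at_top) simp
    then have *: "((\<lambda>x. f (- ln x)) \<longlongrightarrow> 0) (at_right 0)"
      using lim by (rule filterlim_compose[rotated])
    have "eventually (\<lambda>x. f (- ln x) = \<phi> x) (at_right 0)"
      unfolding eventually_at_right_field \<phi>_def by (intro exI[of _ 1]) auto
    then have "(\<phi> \<longlongrightarrow> 0) (at_right 0)"
      by (rule Lim_transform_eventually[OF *])
    moreover have "at_right (0::real) = at 0 within {0..1}"
      by (metis at_within_Icc_at_right zero_less_one)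
    ultimately show ?thesis
      using True by (simp add: continuous_within \<phi>_def)
  next
    case False
    have "continuous_on {0<..1} (\<lambda>x. f (- ln x))"
      by (rule continuous_on_compose2[OF cont]) (auto intro!: continuous_intros)
    then have "continuous_on {0<..1} \<phi>"
      by (rule continuous_on_eq) (auto simp: \<phi>_def)
    then have "continuous (at x within {0<..1}) \<phi>"
      using x False by (auto simp: continuous_on_eq_continuous_within)
    moreover have "at x within {0<..1} = at x within {0..1}"
      by (rule at_within_nhd[where S="{0<..}"]) (use x False in auto)
    ultimately show ?thesis
      by (simp add: continuous_within)
  qed
  then have "continuous_on {0..1} \<phi>"
    by (auto simp: continuous_on_eq_continuous_within)
  then obtain p where p: "real_polynomial_function p" "\<And>x. x \<in> {0..1} \<Longrightarrow> \<bar>\<phi> x - p x\<bar> < e"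
    using Stone_Weierstrass_real_polynomial_function[of "{0..1::real}" \<phi> e] e compact_Icc by metis
  then obtain a n where an: "p = (\<lambda>x. \<Sum>i\<le>n. a i * x ^ i)"
    by (auto simp: real_polynomial_function_iff_sum)
  show thesis
  proof (rule that[of a n])
    fix y :: real assume "0 \<le> y"
    then have "\<bar>\<phi> (exp (- y)) - p (exp (- y))\<bar> < e"
      by (intro p) auto
    moreover have "exp (- real k * y) = exp (- y) ^ k" for k
      by (simp flip: exp_of_nat_mult)
    ultimately show "\<bar>f y - (\<Sum>k\<le>n. a k * exp (- real k * y))\<bar> < e"
      by (simp add: \<phi>_def an)
  qed
qed

lemma space_of_sets_state_space: "sets M = sets state_space \<Longrightarrow> space M = {0..}"
  using sets_eq_imp_space_eq[of M state_space] by (simp add: state_space_def space_restrict_space)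

lemma sets_state_space: "A \<in> sets state_space \<longleftrightarrow> A \<in> sets borel \<and> A \<subseteq> {0..}"
  unfolding state_space_def by (subst sets_restrict_space_iff) auto

lemma borel_imp_measurable_state_space:
  assumes "sets M = sets state_space" "f \<in> measurable borel N"
  shows "f \<in> measurable M N"
proof -
  have "f \<in> measurable state_space N"
    unfolding state_space_def using assms(2) by (rule measurable_restrict_space1)
  then show ?thesis
    using measurable_cong_sets[OF assms(1) refl] by blast
qed

lemma continuous_imp_measurable_state_space:
  fixes f :: "real \<Rightarrow> real"
  assumes "sets M = sets state_space" "continuous_on {0..} f"
  shows "f \<in> borel_measurable M"
proof -
  have "f \<in> borel_measurable state_space"
    unfolding state_space_def using assms(2) by (rule borel_measurable_continuous_on_restrict)
  then show ?thesis
    using measurable_cong_sets[OF assms(1) refl] by blast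
qed

lemma vanishing_bounded:
  fixes f :: "real \<Rightarrow> real"
  assumes "continuous_on {0..} f" "(f \<longlongrightarrow> 0) at_top"
  obtains B where "\<And>y. 0 \<le> y \<Longrightarrow> \<bar>f y\<bar> \<le> B"
proof -
  obtain a n where an: "\<And>y. 0 \<le> y \<Longrightarrow> \<bar>f y - (\<Sum>k\<le>n. a k * exp (- real k * y))\<bar> < 1"
    using exp_poly_approx[OF assms, of 1] by auto
  have "\<bar>f y\<bar> \<le> 1 + (\<Sum>k\<le>n. \<bar>a k\<bar>)" if "0 \<le> y" for y
  proof -
    have "\<bar>\<Sum>k\<le>n. a k * exp (- real k * y)\<bar> \<le> (\<Sum>k\<le>n. \<bar>a k\<bar>)"
      by (rule order_trans[OF sum_abs sum_mono])
         (use that in \<open>auto simp: abs_mult intro: mult_left_le\<close>)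
    then show ?thesis using an[OF that] by linarith
  qed
  then show thesis using that by blast
qed

lemma integrable_mult_bounded:
  fixes f u :: "'a \<Rightarrow> real"
  assumes "integrable M u" "f \<in> borel_measurable M" "\<And>x. x \<in> space M \<Longrightarrow> \<bar>f x\<bar> \<le> B"
  shows "integrable M (\<lambda>x. f x * u x)"
proof (rule Bochner_Integration.integrable_bound[of M "\<lambda>x. B * u x"])
  show "integrable M (\<lambda>x. B * u x)" using assms by simp
  show "(\<lambda>x. f x * u x) \<in> borel_measurable M" using assms by auto
  have "\<bar>f x\<bar> * \<bar>u x\<bar> \<le> \<bar>B\<bar> * \<bar>u x\<bar>" if "x \<in> space M" for x
    using assms(3)[OF that] by (intro mult_right_mono) auto
  then show "AE x in M. norm (f x * u x) \<le> norm (B * u x)"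
    by (auto simp: abs_mult)
qed

text \<open>
  The weights \<open>u\<close> and \<open>v\<close> may change sign, which is what the balance equation for the density needs.
  Equality extends from exponentials to continuous functions vanishing at infinity by uniform approximation,
  to half-lines by dominated convergence, and to Borel sets since half-lines form a generator stable under
  intersection.
\<close>

lemma signed_laplace_unique:
  fixes u v :: "real \<Rightarrow> real"
  assumes M: "sets M = sets state_space" and N: "sets N = sets state_space"
    and u: "integrable M u" and v: "integrable N v"
    and eq: "\<And>n::nat. (\<integral>y. exp (- real n * y) * u y \<partial>M) = (\<integral>y. exp (- real n * y) * v y \<partial>N)"
    and A: "A \<in> sets borel"
  shows "(\<integral>y. indicator A y * u y \<partial>M) = (\<integral>y. indicator A y * v y \<partial>N)"
proof -
  note [simp] = space_of_sets_state_space[OF M] space_of_sets_state_space[OF N]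
  note mM = continuous_imp_measurable_state_space[OF M]
  note mN = continuous_imp_measurable_state_space[OF N]
  have meas_e: "continuous_on {0..} (\<lambda>y::real. exp (- real k * y))" for k :: nat
    by (intro continuous_intros)
  have cont_eq: "(\<integral>y. f y * u y \<partial>M) = (\<integral>y. f y * v y \<partial>N)"
    if f: "continuous_on {0..} f" "(f \<longlongrightarrow> 0) at_top" for f
  proof -
    obtain B where B: "\<And>y. 0 \<le> y \<Longrightarrow> \<bar>f y\<bar> \<le> B"
      using vanishing_bounded[OF f] by blast
    have ifu: "integrable M (\<lambda>y. f y * u y)" and ifv: "integrable N (\<lambda>y. f y * v y)"
      using integrable_mult_bounded[OF u mM[OF f(1)], of B]
        integrable_mult_bounded[OF v mN[OF f(1)], of B] B by auto
    define C where "C = (\<integral>y. \<bar>u y\<bar> \<partial>M) + (\<integral>y. \<bar>v y\<bar> \<partial>N)"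
    have "C \<ge> 0" by (auto simp: C_def)
    have bound: "\<bar>(\<integral>y. f y * u y \<partial>M) - (\<integral>y. f y * v y \<partial>N)\<bar> \<le> e * C" if e: "0 < e" for e
    proof -
      obtain a n where an: "\<And>y. 0 \<le> y \<Longrightarrow> \<bar>f y - (\<Sum>k\<le>n. a k * exp (- real k * y))\<bar> < e"
        using exp_poly_approx[OF f e] by blast
      let ?p = "\<lambda>y. \<Sum>k\<le>n. a k * exp (- real k * y)"
      have iu: "integrable M (\<lambda>y. exp (- real k * y) * u y)" for k
        by (rule integrable_mult_bounded[OF u mM[OF meas_e], of _ 1]) auto
      have iv: "integrable N (\<lambda>y. exp (- real k * y) * v y)" for k
        by (rule integrable_mult_bounded[OF v mN[OF meas_e], of _ 1]) auto
      have pu: "integrable M (\<lambda>y. ?p y * u y)"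
        unfolding sum_distrib_right mult.assoc
        by (intro Bochner_Integration.integrable_sum integrable_mult_right iu)
      have pv: "integrable N (\<lambda>y. ?p y * v y)"
        unfolding sum_distrib_right mult.assoc
        by (intro Bochner_Integration.integrable_sum integrable_mult_right iv)
      have p: "(\<integral>y. ?p y * u y \<partial>M) = (\<integral>y. ?p y * v y \<partial>N)"
        unfolding sum_distrib_right mult.assoc
        by (subst (1 2) Bochner_Integration.integral_sum)
           (use iu iv eq in \<open>auto intro!: integrable_mult_right\<close>)
      have du: "\<bar>(\<integral>y. f y * u y \<partial>M) - (\<integral>y. ?p y * u y \<partial>M)\<bar> \<le> e * (\<integral>y. \<bar>u y\<bar> \<partial>M)"
      proof -
        have "\<bar>\<integral>y. (f y - ?p y) * u y \<partial>M\<bar> \<le> (\<integral>y. e * \<bar>u y\<bar> \<partial>M)"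
        proof (rule integral_abs_bound_integral)
          show "integrable M (\<lambda>y. (f y - ?p y) * u y)"
            using Bochner_Integration.integrable_diff[OF ifu pu] by (simp add: algebra_simps)
          show "integrable M (\<lambda>y. e * \<bar>u y\<bar>)" using u by auto
          show "\<bar>(f y - ?p y) * u y\<bar> \<le> e * \<bar>u y\<bar>" if "y \<in> space M" for y
            unfolding abs_mult using an[of y] that by (intro mult_right_mono) auto
        qed
        then show ?thesis
          using Bochner_Integration.integral_diff[OF ifu pu] by (simp add: left_diff_distrib)
      qed
      have dv: "\<bar>(\<integral>y. f y * v y \<partial>N) - (\<integral>y. ?p y * v y \<partial>N)\<bar> \<le> e * (\<integral>y. \<bar>v y\<bar> \<partial>N)"
      proof -
        have "\<bar>\<integral>y. (f y - ?p y) * v y \<partial>N\<bar> \<le> (\<integral>y. e * \<bar>v y\<bar> \<partial>N)"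
        proof (rule integral_abs_bound_integral)
          show "integrable N (\<lambda>y. (f y - ?p y) * v y)"
            using Bochner_Integration.integrable_diff[OF ifv pv] by (simp add: algebra_simps)
          show "integrable N (\<lambda>y. e * \<bar>v y\<bar>)" using v by auto
          show "\<bar>(f y - ?p y) * v y\<bar> \<le> e * \<bar>v y\<bar>" if "y \<in> space N" for y
            unfolding abs_mult using an[of y] that by (intro mult_right_mono) auto
        qed
        then show ?thesis
          using Bochner_Integration.integral_diff[OF ifv pv] by (simp add: left_diff_distrib)
      qed
      show ?thesis
        using du dv p unfolding C_def by (simp add: distrib_left)
    qed
    have "\<bar>(\<integral>y. f y * u y \<partial>M) - (\<integral>y. f y * v y \<partial>N)\<bar> \<le> 0"
    proof (rule field_le_epsilon)
      fix e :: real assume e: "0 < e"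
      have "e / (C + 1) * C \<le> e"
        using e \<open>C \<ge> 0\<close> by (simp add: field_simps)
      then show "\<bar>(\<integral>y. f y * u y \<partial>M) - (\<integral>y. f y * v y \<partial>N)\<bar> \<le> 0 + e"
        using bound[of "e / (C + 1)"] e \<open>C \<ge> 0\<close> by simp
    qed
    then show ?thesis by simp
  qed
  have ray: "(\<integral>y. indicator {..a} y * u y \<partial>M) = (\<integral>y. indicator {..a} y * v y \<partial>N)" for a :: real
  proof -
    \<comment> \<open>Ramps that fall from \<open>1\<close> to \<open>0\<close> on an interval of length \<open>1 / n\<close> after \<open>a\<close>.\<close>
    define f where "f n y = max 0 (1 - real n * max 0 (y - a))" for n y
    have fc: "continuous_on {0..} (f n)" for n
      unfolding f_def by (intro continuous_intros)
    have fb: "\<bar>f n y\<bar> \<le> 1" for n y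
      unfolding f_def by auto
    have flim: "(\<lambda>n. f n y) \<longlonglongrightarrow> indicator {..a} y" for y
    proof (cases "y \<le> a")
      case True
      then show ?thesis by (simp add: f_def)
    next
      case False
      have "eventually (\<lambda>n. f n y = 0) sequentially"
      proof -
        obtain N :: nat where N: "1 / (y - a) < real N" using reals_Archimedean2 by blast
        have "f n y = 0" if "n \<ge> N" for n
        proof -
          have "1 / (y - a) < real n" using N that by linarith
          then have "1 < real n * (y - a)" using False by (simp add: divide_less_eq)
          then show ?thesis using False by (simp add: f_def)
        qed
        then show ?thesis by (auto simp: eventually_sequentially)
      qed
      then show ?thesis using False by (simp add: tendsto_eventually)
    qed
    have f0: "(f (Suc n) \<longlongrightarrow> 0) at_top" for n
    proof (rule tendsto_eventually)
      have "f (Suc n) y = 0" if "y \<ge> a + 1" for y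
      proof -
        have "1 * 1 \<le> real (Suc n) * (y - a)" using that by (intro mult_mono) auto
        then show ?thesis using that by (simp add: f_def)
      qed
      then show "\<forall>\<^sub>F y in at_top. f (Suc n) y = 0"
        by (auto simp: eventually_at_top_linorder)
    qed
    have indm: "(indicator {..a} :: real \<Rightarrow> real) \<in> borel_measurable borel" by auto
    have "(\<lambda>n. \<integral>y. f (Suc n) y * u y \<partial>M) \<longlonglongrightarrow> (\<integral>y. indicator {..a} y * u y \<partial>M)"
    proof (rule integral_dominated_convergence[where w="\<lambda>y. \<bar>u y\<bar>"])
      show "AE y in M. (\<lambda>n. f (Suc n) y * u y) \<longlonglongrightarrow> indicator {..a} y * u y"
        by (intro AE_I2 tendsto_mult[OF LIMSEQ_Suc[OF flim] tendsto_const])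
      show "AE y in M. norm (f (Suc n) y * u y) \<le> \<bar>u y\<bar>" for n
        by (auto simp: abs_mult intro!: AE_I2 mult_left_le_one_le fb)
    qed (use u mM[OF fc] borel_imp_measurable_state_space[OF M indm] in auto)
    moreover have "(\<lambda>n. \<integral>y. f (Suc n) y * v y \<partial>N) \<longlonglongrightarrow> (\<integral>y. indicator {..a} y * v y \<partial>N)"
    proof (rule integral_dominated_convergence[where w="\<lambda>y. \<bar>v y\<bar>"])
      show "AE y in N. (\<lambda>n. f (Suc n) y * v y) \<longlonglongrightarrow> indicator {..a} y * v y"
        by (intro AE_I2 tendsto_mult[OF LIMSEQ_Suc[OF flim] tendsto_const])
      show "AE y in N. norm (f (Suc n) y * v y) \<le> \<bar>v y\<bar>" for n
        by (auto simp: abs_mult intro!: AE_I2 mult_left_le_one_le fb)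
    qed (use v mN[OF fc] borel_imp_measurable_state_space[OF N indm] in auto)
    ultimately show ?thesis
      using cont_eq[OF fc f0] LIMSEQ_unique by fastforce
  qed
  have total: "(\<integral>y. u y \<partial>M) = (\<integral>y. v y \<partial>N)"
    using eq[of 0] by simp
  have iM: "integrable M (\<lambda>y. indicator B y * u y)" and iN: "integrable N (\<lambda>y. indicator B y * v y)"
    if "B \<in> sets borel" for B :: "real set"
    using that
    by (auto intro!: integrable_mult_bounded[OF u, of _ 1] integrable_mult_bounded[OF v, of _ 1]
        borel_imp_measurable_state_space[OF M] borel_imp_measurable_state_space[OF N]
        simp: indicator_def)
  have "Int_stable (range atMost :: real set set)"
    by (auto simp: Int_stable_def)
  moreover have "range atMost \<subseteq> Pow (UNIV :: real set)" by auto
  moreover have "A \<in> sigma_sets UNIV (range atMost)"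
    using A by (simp add: borel_eq_atMost)
  ultimately show ?thesis
  proof (induction rule: sigma_sets_induct_disjoint)
    case (basic B)
    then show ?case using ray by auto
  next
    case empty
    show ?case by simp
  next
    case (compl B)
    then have B: "B \<in> sets borel" by (simp add: borel_eq_atMost)
    have *: "indicator (UNIV - B) y * (w::real) = w - indicator B y * w" for y :: real and w
      by (auto simp: indicator_def)
    show ?case
      unfolding * using u v iM[OF B] iN[OF B] total compl.IH by simp
  next
    case (union B)
    then have B: "B i \<in> sets borel" for i by (auto simp: borel_eq_atMost)
    have sM: "(\<lambda>i. indicator (B i) y * w) sums (indicator (\<Union>i. B i) y * w)" for y w :: real
      using union(1) by (intro sums_mult2) (simp add: indicator_sums disjoint_family_on_def)
    have UB: "(\<Union>i. B i) \<in> sets borel" using B by auto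
    have fin: "\<bar>\<Sum>i<n. indicator (B i) y * w\<bar> \<le> \<bar>w\<bar>" for n and y w :: real
    proof -
      have "\<bar>\<Sum>i<n. indicator (B i) y * w\<bar> \<le> (\<Sum>i<n. indicator (B i) y * \<bar>w\<bar>)"
        by (rule order_trans[OF sum_abs]) (simp add: abs_mult)
      also have "\<dots> \<le> indicator (\<Union>i. B i) y * \<bar>w\<bar>"
        using sum_le_suminf[OF sums_summable[OF sM[of y "\<bar>w\<bar>"]], of "{..<n}"] sums_unique[OF sM[of y "\<bar>w\<bar>"]] by simp
      also have "\<dots> \<le> \<bar>w\<bar>" by (auto simp: indicator_def)
      finally show ?thesis .
    qed
    have limM: "(\<lambda>n. \<integral>y. (\<Sum>i<n. indicator (B i) y * u y) \<partial>M) \<longlonglongrightarrow> (\<integral>y. indicator (\<Union>i. B i) y * u y \<partial>M)"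
    proof (rule integral_dominated_convergence[where w="\<lambda>y. \<bar>u y\<bar>"])
      show "AE y in M. norm (\<Sum>i<n. indicator (B i) y * u y) \<le> \<bar>u y\<bar>" for n
        using fin by simp
      show "AE y in M. (\<lambda>n. \<Sum>i<n. indicator (B i) y * u y) \<longlonglongrightarrow> indicator (\<Union>i. B i) y * u y"
        using sM by (auto simp: sums_def)
      show "(\<lambda>y. indicator (\<Union>i. B i) y * u y) \<in> borel_measurable M"
        by (rule borel_measurable_integrable[OF iM[OF UB]])
      show "(\<lambda>y. \<Sum>i<n. indicator (B i) y * u y) \<in> borel_measurable M" for n
        by (rule borel_measurable_sum) (rule borel_measurable_integrable[OF iM[OF B]])
      show "integrable M (\<lambda>y. \<bar>u y\<bar>)"
        using u by simp
    qed
    have limN: "(\<lambda>n. \<integral>y. (\<Sum>i<n. indicator (B i) y * v y) \<partial>N) \<longlonglongrightarrow> (\<integral>y. indicator (\<Union>i. B i) y * v y \<partial>N)"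
    proof (rule integral_dominated_convergence[where w="\<lambda>y. \<bar>v y\<bar>"])
      show "AE y in N. norm (\<Sum>i<n. indicator (B i) y * v y) \<le> \<bar>v y\<bar>" for n
        using fin by simp
      show "AE y in N. (\<lambda>n. \<Sum>i<n. indicator (B i) y * v y) \<longlonglongrightarrow> indicator (\<Union>i. B i) y * v y"
        using sM by (auto simp: sums_def)
      show "(\<lambda>y. indicator (\<Union>i. B i) y * v y) \<in> borel_measurable N"
        by (rule borel_measurable_integrable[OF iN[OF UB]])
      show "(\<lambda>y. \<Sum>i<n. indicator (B i) y * v y) \<in> borel_measurable N" for n
        by (rule borel_measurable_sum) (rule borel_measurable_integrable[OF iN[OF B]])
      show "integrable N (\<lambda>y. \<bar>v y\<bar>)"
        using v by simp
    qed
    have "(\<integral>y. (\<Sum>i<n. indicator (B i) y * u y) \<partial>M) = (\<integral>y. (\<Sum>i<n. indicator (B i) y * v y) \<partial>N)" for n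
      by (subst (1 2) Bochner_Integration.integral_sum) (intro iM iN B sum.cong refl union(3))+
    then show ?case
      using limM limN LIMSEQ_unique by fastforce
  qed
qed

section \<open>Scalar autonomous flows\<close>

text \<open>
  Separation of variables: the solution is the inverse of the travel time \<open>T x = \<integral> 1 / r\<close> from \<open>w\<close> to
  \<open>x\<close>. The two-sided bound on \<open>r\<close> makes \<open>T\<close> a bijection of the line with a Lipschitz inverse.
\<close>

lemma autonomous_flow:
  fixes r :: "real \<Rightarrow> real"
  assumes cont: "continuous_on UNIV r" and a: "0 < a" and r: "\<And>x. a \<le> r x" "\<And>x. r x \<le> b"
  obtains W where "W 0 = w" "\<And>t. (W has_real_derivative r (W t)) (at t)"
proof -
  have pos: "0 < r x" for x using a r(1)[of x] by linarith
  have b: "0 < b" using pos[of 0] r(2)[of 0] by linarith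
  define T where "T x = (LBINT y=w..x. 1 / r y)" for x :: real
  have DT: "(T has_real_derivative 1 / r x) (at x)" for x
  proof -
    let ?l = "min w x - 1" and ?u = "max w x + 1"
    have "continuous_on {?l..?u} (\<lambda>y. 1 / r y)"
      using pos by (intro continuous_intros continuous_on_subset[OF cont]) (auto simp: less_imp_neq[symmetric])
    then have "(T has_vector_derivative 1 / r x) (at x within {?l..?u})"
      unfolding T_def by (intro interval_integral_FTC2) auto
    moreover have "at x within {?l..?u} = at x"
      by (rule at_within_interior) auto
    ultimately show ?thesis
      by (simp add: has_real_derivative_iff_has_vector_derivative)
  qed
  have grow: "(y - x) / b \<le> T y - T x" if "x \<le> y" for x y
  proof -
    have "(\<lambda>x. T x - x / b) x \<le> (\<lambda>x. T x - x / b) y"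
    proof (rule DERIV_nonneg_imp_nondecreasing[OF that])
      fix z
      have "0 \<le> 1 / r z - 1 / b"
        using pos[of z] b r(2)[of z] by (simp add: frac_le)
      moreover have "((\<lambda>x. T x - x / b) has_real_derivative (1 / r z - 1 / b)) (at z)"
        using b by (auto intro!: derivative_eq_intros DT)
      ultimately show "\<exists>D. ((\<lambda>x. T x - x / b) has_real_derivative D) (at z) \<and> 0 \<le> D"
        by blast
    qed
    then show ?thesis by (simp add: diff_divide_distrib)
  qed
  have Tw: "T w = 0" by (simp add: T_def)
  have "\<exists>x. T x = t" for t
  proof -
    let ?l = "w - \<bar>t\<bar> * b" and ?u = "w + \<bar>t\<bar> * b"
    have "?l \<le> w" "w \<le> ?u" using b by auto
    then have "T ?l \<le> t" "t \<le> T ?u"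
      using grow[of ?l w] grow[of w ?u] b Tw by auto
    moreover have "continuous_on {?l..?u} T"
      by (rule DERIV_continuous_on[OF has_field_derivative_at_within[OF DT]])
    ultimately show ?thesis
      using IVT'[of T ?l t ?u] \<open>?l \<le> w\<close> \<open>w \<le> ?u\<close> by auto
  qed
  then obtain W where TW: "\<And>t. T (W t) = t" by metis
  have one_sided: "W t - W s \<le> b * \<bar>s - t\<bar>" for s t
  proof (cases "W s \<le> W t")
    case True
    then have "(W t - W s) / b \<le> \<bar>s - t\<bar>"
      using grow[of "W s" "W t"] by (simp add: TW)
    then show ?thesis using b by (simp add: pos_divide_le_eq mult.commute)
  next
    case False
    moreover have "0 \<le> b * \<bar>s - t\<bar>" using b by simp
    ultimately show ?thesis by linarith
  qed
  have lip: "\<bar>W s - W t\<bar> \<le> b * \<bar>s - t\<bar>" for s t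
    using one_sided[of s t] one_sided[of t s] by (auto simp: abs_minus_commute)
  have contW: "isCont W t" for t
  proof -
    have "((\<lambda>s. b * \<bar>s - t\<bar>) \<longlongrightarrow> 0) (at t)"
      by (auto intro!: tendsto_eq_intros)
    then have "((\<lambda>s. W s - W t) \<longlongrightarrow> 0) (at t)"
      by (rule Lim_null_comparison[rotated]) (simp add: lip)
    then show ?thesis
      by (simp add: isCont_def LIM_zero_cancel)
  qed
  have "(W has_real_derivative r (W t)) (at t)" for t
  proof -
    have "(W has_real_derivative inverse (1 / r (W t))) (at t)"
      by (rule DERIV_inverse_function[where f=T and a="t - 1" and b="t + 1"])
         (use DT TW contW pos[of "W t"] in auto)
    then show ?thesis by simp
  qed
  moreover have "W 0 = w"
    using grow[of "W 0" w] grow[of w "W 0"] TW[of 0] Tw b by (cases "W 0 \<le> w") (auto simp: divide_le_0_iff)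
  ultimately show thesis using that by blast
qed

section \<open>The Riccati equation of the process\<close>

text \<open>
  Kept apart from the process, since the density of the limit law is derived from its Laplace transform alone.
\<close>

locale bandit_parameters =
  fixes p\<^sub>A p\<^sub>B g :: real
  assumes pB: "0 < p\<^sub>B" and pAB: "p\<^sub>B < p\<^sub>A" and pA1: "p\<^sub>A < 1" and g: "0 < g"
begin

lemma pA: "0 < p\<^sub>A" using pB pAB by linarith

text \<open>
  The function with \<open>L e\<^sub>l y = (R l * y - (1 - p\<^sub>A) * l) * e\<^sub>l y\<close> for \<open>e\<^sub>l y = exp (- l * y)\<close>.
\<close>

definition R :: "real \<Rightarrow> real" where
  "R l = p\<^sub>A * l - p\<^sub>B * (1 - exp (- l * g)) / g"

text \<open>
  The quotient \<open>R l / l\<close>, extended to \<open>l \<le> 0\<close> by its limit at \<open>0\<close> so that it is continuous on the whole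
  line.
\<close>

definition slope :: "real \<Rightarrow> real" where
  "slope l = (if l \<le> 0 then p\<^sub>A - p\<^sub>B else R l / l)"

lemma slope_R: "0 < l \<Longrightarrow> R l = l * slope l"
  by (simp add: slope_def)

lemma slope_bounds: "p\<^sub>A - p\<^sub>B \<le> slope l" "slope l \<le> p\<^sub>A"
proof -
  have "p\<^sub>A - p\<^sub>B \<le> slope l \<and> slope l \<le> p\<^sub>A"
  proof (cases "l \<le> 0")
    case True
    then show ?thesis using pB by (simp add: slope_def)
  next
    case False
    have *: "1 - exp (- l * g) \<le> l * g"
      using exp_ge_add_one_self[of "- l * g"] by simp
    have "p\<^sub>B * (1 - exp (- l * g)) / g \<le> p\<^sub>B * l"
      using mult_left_mono[OF *, of p\<^sub>B] pB g by (simp add: divide_le_eq mult.assoc)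
    moreover have "0 \<le> p\<^sub>B * (1 - exp (- l * g)) / g"
      using pB g False by auto
    ultimately show ?thesis
      using False by (simp add: slope_def R_def le_divide_eq divide_le_eq algebra_simps)
  qed
  then show "p\<^sub>A - p\<^sub>B \<le> slope l" "slope l \<le> p\<^sub>A" by auto
qed

lemma slope_pos: "0 < slope l"
  using slope_bounds(1)[of l] pAB by linarith

lemma R_pos: "0 < l \<Longrightarrow> 0 < R l"
  by (simp add: slope_R slope_pos)

lemma continuous_slope: "continuous_on UNIV slope"
proof -
  have "isCont slope l" for l
  proof -
    consider "l < 0" | "l = 0" | "0 < l" by linarith
    then show ?thesis
    proof cases
      case 1
      then have "eventually (\<lambda>x. slope x = p\<^sub>A - p\<^sub>B) (nhds l)"
        using eventually_nhds_in_open[of "{..<0}" l] by (auto simp: slope_def elim: eventually_mono)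
      then show ?thesis using isCont_cong[of slope "\<lambda>x. p\<^sub>A - p\<^sub>B" l] by auto
    next
      case 2
      have "(R has_real_derivative (p\<^sub>A - p\<^sub>B * g / g)) (at 0)"
        unfolding R_def by (auto intro!: derivative_eq_intros)
      then have "((\<lambda>x. R x / x) \<longlongrightarrow> p\<^sub>A - p\<^sub>B) (at 0)"
        using g by (simp add: DERIV_def R_def)
      then have "((\<lambda>x. R x / x) \<longlongrightarrow> p\<^sub>A - p\<^sub>B) (at_right 0)"
        by (rule tendsto_mono[rotated]) (simp add: at_le)
      then have r: "(slope \<longlongrightarrow> p\<^sub>A - p\<^sub>B) (at_right 0)"
        by (rule Lim_transform_eventually)
           (auto simp: eventually_at_right_field slope_def intro!: exI[of _ 1])
      have "(slope \<longlongrightarrow> p\<^sub>A - p\<^sub>B) (at_left 0)"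
        by (rule tendsto_eventually)
           (auto simp: eventually_at_left_field slope_def intro!: exI[of _ "-1"])
      with r have "(slope \<longlongrightarrow> p\<^sub>A - p\<^sub>B) (at 0)"
        by (simp add: filterlim_at_split)
      then show ?thesis using 2 by (simp add: isCont_def slope_def)
    next
      case 3
      then have "eventually (\<lambda>x. slope x = R x / x) (nhds l)"
        using eventually_nhds_in_open[of "{0<..}" l] by (auto simp: slope_def elim: eventually_mono)
      moreover have "isCont (\<lambda>x. R x / x) l"
        unfolding R_def using 3 g by (intro continuous_intros) auto
      ultimately show ?thesis using isCont_cong[of slope "\<lambda>x. R x / x" l] by auto
    qed
  qed
  then show ?thesis by (simp add: continuous_on_eq_continuous_at)
qed

definition Q :: "real \<Rightarrow> real" where
  "Q l = integral {0..l} (\<lambda>u. 1 / slope u)"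

lemma continuous_inv_slope: "continuous_on S (\<lambda>u. 1 / slope u)"
  using slope_pos
  by (intro continuous_intros continuous_on_subset[OF continuous_slope]) (auto simp: less_imp_neq[symmetric])

lemma Q_deriv:
  assumes "0 < l" shows "(Q has_real_derivative l / R l) (at l)"
proof -
  have "(Q has_real_derivative 1 / slope l) (at l within {0..l + 1})"
    unfolding Q_def using assms
    by (intro integral_has_real_derivative continuous_inv_slope) auto
  moreover have "at l within {0..l + 1} = at l"
    using assms by (intro at_within_interior) auto
  ultimately show ?thesis using assms by (simp add: slope_R)
qed

lemma Q_bounds:
  assumes "0 \<le> l" shows "0 \<le> Q l" "Q l \<le> l / (p\<^sub>A - p\<^sub>B)"
proof -
  have i: "(\<lambda>u. 1 / slope u) integrable_on {0..l}"
    by (intro integrable_continuous_real continuous_inv_slope)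
  show "0 \<le> Q l" unfolding Q_def
    using slope_pos by (intro integral_nonneg i) (auto intro: less_imp_le)
  have "Q l \<le> integral {0..l} (\<lambda>u. 1 / (p\<^sub>A - p\<^sub>B))" unfolding Q_def
    using slope_bounds(1) slope_pos pAB by (intro integral_le i) (auto intro!: frac_le)
  then show "Q l \<le> l / (p\<^sub>A - p\<^sub>B)" using assms by simp
qed

lemma Q_tendsto_0: "(Q \<longlongrightarrow> 0) (at_right 0)"
proof (rule tendsto_sandwich[OF _ _ tendsto_const])
  show "((\<lambda>l. l / (p\<^sub>A - p\<^sub>B)) \<longlongrightarrow> 0) (at_right 0)"
    using pAB by (auto intro!: tendsto_eq_intros)
qed (auto simp: eventually_at_right_field intro!: exI[of _ 1] Q_bounds)

text \<open>
  The Laplace transform of the stationary law. It solves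
  \<open>R l * \<Lambda>' l = - (1 - p\<^sub>A) * l * \<Lambda> l\<close> with \<open>\<Lambda> 0 = 1\<close>, which expresses that \<open>L e\<^sub>l\<close> integrates to zero
  under that law.
\<close>

definition \<Lambda> :: "real \<Rightarrow> real" where
  "\<Lambda> l = exp (- (1 - p\<^sub>A) * Q l)"

lemma \<Lambda>_bounds: "0 < l \<Longrightarrow> 0 < \<Lambda> l" "0 < l \<Longrightarrow> \<Lambda> l \<le> 1"
  using Q_bounds(1)[of l] pA1 by (auto simp: \<Lambda>_def intro: mult_nonpos_nonneg)

lemma \<Lambda>_tendsto_1: "(\<Lambda> \<longlongrightarrow> 1) (at_right 0)"
proof -
  have "((\<lambda>l. exp (- (1 - p\<^sub>A) * Q l)) \<longlongrightarrow> exp (- (1 - p\<^sub>A) * 0)) (at_right 0)"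
    by (intro tendsto_intros Q_tendsto_0)
  then show ?thesis by (simp add: \<Lambda>_def[abs_def])
qed

lemma \<Lambda>_near_1:
  assumes "0 < e" obtains l where "0 < l" "1 - \<Lambda> l < e"
proof -
  have "\<forall>\<^sub>F l in at_right 0. 1 - e < \<Lambda> l"
    by (rule order_tendstoD(1)[OF \<Lambda>_tendsto_1]) (use assms in simp)
  then obtain b where "0 < b" "\<And>l. 0 < l \<Longrightarrow> l < b \<Longrightarrow> 1 - e < \<Lambda> l"
    unfolding eventually_at_right_field by auto
  then have "0 < b / 2" "1 - \<Lambda> (b / 2) < e" by (auto simp: field_simps)
  then show thesis by (rule that)
qed

text \<open>
  In the variable \<open>ln \<psi>\<close> the speed is \<open>slope\<close>, which lies between two positive constants; the flow is
  therefore global and its decay exponential.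
\<close>

lemma riccati_flow:
  assumes "0 < l"
  obtains \<psi> where "\<psi> 0 = l" "\<And>t. 0 < \<psi> t" "\<And>t. (\<psi> has_real_derivative - R (\<psi> t)) (at t)"
    "\<And>t. 0 \<le> t \<Longrightarrow> \<psi> t \<le> l * exp (- (p\<^sub>A - p\<^sub>B) * t)"
proof -
  have "continuous_on UNIV (\<lambda>x. slope (exp x))"
    by (rule continuous_on_compose2[OF continuous_slope]) (auto intro: continuous_intros)
  then obtain W where W: "W 0 = ln l" "\<And>t. (W has_real_derivative slope (exp (W t))) (at t)"
    using autonomous_flow[of "\<lambda>x. slope (exp x)" "p\<^sub>A - p\<^sub>B" p\<^sub>A "ln l"] slope_bounds pAB by auto
  define \<psi> where "\<psi> t = exp (W (- t))" for t
  have "(\<psi> has_real_derivative - R (\<psi> t)) (at t)" for t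
  proof -
    have "((\<lambda>t. W (- t)) has_real_derivative (slope (exp (W (- t))) * -1)) (at t)"
      by (rule DERIV_chain2[of W, OF W(2)]) (auto intro!: derivative_eq_intros)
    then have "(\<psi> has_real_derivative (exp (W (- t)) * (slope (exp (W (- t))) * -1))) (at t)"
      unfolding \<psi>_def by (auto intro!: derivative_eq_intros)
    then show ?thesis by (simp add: \<psi>_def slope_R)
  qed
  moreover have "\<psi> t \<le> l * exp (- (p\<^sub>A - p\<^sub>B) * t)" if "0 \<le> t" for t
  proof -
    let ?h = "\<lambda>s. W s - (p\<^sub>A - p\<^sub>B) * s"
    have "?h (- t) \<le> ?h 0"
    proof (rule DERIV_nonneg_imp_nondecreasing[where f="?h" and a="- t" and b=0])
      fix s
      have D: "(?h has_real_derivative (slope (exp (W s)) - (p\<^sub>A - p\<^sub>B))) (at s)"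
        by (auto intro!: derivative_eq_intros W(2))
      show "\<exists>D. (?h has_real_derivative D) (at s) \<and> 0 \<le> D"
        using slope_bounds(1)[of "exp (W s)"] by (intro exI[of _ "slope (exp (W s)) - (p\<^sub>A - p\<^sub>B)"] conjI D) simp
    qed (use that in auto)
    then have "\<psi> t \<le> exp (ln l + - (p\<^sub>A - p\<^sub>B) * t)"
      using W(1) by (simp add: \<psi>_def algebra_simps)
    then show ?thesis using assms by (simp add: exp_add)
  qed
  moreover have "\<psi> 0 = l" using W(1) assms by (simp add: \<psi>_def)
  moreover have "0 < \<psi> t" for t by (simp add: \<psi>_def)
  ultimately show thesis using that by blast
qed

end

section \<open>Test functions obtained by cutting off decaying functions\<close>

lemma DERIV_pos_part_squared:
  "((\<lambda>x::real. (max 0 x)\<^sup>2) has_real_derivative 2 * max 0 x) (at x)"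
proof -
  consider "x < 0" | "x = 0" | "0 < x" by linarith
  then show ?thesis
  proof cases
    case 1
    have "((\<lambda>x::real. 0) has_real_derivative 0) (at x)" by simp
    then have "((\<lambda>x::real. (max 0 x)\<^sup>2) has_real_derivative 0) (at x)"
      by (rule DERIV_cong_ev[THEN iffD1, rotated -1, OF _ refl _ refl])
         (use 1 eventually_nhds_in_open[of "{..<0}" x] in \<open>auto elim: eventually_mono\<close>)
    then show ?thesis using 1 by simp
  next
    case 2
    have "((\<lambda>h::real. (max 0 h)\<^sup>2 / h) \<longlongrightarrow> 0) (at 0)"
    proof (rule Lim_null_comparison)
      show "((\<lambda>h::real. \<bar>h\<bar>) \<longlongrightarrow> 0) (at 0)"
        by (auto intro!: tendsto_eq_intros)
      show "\<forall>\<^sub>F h::real in at 0. norm ((max 0 h)\<^sup>2 / h) \<le> \<bar>h\<bar>"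
        by (rule always_eventually) (auto simp: max_def power2_eq_square)
    qed
    then show ?thesis using 2 by (simp add: DERIV_def)
  next
    case 3
    have "((\<lambda>x::real. x\<^sup>2) has_real_derivative 2 * x) (at x)"
      by (auto intro!: derivative_eq_intros)
    then have "((\<lambda>x::real. (max 0 x)\<^sup>2) has_real_derivative 2 * x) (at x)"
      by (rule DERIV_cong_ev[THEN iffD1, rotated -1, OF _ refl _ refl])
         (use 3 eventually_nhds_in_open[of "{0<..}" x] in \<open>auto elim: eventually_mono\<close>)
    then show ?thesis using 3 by simp
  qed
qed

text \<open>
  A continuously differentiable step from \<open>1\<close> on \<open>{..0}\<close> to \<open>0\<close> on \<open>{1..}\<close>.
\<close>

definition cutoff :: "real \<Rightarrow> real" where
  "cutoff x = (max 0 (1 - (max 0 x)\<^sup>2))\<^sup>2"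

definition cutoff' :: "real \<Rightarrow> real" where
  "cutoff' x = - 4 * max 0 (1 - (max 0 x)\<^sup>2) * max 0 x"

lemma cutoff_deriv: "(cutoff has_real_derivative cutoff' x) (at x)"
proof -
  have "((\<lambda>x. 1 - (max 0 x)\<^sup>2) has_real_derivative - (2 * max 0 x)) (at x)"
    using DERIV_diff[OF DERIV_const DERIV_pos_part_squared, of 1 x] by simp
  from DERIV_chain2[OF DERIV_pos_part_squared this] show ?thesis
    unfolding cutoff_def cutoff'_def by (simp add: mult_ac)
qed

lemma cutoff_bounds: "0 \<le> cutoff x" "cutoff x \<le> 1" "\<bar>cutoff' x\<bar> \<le> 4"
proof -
  have a: "0 \<le> max 0 (1 - (max 0 x)\<^sup>2)" "max 0 (1 - (max 0 x)\<^sup>2) \<le> 1" by auto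
  then show "0 \<le> cutoff x" "cutoff x \<le> 1"
    by (auto simp: cutoff_def intro: power_le_one)
  show "\<bar>cutoff' x\<bar> \<le> 4"
  proof (cases "x \<le> 1")
    case True
    then have "max 0 (1 - (max 0 x)\<^sup>2) * max 0 x \<le> 1 * 1"
      using a by (intro mult_mono) auto
    moreover have "0 \<le> max 0 (1 - (max 0 x)\<^sup>2) * max 0 x" by simp
    ultimately show ?thesis unfolding cutoff'_def by (simp add: abs_mult)
  next
    case False
    then have "1 \<le> x\<^sup>2" by (simp add: one_le_power)
    then show ?thesis using False by (simp add: cutoff'_def)
  qed
qed

lemma cutoff_eq:
  "x \<le> 0 \<Longrightarrow> cutoff x = 1" "x \<le> 0 \<Longrightarrow> cutoff' x = 0" "1 \<le> x \<Longrightarrow> cutoff x = 0"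
  by (auto simp: cutoff_def cutoff'_def one_le_power)

lemma vector_derivative_within_Ici:
  assumes "(f has_real_derivative D) (at y)" "0 \<le> y"
  shows "vector_derivative f (at y within {0..}) = D"
proof (rule vector_derivative_within)
  have "y islimpt {0..}"
    by (rule islimpt_subset[of y "{y..y+1}"]) (use assms(2) in auto)
  then show "at y within {0..} \<noteq> bot"
    by (simp add: trivial_limit_within)
  show "(f has_vector_derivative D) (at y within {0..})"
    using assms(1) has_vector_derivative_at_within has_real_derivative_iff_has_vector_derivative by blast
qed

text \<open>
  The factor \<open>1 + y\<close> compensates the linear growth of the coefficients of the generator, so that the generator
  maps a decaying function to a bounded one, with a bound depending only on \<open>C\<close>.
\<close>

definition decaying :: "real \<Rightarrow> (real \<Rightarrow> real) \<Rightarrow> (real \<Rightarrow> real) \<Rightarrow> bool" where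
  "decaying C f f' \<longleftrightarrow> (\<forall>y. (f has_real_derivative f' y) (at y)) \<and> continuous_on UNIV f' \<and>
     (\<forall>y\<ge>0. (1 + y) * \<bar>f y\<bar> \<le> C \<and> (1 + y) * \<bar>f' y\<bar> \<le> C)"

lemma decaying_continuous: "decaying C f f' \<Longrightarrow> continuous_on S f"
  unfolding decaying_def
  by (meson DERIV_continuous_on has_field_derivative_at_within)

lemma decaying_bounded:
  assumes "decaying C f f'" "0 \<le> y"
  shows "\<bar>f y\<bar> \<le> C" "\<bar>f' y\<bar> \<le> C"
proof -
  have "\<bar>z\<bar> \<le> (1 + y) * \<bar>z\<bar>" for z :: real
    using assms(2) by (simp add: algebra_simps)
  then show "\<bar>f y\<bar> \<le> C" "\<bar>f' y\<bar> \<le> C"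
    using assms order_trans unfolding decaying_def by blast+
qed

text \<open>
  The constant does not depend on the position \<open>a\<close> of the cutoff; this provides the domination in the passage
  from test functions to decaying functions.
\<close>

lemma decaying_cutoff:
  assumes "decaying C f f'"
  shows "decaying (5 * C) (\<lambda>y. f y * cutoff (y - a)) (\<lambda>y. f' y * cutoff (y - a) + f y * cutoff' (y - a))"
proof -
  have C: "0 \<le> C" using decaying_bounded(1)[OF assms, of 0] by auto
  note d = assms[unfolded decaying_def]
  have D: "((\<lambda>y. f y * cutoff (y - a)) has_real_derivative
      f' y * cutoff (y - a) + f y * cutoff' (y - a)) (at y)" for y
    using d by (auto intro!: derivative_eq_intros DERIV_chain2[OF cutoff_deriv])
  have c: "continuous_on UNIV (\<lambda>y. cutoff (y - a))"
    by (rule continuous_on_compose2[of UNIV cutoff])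
       (auto intro!: continuous_intros DERIV_continuous_on[OF has_field_derivative_at_within[OF cutoff_deriv]])
  have c': "continuous_on UNIV (\<lambda>y. cutoff' (y - a))"
    unfolding cutoff'_def by (intro continuous_intros)
  have "(1 + y) * \<bar>f y * cutoff (y - a)\<bar> \<le> 5 * C" if y: "0 \<le> y" for y
  proof -
    have "(1 + y) * \<bar>f y * cutoff (y - a)\<bar> = ((1 + y) * \<bar>f y\<bar>) * \<bar>cutoff (y - a)\<bar>"
      by (simp add: abs_mult)
    also have "\<dots> \<le> C * 1"
      using d y C cutoff_bounds[of "y - a"] by (intro mult_mono) auto
    finally show ?thesis using C by simp
  qed
  moreover have "(1 + y) * \<bar>f' y * cutoff (y - a) + f y * cutoff' (y - a)\<bar> \<le> 5 * C"
    if y: "0 \<le> y" for y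
  proof -
    have "(1 + y) * \<bar>f' y * cutoff (y - a) + f y * cutoff' (y - a)\<bar>
      \<le> (1 + y) * (\<bar>f' y * cutoff (y - a)\<bar> + \<bar>f y * cutoff' (y - a)\<bar>)"
      using y by (intro mult_left_mono abs_triangle_ineq) auto
    also have "\<dots> = ((1 + y) * \<bar>f' y\<bar>) * \<bar>cutoff (y - a)\<bar> + ((1 + y) * \<bar>f y\<bar>) * \<bar>cutoff' (y - a)\<bar>"
      by (simp add: abs_mult distrib_left mult.assoc)
    also have "\<dots> \<le> C * 1 + C * 4"
      using d y C cutoff_bounds[of "y - a"] by (intro add_mono mult_mono) auto
    finally show ?thesis by simp
  qed
  ultimately show ?thesis
    unfolding decaying_def using D c c' d decaying_continuous[OF assms]
    by (auto intro!: continuous_intros)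
qed

context bandit_parameters
begin

text \<open>
  The generator with the derivative passed as an argument, so that no choice of a one-sided derivative at \<open>0\<close>
  intervenes.
\<close>

definition L :: "(real \<Rightarrow> real) \<Rightarrow> (real \<Rightarrow> real) \<Rightarrow> real \<Rightarrow> real" where
  "L f f' y = p\<^sub>B * y * ((f (y + g) - f y) / g) + (1 - p\<^sub>A - p\<^sub>A * y) * f' y"

lemma gen_eq_L:
  assumes "(f has_real_derivative f' y) (at y)" "0 \<le> y"
  shows "gen p\<^sub>A p\<^sub>B g f y = L f f' y"
  using vector_derivative_within_Ici[OF assms] by (simp add: gen_def L_def)

definition L_const :: real where "L_const = 2 * p\<^sub>B / g + 1"

lemma L_bound:
  assumes d: "decaying C f f'" and y: "0 \<le> y"
  shows "\<bar>L f f' y\<bar> \<le> C * L_const"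
proof -
  have b: "(1 + z) * \<bar>f z\<bar> \<le> C" "(1 + z) * \<bar>f' z\<bar> \<le> C" if "0 \<le> z" for z
    using d that by (auto simp: decaying_def)
  have "\<bar>y * f (y + g)\<bar> \<le> (1 + (y + g)) * \<bar>f (y + g)\<bar>"
    using y g by (simp add: abs_mult mult_right_mono)
  also have "\<dots> \<le> C" using b(1)[of "y + g"] y g by simp
  finally have 1: "\<bar>y * f (y + g)\<bar> \<le> C" .
  have "\<bar>y * f y\<bar> \<le> (1 + y) * \<bar>f y\<bar>"
    using y by (simp add: abs_mult mult_right_mono)
  with b(1)[OF y] have 2: "\<bar>y * f y\<bar> \<le> C" by linarith
  have "0 \<le> p\<^sub>A * y" "p\<^sub>A * y \<le> y"
    using pA pA1 y by (auto simp: mult_left_le_one_le)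
  then have "\<bar>1 - p\<^sub>A - p\<^sub>A * y\<bar> \<le> 1 + y"
    using pA pA1 y by (intro abs_leI) linarith+
  then have "\<bar>(1 - p\<^sub>A - p\<^sub>A * y) * f' y\<bar> \<le> (1 + y) * \<bar>f' y\<bar>"
    by (simp add: abs_mult mult_right_mono)
  with b(2)[OF y] have 3: "\<bar>(1 - p\<^sub>A - p\<^sub>A * y) * f' y\<bar> \<le> C" by linarith
  have "\<bar>y * f (y + g) - y * f y\<bar> \<le> 2 * C" using 1 2 by linarith
  then have "p\<^sub>B / g * \<bar>y * f (y + g) - y * f y\<bar> \<le> p\<^sub>B / g * (2 * C)"
    using pB g by (intro mult_left_mono) auto
  also have "p\<^sub>B / g * \<bar>y * f (y + g) - y * f y\<bar> = \<bar>p\<^sub>B / g * (y * f (y + g) - y * f y)\<bar>"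
    using pB g by (simp add: abs_mult)
  also have "p\<^sub>B / g * (y * f (y + g) - y * f y) = p\<^sub>B * y * ((f (y + g) - f y) / g)"
    by (simp add: algebra_simps diff_divide_distrib)
  finally have "\<bar>p\<^sub>B * y * ((f (y + g) - f y) / g)\<bar> \<le> p\<^sub>B / g * (2 * C)" .
  with 3 have "\<bar>L f f' y\<bar> \<le> p\<^sub>B / g * (2 * C) + C"
    unfolding L_def by linarith
  also have "\<dots> = C * L_const" by (simp add: L_const_def algebra_simps)
  finally show ?thesis .
qed

lemma L_continuous:
  assumes d: "decaying C f f'"
  shows "continuous_on S (L f f')"
proof -
  have f': "continuous_on S f'"
    using d continuous_on_subset unfolding decaying_def by blast
  have "continuous_on S (\<lambda>y. f (y + g))"
    by (rule continuous_on_compose2[OF decaying_continuous[OF d, of UNIV]]) (auto intro: continuous_intros)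
  then show ?thesis
    unfolding L_def using f' decaying_continuous[OF d, of S] g by (intro continuous_intros) auto
qed

lemma test_function_cutoff:
  assumes d: "decaying C f f'"
  shows "test_function (\<lambda>y. f y * cutoff (y - a))"
  unfolding test_function_def
proof (intro conjI)
  let ?f = "\<lambda>y. f y * cutoff (y - a)" and ?f' = "\<lambda>y. f' y * cutoff (y - a) + f y * cutoff' (y - a)"
  note d' = decaying_cutoff[OF d, of a, unfolded decaying_def]
  have D: "(?f has_real_derivative ?f' y) (at y)" for y
    using d' by blast
  show "?f differentiable_on {0..}"
    unfolding differentiable_on_def
    using D by (meson differentiable_at_withinI real_differentiable_def)
  have "continuous_on {0..} ?f'" using d' continuous_on_subset by blast
  then show "continuous_on {0..} (\<lambda>y. vector_derivative ?f (at y within {0..}))"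
    by (rule continuous_on_eq) (simp add: vector_derivative_within_Ici[OF D])
  have "{y \<in> {0..}. ?f y \<noteq> 0} \<subseteq> {0..\<bar>a\<bar> + 1}"
  proof
    fix y assume y: "y \<in> {y \<in> {0..}. ?f y \<noteq> 0}"
    then have "\<not> 1 \<le> y - a" using cutoff_eq(3)[of "y - a"] by auto
    then show "y \<in> {0..\<bar>a\<bar> + 1}" using y by auto
  qed
  then show "compact (closure {y \<in> {0..}. ?f y \<noteq> 0})"
    by (metis bounded_closed_interval bounded_subset compact_closure)
qed

end

section \<open>Dynkin's formula\<close>

locale bandit_process = bandit_parameters +
  fixes \<Omega> :: "'w measure" and P :: "real \<Rightarrow> 'w measure" and Y :: "real \<Rightarrow> 'w \<Rightarrow> real"
  assumes process: "markov_process_with_generator (gen p\<^sub>A p\<^sub>B g) \<Omega> P Y"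
begin

lemma markov: "cadlag_markov_process \<Omega> P Y"
  and mg_problem: "solves_martingale_problem (gen p\<^sub>A p\<^sub>B g) \<Omega> P Y"
  using process by (auto simp: markov_process_with_generator_def)

lemma Y_measurable_\<Omega>: "0 \<le> t \<Longrightarrow> Y t \<in> measurable \<Omega> state_space"
  using markov by (simp add: cadlag_markov_process_def)

lemma prob_P: "0 \<le> y \<Longrightarrow> prob_space (P y)"
  and sets_P: "0 \<le> y \<Longrightarrow> sets (P y) = sets \<Omega>"
  and Y_start: "0 \<le> y \<Longrightarrow> AE \<omega> in P y. Y 0 \<omega> = y"
  using markov by (auto simp: cadlag_markov_process_def)

lemma space_P: "0 \<le> y \<Longrightarrow> space (P y) = space \<Omega>"
  using sets_P sets_eq_imp_space_eq by blast

lemma Y_measurable: "0 \<le> y \<Longrightarrow> 0 \<le> t \<Longrightarrow> Y t \<in> measurable (P y) state_space"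
  using Y_measurable_\<Omega> measurable_cong_sets[OF sets_P refl] by blast

lemma Y_nonneg: "0 \<le> t \<Longrightarrow> \<omega> \<in> space \<Omega> \<Longrightarrow> 0 \<le> Y t \<omega>"
  using measurable_space[OF Y_measurable_\<Omega>] space_of_sets_state_space[OF refl] by auto

lemma Y_right_continuous:
  assumes "\<omega> \<in> space \<Omega>" "0 \<le> t"
  shows "((\<lambda>s. Y s \<omega>) \<longlongrightarrow> Y t \<omega>) (at_right t)"
  using markov assms by (simp add: cadlag_markov_process_def cadlag_def)

lemma Y_comp_measurable:
  fixes f :: "real \<Rightarrow> real"
  assumes "0 \<le> y" "0 \<le> t" "continuous_on {0..} f"
  shows "(\<lambda>\<omega>. f (Y t \<omega>)) \<in> borel_measurable (P y)"
  using measurable_compose[OF Y_measurable[OF assms(1,2)]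
      continuous_imp_measurable_state_space[OF refl assms(3)]] .

lemma Y_comp_integrable:
  fixes f :: "real \<Rightarrow> real"
  assumes "0 \<le> y" "0 \<le> t" "continuous_on {0..} f" "\<And>z. 0 \<le> z \<Longrightarrow> \<bar>f z\<bar> \<le> B"
  shows "integrable (P y) (\<lambda>\<omega>. f (Y t \<omega>))"
proof -
  interpret prob_space "P y" using prob_P assms(1) .
  show ?thesis
    by (rule integrable_const_bound[where B=B])
       (use assms Y_nonneg space_P Y_comp_measurable in auto)
qed

lemma Y_comp_integral_bound:
  fixes f :: "real \<Rightarrow> real"
  assumes "0 \<le> y" "0 \<le> t" "continuous_on {0..} f" "\<And>z. 0 \<le> z \<Longrightarrow> \<bar>f z\<bar> \<le> B"
  shows "\<bar>\<integral>\<omega>. f (Y t \<omega>) \<partial>P y\<bar> \<le> B"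
proof -
  interpret prob_space "P y" using prob_P assms(1) .
  have "\<bar>f (Y t \<omega>)\<bar> \<le> B" if "\<omega> \<in> space (P y)" for \<omega>
    using that assms Y_nonneg space_P by auto
  then have "AE \<omega> in P y. f (Y t \<omega>) \<le> B" "AE \<omega> in P y. - B \<le> f (Y t \<omega>)"
    by (auto intro!: AE_I2 simp: abs_le_iff minus_le_iff)
  with integral_le_const[OF Y_comp_integrable[OF assms]] integral_ge_const[OF Y_comp_integrable[OF assms]]
  show ?thesis by (intro abs_leI) (simp_all add: minus_le_iff)
qed

lemma Y_comp_start:
  fixes f :: "real \<Rightarrow> real"
  assumes "0 \<le> y" "continuous_on {0..} f"
  shows "(\<integral>\<omega>. f (Y 0 \<omega>) \<partial>P y) = f y"
proof -
  interpret prob_space "P y" using prob_P assms(1) .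
  have "(\<integral>\<omega>. f (Y 0 \<omega>) \<partial>P y) = (\<integral>\<omega>. f y \<partial>P y)"
    by (rule integral_cong_AE) (use Y_comp_measurable[OF assms(1) _ assms(2)] Y_start[OF assms(1)] in auto)
  then show ?thesis by (simp add: prob_space)
qed

text \<open>
  A right-continuous process is the pointwise limit of the processes obtained by evaluating it at the next point of
  the grid of mesh \<open>1 / Suc n\<close>; each of these is measurable since it takes countably many time values.
\<close>

lemma Y_jointly_measurable:
  fixes \<phi> :: "real \<Rightarrow> real"
  assumes y: "0 \<le> y" and \<phi>: "continuous_on {0..} \<phi>"
  shows "(\<lambda>(s, \<omega>). indicator {0..t} s * \<phi> (Y s \<omega>)) \<in> borel_measurable (lborel \<Otimes>\<^sub>M P y)"
proof -
  \<comment> \<open>The grid point \<open>\<tau> n (k n s)\<close> is strictly larger than \<open>s\<close>, as right-continuity requires.\<close>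
  define k where "k n s = nat \<lfloor>real (Suc n) * s\<rfloor>" for n :: nat and s :: real
  define \<tau> where "\<tau> n j = real (Suc j) / real (Suc n)" for n j :: nat
  define Z where "Z n x = indicator {0..t} (fst x) * \<phi> (Y (\<tau> n (k n (fst x))) (snd x))"
    for n and x :: "real \<times> 'w"
  have \<tau>: "s < \<tau> n (k n s)" "\<tau> n (k n s) \<le> s + 1 / real (Suc n)" if "0 \<le> s" for n s
  proof -
    have "0 \<le> real (Suc n) * s" using that by simp
    then have k: "real (k n s) \<le> real (Suc n) * s" "real (Suc n) * s < real (k n s) + 1"
      unfolding k_def by linarith+
    show "s < \<tau> n (k n s)"
      using k(2) by (simp add: \<tau>_def pos_less_divide_eq mult.commute)
    have "real (k n s) / real (Suc n) \<le> s"
      using k(1) by (simp add: pos_divide_le_eq mult.commute)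
    moreover have "\<tau> n (k n s) = real (k n s) / real (Suc n) + 1 / real (Suc n)"
      by (simp add: \<tau>_def add_divide_distrib)
    ultimately show "\<tau> n (k n s) \<le> s + 1 / real (Suc n)" by simp
  qed
  have "Z n \<in> borel_measurable (lborel \<Otimes>\<^sub>M P y)" for n
  proof -
    have km: "(\<lambda>x. k n (fst x)) \<in> measurable (lborel \<Otimes>\<^sub>M P y) (count_space UNIV)"
      unfolding k_def by measurable
    have "(\<lambda>x. indicator {0..t} (fst x) * \<phi> (Y (\<tau> n j) (snd x))) \<in> borel_measurable (lborel \<Otimes>\<^sub>M P y)" for j
    proof -
      have [measurable]: "(\<lambda>\<omega>. \<phi> (Y (\<tau> n j) \<omega>)) \<in> borel_measurable (P y)"
        by (rule Y_comp_measurable[OF y _ \<phi>]) (simp add: \<tau>_def)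
      show ?thesis by measurable
    qed
    from measurable_compose_countable[OF this km] show ?thesis
      unfolding Z_def .
  qed
  moreover have "(\<lambda>n. Z n x) \<longlonglongrightarrow> (case x of (s, \<omega>) \<Rightarrow> indicator {0..t} s * \<phi> (Y s \<omega>))"
    if x: "x \<in> space (lborel \<Otimes>\<^sub>M P y)" for x
  proof (cases "0 \<le> fst x")
    case True
    obtain s \<omega> where [simp]: "x = (s, \<omega>)" by (cases x)
    have s: "0 \<le> s" and \<omega>: "\<omega> \<in> space \<Omega>" using True x y by (auto simp: space_pair_measure space_P)
    have "(\<lambda>n. s + 1 / real (Suc n)) \<longlonglongrightarrow> s + 0"
      by (intro tendsto_intros LIMSEQ_Suc lim_1_over_n)
    then have "(\<lambda>n. s + 1 / real (Suc n)) \<longlonglongrightarrow> s" by simp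
    then have "(\<lambda>n. \<tau> n (k n s)) \<longlonglongrightarrow> s"
      by (rule tendsto_sandwich[OF _ _ tendsto_const, rotated -1])
         (use \<tau>[OF s] in \<open>auto intro!: always_eventually less_imp_le\<close>)
    then have "filterlim (\<lambda>n. \<tau> n (k n s)) (at_right s) sequentially"
      using \<tau>(1)[OF s] by (auto simp: filterlim_at less_imp_neq[symmetric])
    then have lim: "(\<lambda>n. Y (\<tau> n (k n s)) \<omega>) \<longlonglongrightarrow> Y s \<omega>"
      by (rule filterlim_compose[OF Y_right_continuous[OF \<omega> s]])
    have "(\<lambda>n. \<phi> (Y (\<tau> n (k n s)) \<omega>)) \<longlonglongrightarrow> \<phi> (Y s \<omega>)"
      by (rule continuous_on_tendsto_compose[OF \<phi> lim])
         (use Y_nonneg[OF _ \<omega>] s in \<open>auto simp: \<tau>_def\<close>)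
    then show ?thesis by (auto simp: Z_def intro!: tendsto_mult)
  next
    case False
    then show ?thesis by (auto simp: Z_def split: prod.split)
  qed
  ultimately show ?thesis
    by (rule borel_measurable_LIMSEQ_real[rotated])
qed

lemma expectation_time_integral:
  fixes \<phi> :: "real \<Rightarrow> real"
  assumes y: "0 \<le> y" and t: "0 \<le> t" and \<phi>: "continuous_on {0..} \<phi>"
    and B: "\<And>z. 0 \<le> z \<Longrightarrow> \<bar>\<phi> z\<bar> \<le> B"
  shows "integrable (P y) (\<lambda>\<omega>. LINT s:{0..t}|lborel. \<phi> (Y s \<omega>))"
    and "(\<integral>\<omega>. (LINT s:{0..t}|lborel. \<phi> (Y s \<omega>)) \<partial>P y) = (LINT s:{0..t}|lborel. (\<integral>\<omega>. \<phi> (Y s \<omega>) \<partial>P y))"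
    and "set_integrable lborel {0..t} (\<lambda>s. \<integral>\<omega>. \<phi> (Y s \<omega>) \<partial>P y)"
proof -
  interpret prob_space "P y" using prob_P[OF y] .
  have sf: "sigma_finite_measure (P y)" ..
  interpret pair_sigma_finite lborel "P y" ..
  let ?F = "\<lambda>s \<omega>. indicator {0..t} s * \<phi> (Y s \<omega>)"
  have i: "integrable (lborel \<Otimes>\<^sub>M P y) (case_prod ?F)"
  proof (rule integrableI_bounded_set[where A="{0..t} \<times> space (P y)" and B=B])
    show "{0..t} \<times> space (P y) \<in> sets (lborel \<Otimes>\<^sub>M P y)" by auto
    show "case_prod ?F \<in> borel_measurable (lborel \<Otimes>\<^sub>M P y)"
      by (rule Y_jointly_measurable[OF y \<phi>])
    show "emeasure (lborel \<Otimes>\<^sub>M P y) ({0..t} \<times> space (P y)) < \<infinity>"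
      using t by (subst sigma_finite_measure.emeasure_pair_measure_Times[OF sf]) (auto simp: emeasure_space_1)
    show "AE x in lborel \<Otimes>\<^sub>M P y. x \<in> {0..t} \<times> space (P y) \<longrightarrow> norm (case_prod ?F x) \<le> B"
      using B Y_nonneg y by (auto simp: space_P)
    show "AE x in lborel \<Otimes>\<^sub>M P y. x \<notin> {0..t} \<times> space (P y) \<longrightarrow> case_prod ?F x = 0"
      by (rule AE_I2) (auto simp: space_pair_measure indicator_def)
  qed
  show "integrable (P y) (\<lambda>\<omega>. LINT s:{0..t}|lborel. \<phi> (Y s \<omega>))"
    using integrable_snd[OF i] by (simp add: set_lebesgue_integral_def)
  show "(\<integral>\<omega>. (LINT s:{0..t}|lborel. \<phi> (Y s \<omega>)) \<partial>P y) = (LINT s:{0..t}|lborel. (\<integral>\<omega>. \<phi> (Y s \<omega>) \<partial>P y))"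
    using Fubini_integral[OF i] by (simp add: set_lebesgue_integral_def)
  show "set_integrable lborel {0..t} (\<lambda>s. \<integral>\<omega>. \<phi> (Y s \<omega>) \<partial>P y)"
    using integrable_fst[OF i] by (simp add: set_integrable_def)
qed

lemma subalgebra_filtration:
  assumes "0 \<le> y" "0 \<le> t"
  shows "subalgebra (P y) (natural_filtration \<Omega> Y t)"
proof -
  have *: "{Y s -` A \<inter> space \<Omega> | s A. 0 \<le> s \<and> s \<le> t \<and> A \<in> sets state_space} \<subseteq> sets \<Omega>"
    using measurable_sets[OF Y_measurable_\<Omega>] by auto
  moreover have "sets \<Omega> \<subseteq> Pow (space \<Omega>)" by (rule sets.space_closed)
  ultimately have "sets (natural_filtration \<Omega> Y t) \<subseteq> sets \<Omega>"
    unfolding natural_filtration_def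
    by (subst sets_measure_of) (auto intro!: sets.sigma_sets_subset[OF *, THEN subsetD])
  then show ?thesis
    using assms by (simp add: subalgebra_def space_P sets_P natural_filtration_def space_measure_of_conv)
qed

text \<open>
  The martingale of the martingale problem vanishes at time \<open>0\<close>, so its expectation vanishes at all times.
\<close>

lemma dynkin_test_function:
  assumes y: "0 \<le> y" and t: "0 \<le> t" and f: "test_function f"
  shows "(\<integral>\<omega>. f (Y t \<omega>) - f (Y 0 \<omega>) - (LINT s:{0..t}|lborel. gen p\<^sub>A p\<^sub>B g f (Y s \<omega>)) \<partial>P y) = 0"
proof -
  interpret prob_space "P y" using prob_P[OF y] .
  let ?X = "\<lambda>t \<omega>. f (Y t \<omega>) - f (Y 0 \<omega>) - (LINT s:{0..t}|lborel. gen p\<^sub>A p\<^sub>B g f (Y s \<omega>))"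
  let ?F = "natural_filtration \<Omega> Y 0"
  have "martingale (P y) (natural_filtration \<Omega> Y) ?X"
    using mg_problem f y unfolding solves_martingale_problem_def by blast
  then have int: "integrable (P y) (?X t)"
    and ae: "AE \<omega> in P y. real_cond_exp (P y) ?F (?X t) \<omega> = ?X 0 \<omega>"
    using t by (auto simp: martingale_def)
  interpret finite_measure_subalgebra "P y" ?F
    by unfold_locales (rule subalgebra_filtration[OF y order.refl])
  have zero: "(LINT s:{0..0}|lborel. h s) = 0" for h :: "real \<Rightarrow> real"
  proof -
    have "AE s in lborel. s \<noteq> (0::real)" by (rule AE_lborel_singleton)
    then have "AE s in lborel. indicator {0..0} s *\<^sub>R h s = 0" by eventually_elim auto
    then have "(\<integral>s. indicator {0..0} s *\<^sub>R h s \<partial>lborel) = 0"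
      by (rule integral_eq_zero_AE)
    then show ?thesis by (simp add: set_lebesgue_integral_def)
  qed
  have "(\<integral>\<omega>. ?X t \<omega> \<partial>P y) = (\<integral>\<omega>. real_cond_exp (P y) ?F (?X t) \<omega> \<partial>P y)"
    using real_cond_exp_int(2)[OF int] by simp
  also have "\<dots> = (\<integral>\<omega>. 0 \<partial>P y)"
    by (rule integral_cong_AE) (use ae zero borel_measurable_cond_exp2 in auto)
  finally show ?thesis by simp
qed

text \<open>
  Exponentials do not have compact support. Their truncations do, and both sides of the formula for the
  truncated functions converge by dominated convergence, thanks to the uniform constant in \<open>decaying_cutoff\<close>.
\<close>

lemma dynkin:
  assumes y: "0 \<le> y" and t: "0 \<le> t" and d: "decaying C f f'"
  shows "(\<integral>\<omega>. f (Y t \<omega>) \<partial>P y) = f y + (LINT s:{0..t}|lborel. (\<integral>\<omega>. L f f' (Y s \<omega>) \<partial>P y))"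
proof -
  interpret prob_space "P y" using prob_P[OF y] .
  define F where "F n z = f z * cutoff (z - real n)" for n z
  define F' where "F' n z = f' z * cutoff (z - real n) + f z * cutoff' (z - real n)" for n z
  have dF: "decaying (5 * C) (F n) (F' n)" for n
    using decaying_cutoff[OF d] unfolding F_def F'_def .
  have FD: "(F n has_real_derivative F' n z) (at z)" for n z
    using dF unfolding decaying_def by blast
  have eq: "(\<integral>\<omega>. F n (Y t \<omega>) \<partial>P y) = F n y + (LINT s:{0..t}|lborel. (\<integral>\<omega>. L (F n) (F' n) (Y s \<omega>) \<partial>P y))" for n
  proof -
    have gen: "(LINT s:{0..t}|lborel. gen p\<^sub>A p\<^sub>B g (F n) (Y s \<omega>)) = (LINT s:{0..t}|lborel. L (F n) (F' n) (Y s \<omega>))"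
      if "\<omega> \<in> space (P y)" for \<omega>
      using that Y_nonneg[of _ \<omega>] space_P[OF y]
      by (intro set_lebesgue_integral_cong allI impI gen_eq_L[OF FD]) auto
    note ft = expectation_time_integral[OF y t L_continuous[OF dF[of n]] L_bound[OF dF[of n]]]
    have iF: "integrable (P y) (\<lambda>\<omega>. F n (Y s \<omega>))" if "0 \<le> s" for s
      using Y_comp_integrable[OF y that decaying_continuous[OF dF] decaying_bounded(1)[OF dF]] .
    have "test_function (F n)"
      unfolding F_def by (rule test_function_cutoff[OF d])
    from dynkin_test_function[OF y t this]
    have "(\<integral>\<omega>. F n (Y t \<omega>) - F n (Y 0 \<omega>) - (LINT s:{0..t}|lborel. L (F n) (F' n) (Y s \<omega>)) \<partial>P y) = 0"
      by (subst (asm) Bochner_Integration.integral_cong[OF refl]) (auto simp: gen)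
    then show ?thesis
      using Bochner_Integration.integral_diff[OF Bochner_Integration.integrable_diff[OF iF[OF t] iF[OF order.refl]] ft(1)]
        Bochner_Integration.integral_diff[OF iF[OF t] iF[OF order.refl]]
        Y_comp_start[OF y decaying_continuous[OF dF[of n]]] ft(2) by linarith
  qed
  \<comment> \<open>At a fixed point the truncation is inactive, also after a jump, once \<open>n \<ge> z + g\<close>.\<close>
  have F_ev: "eventually (\<lambda>n. F n z = f z \<and> L (F n) (F' n) z = L f f' z) sequentially" for z
  proof -
    obtain N :: nat where N: "z + g \<le> real N" using real_arch_simple by blast
    have "F n z = f z \<and> L (F n) (F' n) z = L f f' z" if "N \<le> n" for n
    proof -
      have "z + g \<le> real n" using N that by linarith
      then show ?thesis
        using g cutoff_eq(1)[of "z - real n"] cutoff_eq(2)[of "z - real n"] cutoff_eq(1)[of "z + g - real n"]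
        by (simp add: F_def F'_def L_def)
    qed
    then show ?thesis by (auto simp: eventually_sequentially)
  qed
  have lim1: "(\<lambda>n. F n z) \<longlonglongrightarrow> f z" and lim2: "(\<lambda>n. L (F n) (F' n) z) \<longlonglongrightarrow> L f f' z" for z
    using F_ev[of z] by (auto intro!: tendsto_eventually elim: eventually_mono)
  have limE: "(\<lambda>n. \<integral>\<omega>. h n (Y s \<omega>) \<partial>P y) \<longlonglongrightarrow> (\<integral>\<omega>. k (Y s \<omega>) \<partial>P y)"
    if "0 \<le> s" "\<And>n. continuous_on {0..} (h n)" "continuous_on {0..} k" "\<And>z. (\<lambda>n. h n z) \<longlonglongrightarrow> k z"
      "\<And>n z. 0 \<le> z \<Longrightarrow> \<bar>h n z\<bar> \<le> B" for s B and h :: "nat \<Rightarrow> real \<Rightarrow> real" and k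
  proof (rule integral_dominated_convergence[where w="\<lambda>_. B"])
    show "(\<lambda>\<omega>. k (Y s \<omega>)) \<in> borel_measurable (P y)" "(\<lambda>\<omega>. h n (Y s \<omega>)) \<in> borel_measurable (P y)" for n
      by (intro Y_comp_measurable y that)+
    show "integrable (P y) (\<lambda>_. B)" by simp
    show "AE \<omega> in P y. (\<lambda>n. h n (Y s \<omega>)) \<longlonglongrightarrow> k (Y s \<omega>)"
      by (intro AE_I2 that)
    show "AE \<omega> in P y. norm (h n (Y s \<omega>)) \<le> B" for n
      using that(5) Y_nonneg[OF that(1)] space_P[OF y] by (intro AE_I2) simp
  qed
  have "(\<lambda>n. \<integral>\<omega>. F n (Y t \<omega>) \<partial>P y) \<longlonglongrightarrow> (\<integral>\<omega>. f (Y t \<omega>) \<partial>P y)"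
    by (rule limE[OF t decaying_continuous[OF dF] decaying_continuous[OF d] lim1 decaying_bounded(1)[OF dF]])
  moreover have "(\<lambda>n. F n y + (LINT s:{0..t}|lborel. (\<integral>\<omega>. L (F n) (F' n) (Y s \<omega>) \<partial>P y))) \<longlonglongrightarrow>
      f y + (LINT s:{0..t}|lborel. (\<integral>\<omega>. L f f' (Y s \<omega>) \<partial>P y))"
  proof (intro tendsto_add lim1)
    show "(\<lambda>n. LINT s:{0..t}|lborel. (\<integral>\<omega>. L (F n) (F' n) (Y s \<omega>) \<partial>P y)) \<longlonglongrightarrow>
      (LINT s:{0..t}|lborel. (\<integral>\<omega>. L f f' (Y s \<omega>) \<partial>P y))"
      unfolding set_lebesgue_integral_def
    proof (rule integral_dominated_convergence[where w="\<lambda>s. indicator {0..t} s * (5 * C * L_const)"])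
      show "(\<lambda>s. indicator {0..t} s *\<^sub>R (\<integral>\<omega>. L f f' (Y s \<omega>) \<partial>P y)) \<in> borel_measurable lborel"
        using expectation_time_integral(3)[OF y t L_continuous[OF d] L_bound[OF d]]
        unfolding set_integrable_def by (rule borel_measurable_integrable)
      show "(\<lambda>s. indicator {0..t} s *\<^sub>R (\<integral>\<omega>. L (F n) (F' n) (Y s \<omega>) \<partial>P y)) \<in> borel_measurable lborel" for n
        using expectation_time_integral(3)[OF y t L_continuous[OF dF] L_bound[OF dF]]
        unfolding set_integrable_def by (rule borel_measurable_integrable)
      have "integrable lborel (indicator {0..t} :: real \<Rightarrow> real)"
        using t by (intro integrable_real_indicator) auto
      then show "integrable lborel (\<lambda>s. indicator {0..t} s * (5 * C * L_const))"
        by (rule integrable_mult_left)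
      show "AE s in lborel. (\<lambda>n. indicator {0..t} s *\<^sub>R (\<integral>\<omega>. L (F n) (F' n) (Y s \<omega>) \<partial>P y)) \<longlonglongrightarrow>
        indicator {0..t} s *\<^sub>R (\<integral>\<omega>. L f f' (Y s \<omega>) \<partial>P y)"
      proof (rule AE_I2)
        fix s :: real
        show "(\<lambda>n. indicator {0..t} s *\<^sub>R (\<integral>\<omega>. L (F n) (F' n) (Y s \<omega>) \<partial>P y)) \<longlonglongrightarrow>
          indicator {0..t} s *\<^sub>R (\<integral>\<omega>. L f f' (Y s \<omega>) \<partial>P y)"
        proof (cases "s \<in> {0..t}")
          case True
          then have "0 \<le> s" by simp
          from limE[OF this L_continuous[OF dF] L_continuous[OF d] lim2 L_bound[OF dF]]
          show ?thesis using True by simp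
        qed simp
      qed
      show "AE s in lborel. norm (indicator {0..t} s *\<^sub>R (\<integral>\<omega>. L (F n) (F' n) (Y s \<omega>) \<partial>P y))
        \<le> indicator {0..t} s * (5 * C * L_const)" for n
      proof (rule AE_I2)
        fix s :: real
        show "norm (indicator {0..t} s *\<^sub>R (\<integral>\<omega>. L (F n) (F' n) (Y s \<omega>) \<partial>P y))
          \<le> indicator {0..t} s * (5 * C * L_const)"
        proof (cases "s \<in> {0..t}")
          case True
          then have "0 \<le> s" by simp
          from Y_comp_integral_bound[OF y this L_continuous[OF dF] L_bound[OF dF]]
          show ?thesis using True by simp
        qed simp
      qed
    qed
  qed
  ultimately show ?thesis
    unfolding eq using LIMSEQ_unique by blast
qed

end

section \<open>Regularity of Laplace transforms\<close>

lemma mult_exp_bound: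
  fixes y a :: real
  assumes "0 < a" "0 \<le> y"
  shows "y * exp (- a * y) \<le> 1 / a" "y\<^sup>2 * exp (- a * y) \<le> 4 / a\<^sup>2"
proof -
  have *: "z * y \<le> exp (z * y)" for z
    using exp_ge_add_one_self[of "z * y"] by linarith
  have "y * a \<le> exp (a * y)" using *[of a] by (simp add: mult.commute)
  then show "y * exp (- a * y) \<le> 1 / a"
    using assms by (simp add: exp_minus field_simps)
  have "(a / 2 * y)\<^sup>2 \<le> (exp (a / 2 * y))\<^sup>2"
    using assms by (intro power_mono *) auto
  also have "\<dots> = exp (a * y)"
    by (simp flip: exp_double)
  finally have "y\<^sup>2 * a\<^sup>2 \<le> 4 * exp (a * y)"
    by (simp add: power_mult_distrib power_divide mult.commute)
  then show "y\<^sup>2 * exp (- a * y) \<le> 4 / a\<^sup>2"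
    using assms by (simp add: exp_minus field_simps)
qed

lemma mult_exp_lipschitz:
  fixes y a l l' :: real
  assumes "0 < a" "0 \<le> y" "a \<le> l" "a \<le> l'"
  shows "\<bar>y * exp (- l * y) - y * exp (- l' * y)\<bar> \<le> 4 / a\<^sup>2 * \<bar>l - l'\<bar>"
proof -
  have "norm (y * exp (- l * y) - y * exp (- l' * y)) \<le> 4 / a\<^sup>2 * norm (l - l')"
  proof (rule field_differentiable_bound[where S="{a..}" and f="\<lambda>l. y * exp (- l * y)"
        and f'="\<lambda>l. - (y\<^sup>2 * exp (- l * y))"])
    fix z assume z: "z \<in> {a..}"
    show "((\<lambda>l. y * exp (- l * y)) has_field_derivative - (y\<^sup>2 * exp (- z * y))) (at z within {a..})"
      by (auto intro!: derivative_eq_intros simp: power2_eq_square)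
    have "y\<^sup>2 * exp (- z * y) \<le> y\<^sup>2 * exp (- a * y)"
      using z assms by (intro mult_left_mono) (auto simp: mult_right_mono)
    also have "\<dots> \<le> 4 / a\<^sup>2" by (rule mult_exp_bound) fact+
    finally show "norm (- (y\<^sup>2 * exp (- z * y))) \<le> 4 / a\<^sup>2" by simp
  qed (use assms in auto)
  then show ?thesis by simp
qed

lemma exp_second_order:
  fixes y a l l' :: real
  assumes "0 < a" "0 \<le> y" "a \<le> l" "a \<le> l'"
  shows "\<bar>exp (- l' * y) - exp (- l * y) + (l' - l) * (y * exp (- l * y))\<bar> \<le> 4 / a\<^sup>2 * (l' - l)\<^sup>2"
proof -
  let ?S = "{a..} \<inter> {l - \<bar>l' - l\<bar>..l + \<bar>l' - l\<bar>}"
  let ?f = "\<lambda>z. exp (- z * y) + z * (y * exp (- l * y))"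
  have A: "norm (?f l' - ?f l) \<le> (4 / a\<^sup>2 * \<bar>l' - l\<bar>) * norm (l' - l)"
  proof (rule field_differentiable_bound[where S="?S" and f'="\<lambda>z. y * exp (- l * y) - y * exp (- z * y)"])
    fix z assume z: "z \<in> ?S"
    show "(?f has_field_derivative y * exp (- l * y) - y * exp (- z * y)) (at z within ?S)"
      by (auto intro!: derivative_eq_intros)
    have "\<bar>y * exp (- l * y) - y * exp (- z * y)\<bar> \<le> 4 / a\<^sup>2 * \<bar>l - z\<bar>"
      using z assms by (intro mult_exp_lipschitz) auto
    also have "\<dots> \<le> 4 / a\<^sup>2 * \<bar>l' - l\<bar>"
      using z by (intro mult_left_mono) auto
    finally show "norm (y * exp (- l * y) - y * exp (- z * y)) \<le> 4 / a\<^sup>2 * \<bar>l' - l\<bar>" by simp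
  next
    show "convex ?S" by (intro convex_Int) auto
  qed (use assms in auto)
  have B: "?f l' - ?f l = exp (- l' * y) - exp (- l * y) + (l' - l) * (y * exp (- l * y))"
    by (simp add: left_diff_distrib)
  have C: "(4 / a\<^sup>2 * \<bar>l' - l\<bar>) * norm (l' - l) = 4 / a\<^sup>2 * (l' - l)\<^sup>2"
    unfolding real_norm_def mult.assoc abs_mult_self_eq power2_eq_square ..
  show ?thesis using A[unfolded B C] by (simp only: real_norm_def)
qed

text \<open>
  A quantitative form of differentiability in \<open>l\<close>, uniform over all laws on the half-line. The uniformity
  makes it possible to differentiate along a curve \<open>(t, l t)\<close> on which the law changes together with \<open>l\<close>.
\<close>

lemma laplace_second_order:
  fixes X :: "'a \<Rightarrow> real"
  assumes M: "prob_space M" and X: "X \<in> borel_measurable M" "\<And>\<omega>. \<omega> \<in> space M \<Longrightarrow> 0 \<le> X \<omega>"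
    and a: "0 < a" "a \<le> l" "a \<le> l'"
  shows "\<bar>(\<integral>\<omega>. exp (- l' * X \<omega>) \<partial>M) - (\<integral>\<omega>. exp (- l * X \<omega>) \<partial>M) + (l' - l) * (\<integral>\<omega>. X \<omega> * exp (- l * X \<omega>) \<partial>M)\<bar>
    \<le> 4 / a\<^sup>2 * (l' - l)\<^sup>2"
proof -
  interpret prob_space M by fact
  note [measurable] = X(1)
  have i: "integrable M (\<lambda>\<omega>. exp (- z * X \<omega>))" if "0 < z" for z
  proof (rule integrable_const_bound[where B=1])
    show "AE \<omega> in M. norm (exp (- z * X \<omega>)) \<le> 1"
      using mult_nonneg_nonneg[OF less_imp_le[OF that] X(2)] by (intro AE_I2) simp
  qed measurable
  have j: "integrable M (\<lambda>\<omega>. X \<omega> * exp (- z * X \<omega>))" if "0 < z" for z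
  proof (rule integrable_const_bound[where B="1 / z"])
    show "AE \<omega> in M. norm (X \<omega> * exp (- z * X \<omega>)) \<le> 1 / z"
    proof (rule AE_I2)
      fix \<omega> assume "\<omega> \<in> space M"
      from X(2)[OF this] mult_exp_bound(1)[OF that X(2)[OF this]]
      show "norm (X \<omega> * exp (- z * X \<omega>)) \<le> 1 / z" by (simp add: abs_mult)
    qed
  qed measurable
  let ?h = "\<lambda>\<omega>. exp (- l' * X \<omega>) - exp (- l * X \<omega>) + (l' - l) * (X \<omega> * exp (- l * X \<omega>))"
  have l: "0 < l" "0 < l'" using a by auto
  have ih: "integrable M ?h"
    by (intro Bochner_Integration.integrable_add Bochner_Integration.integrable_diff integrable_mult_right i j l)
  have b: "\<bar>?h \<omega>\<bar> \<le> 4 / a\<^sup>2 * (l' - l)\<^sup>2" if "\<omega> \<in> space M" for \<omega>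
    by (rule exp_second_order[OF a(1) X(2)[OF that] a(2,3)])
  have ae: "AE \<omega> in M. ?h \<omega> \<le> 4 / a\<^sup>2 * (l' - l)\<^sup>2" "AE \<omega> in M. - (4 / a\<^sup>2 * (l' - l)\<^sup>2) \<le> ?h \<omega>"
    by (rule AE_I2, rule abs_le_D1[OF b], assumption, rule AE_I2, rule minus_le_iff[THEN iffD1, OF abs_le_D2[OF b]], assumption)
  have "\<bar>\<integral>\<omega>. ?h \<omega> \<partial>M\<bar> \<le> 4 / a\<^sup>2 * (l' - l)\<^sup>2"
    using integral_le_const[OF ih ae(1)] integral_ge_const[OF ih ae(2)] by (intro abs_leI) linarith+
  moreover have "(\<integral>\<omega>. ?h \<omega> \<partial>M) = (\<integral>\<omega>. exp (- l' * X \<omega>) \<partial>M) - (\<integral>\<omega>. exp (- l * X \<omega>) \<partial>M)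
      + (l' - l) * (\<integral>\<omega>. X \<omega> * exp (- l * X \<omega>) \<partial>M)"
    using Bochner_Integration.integral_add[OF Bochner_Integration.integrable_diff[OF i[OF l(2)] i[OF l(1)]]
        integrable_mult_right[OF j[OF l(1)], of "l' - l"]]
      Bochner_Integration.integral_diff[OF i[OF l(2)] i[OF l(1)]] by simp
  ultimately show ?thesis by simp
qed

definition decay_const :: "real \<Rightarrow> real" where
  "decay_const l = (1 + l) * (1 + 1 / l + 4 / l\<^sup>2)"

lemma decay_exp_aux:
  fixes l y :: real
  assumes "0 < l" "0 \<le> y"
  shows "(1 + y) * exp (- l * y) \<le> 1 + 1 / l" "(1 + y) * (y * exp (- l * y)) \<le> 1 / l + 4 / l\<^sup>2"
proof -
  have *: "exp (- l * y) \<le> 1" using assms by simp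
  have "(1 + y) * exp (- l * y) = exp (- l * y) + y * exp (- l * y)"
    "(1 + y) * (y * exp (- l * y)) = y * exp (- l * y) + y\<^sup>2 * exp (- l * y)"
    by (simp_all add: distrib_right power2_eq_square)
  then show "(1 + y) * exp (- l * y) \<le> 1 + 1 / l" "(1 + y) * (y * exp (- l * y)) \<le> 1 / l + 4 / l\<^sup>2"
    using mult_exp_bound[OF assms] * by linarith+
qed

lemma decaying_exp:
  assumes l: "0 < l"
  shows "decaying (decay_const l) (\<lambda>y. exp (- l * y)) (\<lambda>y. - l * exp (- l * y))"
  unfolding decaying_def
proof (intro conjI allI impI)
  fix y :: real
  show "((\<lambda>y. exp (- l * y)) has_real_derivative - l * exp (- l * y)) (at y)"
    by (auto intro!: derivative_eq_intros)
  assume y: "0 \<le> y"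
  have *: "0 \<le> 1 / l" "0 \<le> 4 / l\<^sup>2" using l by auto
  have "(1 + y) * \<bar>exp (- l * y)\<bar> \<le> 1 * (1 + 1 / l + 4 / l\<^sup>2)"
    unfolding abs_exp_cancel mult_1 using decay_exp_aux(1)[OF l y] *(2) by linarith
  also have "\<dots> \<le> decay_const l"
    unfolding decay_const_def using l * by (intro mult_right_mono) auto
  finally show "(1 + y) * \<bar>exp (- l * y)\<bar> \<le> decay_const l" .
  have "(1 + y) * \<bar>- l * exp (- l * y)\<bar> = l * ((1 + y) * exp (- l * y))"
    using l by (simp add: abs_mult)
  also have "\<dots> \<le> (1 + l) * (1 + 1 / l + 4 / l\<^sup>2)"
  proof (rule mult_mono)
    show "(1 + y) * exp (- l * y) \<le> 1 + 1 / l + 4 / l\<^sup>2"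
      using decay_exp_aux(1)[OF l y] *(2) by linarith
  qed (use l y in auto)
  finally show "(1 + y) * \<bar>- l * exp (- l * y)\<bar> \<le> decay_const l" by (simp add: decay_const_def)
qed (intro continuous_intros)

lemma decaying_mult_exp:
  assumes l: "0 < l"
  shows "decaying (decay_const l) (\<lambda>y. y * exp (- l * y)) (\<lambda>y. exp (- l * y) - l * (y * exp (- l * y)))"
  unfolding decaying_def
proof (intro conjI allI impI)
  fix y :: real
  show "((\<lambda>y. y * exp (- l * y)) has_real_derivative exp (- l * y) - l * (y * exp (- l * y))) (at y)"
    by (auto intro!: derivative_eq_intros)
  assume y: "0 \<le> y"
  have *: "0 \<le> 1 / l" "0 \<le> 4 / l\<^sup>2" using l by auto
  have "(1 + y) * \<bar>y * exp (- l * y)\<bar> \<le> 1 * (1 + 1 / l + 4 / l\<^sup>2)"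
    using decay_exp_aux(2)[OF l y] * y by (simp add: abs_mult)
  also have "\<dots> \<le> decay_const l"
    unfolding decay_const_def using l * by (intro mult_right_mono) auto
  finally show "(1 + y) * \<bar>y * exp (- l * y)\<bar> \<le> decay_const l" .
  have "\<bar>exp (- l * y) - l * (y * exp (- l * y))\<bar> \<le> exp (- l * y) + l * (y * exp (- l * y))"
    using l y by (simp add: abs_le_iff)
  then have "(1 + y) * \<bar>exp (- l * y) - l * (y * exp (- l * y))\<bar> \<le> (1 + y) * (exp (- l * y) + l * (y * exp (- l * y)))"
    using y by (intro mult_left_mono) auto
  also have "\<dots> = (1 + y) * exp (- l * y) + l * ((1 + y) * (y * exp (- l * y)))"
    by (simp add: algebra_simps)
  also have "\<dots> \<le> 1 * (1 + 1 / l + 4 / l\<^sup>2) + l * (1 + 1 / l + 4 / l\<^sup>2)"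
  proof (intro add_mono mult_left_mono)
    show "(1 + y) * exp (- l * y) \<le> 1 * (1 + 1 / l + 4 / l\<^sup>2)"
      unfolding mult_1 using decay_exp_aux(1)[OF l y] *(2) by linarith
    show "(1 + y) * (y * exp (- l * y)) \<le> 1 + 1 / l + 4 / l\<^sup>2"
      using decay_exp_aux(2)[OF l y] by linarith
  qed (use l in auto)
  finally show "(1 + y) * \<bar>exp (- l * y) - l * (y * exp (- l * y))\<bar> \<le> decay_const l"
    by (simp add: decay_const_def distrib_right)
qed (intro continuous_intros)

section \<open>The Laplace transform of the process\<close>

context bandit_process
begin

lemma Y_borel: "0 \<le> y \<Longrightarrow> 0 \<le> t \<Longrightarrow> Y t \<in> borel_measurable (P y)"
  using Y_comp_measurable[of y t "\<lambda>x. x"] by simp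

text \<open>
  The integrand in Dynkin's formula is bounded by \<open>C * L_const\<close>.
\<close>

lemma expectation_lipschitz:
  assumes y: "0 \<le> y" and s: "0 \<le> s" "s \<le> t" and d: "decaying C f f'"
  shows "\<bar>(\<integral>\<omega>. f (Y t \<omega>) \<partial>P y) - (\<integral>\<omega>. f (Y s \<omega>) \<partial>P y)\<bar> \<le> C * L_const * (t - s)"
proof -
  let ?h = "\<lambda>r. \<integral>\<omega>. L f f' (Y r \<omega>) \<partial>P y"
  have t: "0 \<le> t" using s by simp
  note set_int = expectation_time_integral(3)[OF y _ L_continuous[OF d] L_bound[OF d]]
  have dyn: "(\<integral>\<omega>. f (Y r \<omega>) \<partial>P y) = f y + integral {0..r} ?h" if "0 \<le> r" for r
    using dynkin[OF y that d] set_borel_integral_eq_integral(2)[OF set_int[OF that]] by simp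
  have int: "?h integrable_on {0..t}"
    using set_borel_integral_eq_integral(1)[OF set_int[OF t]] .
  have "integral {0..s} ?h + integral {s..t} ?h = integral {0..t} ?h"
    by (rule Henstock_Kurzweil_Integration.integral_combine[OF s int])
  moreover have "norm (integral {s..t} ?h) \<le> C * L_const * (t - s)"
  proof -
    have i: "?h integrable_on {s..t}"
      by (rule integrable_on_subinterval[OF int]) (use s in auto)
    have b: "\<bar>?h r\<bar> \<le> C * L_const" if "r \<in> {s..t}" for r
      by (rule Y_comp_integral_bound[OF y _ L_continuous[OF d] L_bound[OF d]]) (use that s in auto)
    then have "0 \<le> C * L_const" using s by force
    then show ?thesis
      using has_integral_bound_real[OF _ finite.emptyI integrable_integral[OF i], of "C * L_const"] b s by simp
  qed
  ultimately show ?thesis using dyn[OF t] dyn[OF s(1)] by simp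
qed

lemma expectation_lipschitz':
  assumes y: "0 \<le> y" and s: "0 \<le> s" "0 \<le> t" and d: "decaying C f f'"
  shows "\<bar>(\<integral>\<omega>. f (Y t \<omega>) \<partial>P y) - (\<integral>\<omega>. f (Y s \<omega>) \<partial>P y)\<bar> \<le> C * L_const * \<bar>t - s\<bar>"
  using expectation_lipschitz[OF y _ _ d, of s t] expectation_lipschitz[OF y _ _ d, of t s] s
  by (cases "s \<le> t") (auto simp: abs_minus_commute)

lemma expectation_continuous:
  assumes y: "0 \<le> y" and d: "decaying C f f'"
  shows "continuous_on {0..} (\<lambda>t. \<integral>\<omega>. f (Y t \<omega>) \<partial>P y)"
proof -
  have "lipschitz_on (\<bar>C * L_const\<bar>) {0..} (\<lambda>t. \<integral>\<omega>. f (Y t \<omega>) \<partial>P y)"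
  proof (rule lipschitz_onI)
    fix s t :: real assume "s \<in> {0..}" "t \<in> {0..}"
    then have "\<bar>(\<integral>\<omega>. f (Y s \<omega>) \<partial>P y) - (\<integral>\<omega>. f (Y t \<omega>) \<partial>P y)\<bar> \<le> C * L_const * \<bar>s - t\<bar>"
      using expectation_lipschitz'[OF y _ _ d, of t s] by auto
    also have "\<dots> \<le> \<bar>C * L_const\<bar> * \<bar>s - t\<bar>" by (intro mult_right_mono) auto
    finally show "dist (\<integral>\<omega>. f (Y s \<omega>) \<partial>P y) (\<integral>\<omega>. f (Y t \<omega>) \<partial>P y) \<le> \<bar>C * L_const\<bar> * dist s t"
      by (simp add: dist_real_def)
  qed simp
  then show ?thesis by (rule lipschitz_on_continuous_on)
qed

definition laplace :: "real \<Rightarrow> real \<Rightarrow> real \<Rightarrow> real" where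
  "laplace y t l = (\<integral>\<omega>. exp (- l * Y t \<omega>) \<partial>P y)"

definition tilted_mean :: "real \<Rightarrow> real \<Rightarrow> real \<Rightarrow> real" where
  "tilted_mean y t l = (\<integral>\<omega>. Y t \<omega> * exp (- l * Y t \<omega>) \<partial>P y)"

lemma L_exp: "L (\<lambda>y. exp (- l * y)) (\<lambda>y. - l * exp (- l * y)) y
    = R l * (y * exp (- l * y)) - (1 - p\<^sub>A) * l * exp (- l * y)"
proof -
  have "exp (- l * (y + g)) = exp (- l * y) * exp (- l * g)"
    by (simp add: algebra_simps flip: exp_add)
  then show ?thesis using g by (simp add: L_def R_def field_simps)
qed

lemma laplace_time_derivative:
  assumes y: "0 \<le> y" and l: "0 < l" and t: "t \<in> {0..T}"
  shows "((\<lambda>t. laplace y t l) has_real_derivative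
    R l * tilted_mean y t l - (1 - p\<^sub>A) * l * laplace y t l) (at t within {0..T})"
proof -
  let ?f = "\<lambda>y. exp (- l * y)" and ?f' = "\<lambda>y. - l * exp (- l * y)"
  note d = decaying_exp[OF l] and d2 = decaying_mult_exp[OF l]
  let ?h = "\<lambda>t. R l * tilted_mean y t l - (1 - p\<^sub>A) * l * laplace y t l"
  have EL: "(\<integral>\<omega>. L ?f ?f' (Y s \<omega>) \<partial>P y) = ?h s" if s: "0 \<le> s" for s
    unfolding L_exp laplace_def tilted_mean_def
    using Y_comp_integrable[OF y s decaying_continuous[OF d] decaying_bounded(1)[OF d]]
      Y_comp_integrable[OF y s decaying_continuous[OF d2] decaying_bounded(1)[OF d2]]
    by (subst Bochner_Integration.integral_diff) auto
  have c: "continuous_on {0..T} ?h"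
    unfolding laplace_def tilted_mean_def
    by (intro continuous_intros continuous_on_subset[OF expectation_continuous[OF y d]]
        continuous_on_subset[OF expectation_continuous[OF y d2]]) auto
  have eq: "laplace y s l = ?f y + integral {0..s} ?h" if s: "0 \<le> s" for s
  proof -
    have "laplace y s l = ?f y + (LINT r:{0..s}|lborel. (\<integral>\<omega>. L ?f ?f' (Y r \<omega>) \<partial>P y))"
      unfolding laplace_def by (rule dynkin[OF y s d])
    also have "\<dots> = ?f y + integral {0..s} (\<lambda>r. \<integral>\<omega>. L ?f ?f' (Y r \<omega>) \<partial>P y)"
      using set_borel_integral_eq_integral(2)[OF expectation_time_integral(3)[OF y s L_continuous[OF d] L_bound[OF d]]]
      by simp
    also have "integral {0..s} (\<lambda>r. \<integral>\<omega>. L ?f ?f' (Y r \<omega>) \<partial>P y) = integral {0..s} ?h"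
      by (rule integral_cong) (use EL in auto)
    finally show ?thesis .
  qed
  have "((\<lambda>s. ?f y + integral {0..s} ?h) has_real_derivative 0 + ?h t) (at t within {0..T})"
    by (intro DERIV_add DERIV_const integral_has_real_derivative c t)
  then have "((\<lambda>s. ?f y + integral {0..s} ?h) has_real_derivative ?h t) (at t within {0..T})" by simp
  then show ?thesis
    by (rule has_field_derivative_transform_within[OF _ zero_less_one t]) (use eq in auto)
qed

text \<open>
  By \<open>laplace_time_derivative\<close> and differentiation under the integral,
  \<open>\<partial>\<^sub>t F + R l * \<partial>\<^sub>l F = - (1 - p\<^sub>A) * l * F\<close> for the Laplace transform \<open>F t l\<close>; a curve moving with speed
  \<open>R l\<close> sees only the right-hand side.
\<close>

lemma laplace_along_characteristic:
  assumes y: "0 \<le> y" and s: "s \<in> {0..T}" and l: "0 < l s"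
    and l': "(l has_real_derivative R (l s)) (at s)"
  shows "((\<lambda>t. laplace y t (l t)) has_real_derivative - ((1 - p\<^sub>A) * l s * laplace y s (l s))) (at s within {0..T})"
proof -
  let ?A = "at s within {0..T}"
  define l0 a where "l0 = l s" and "a = l s / 2"
  have a: "0 < a" "a \<le> l0" "0 < l0" "a < l0" using l by (auto simp: a_def l0_def)
  define D where "D = tilted_mean y s l0"
  define K where "K = decay_const l0 * L_const"
  \<comment> \<open>The deviation from the first-order expansion in \<open>l\<close>; it is of order \<open>(t - s)\<^sup>2\<close>.\<close>
  define G where "G t = laplace y t (l t) - laplace y t l0 + D * (l t - l0)" for t
  have lW: "(l has_real_derivative R l0) ?A"
    using l' unfolding l0_def by (rule has_field_derivative_at_within)
  then have lcont: "(l \<longlongrightarrow> l0) ?A"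
    using has_field_derivative_imp_has_derivative has_derivative_continuous continuous_within l0_def by blast
  have lq: "((\<lambda>t. (l t - l0) / (t - s)) \<longlongrightarrow> R l0) ?A"
    using lW by (simp add: has_field_derivative_iff l0_def)
  have Gb: "\<bar>G t\<bar> \<le> 4 / a\<^sup>2 * (l t - l0)\<^sup>2 + K * \<bar>t - s\<bar> * \<bar>l t - l0\<bar>" if t: "t \<in> {0..T}" "a \<le> l t" for t
  proof -
    have t0: "0 \<le> t" "0 \<le> s" using t s by auto
    have 1: "\<bar>laplace y t (l t) - laplace y t l0 + (l t - l0) * tilted_mean y t l0\<bar> \<le> 4 / a\<^sup>2 * (l t - l0)\<^sup>2"
      unfolding laplace_def tilted_mean_def
      by (rule laplace_second_order[OF prob_P[OF y] Y_borel[OF y t0(1)] _ a(1,2) t(2)])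
         (use Y_nonneg[OF t0(1)] space_P[OF y] in auto)
    have "\<bar>D - tilted_mean y t l0\<bar> \<le> K * \<bar>s - t\<bar>"
      using expectation_lipschitz'[OF y t0 decaying_mult_exp[OF a(3)]]
      by (simp add: D_def tilted_mean_def K_def)
    then have "\<bar>D - tilted_mean y t l0\<bar> * \<bar>l t - l0\<bar> \<le> K * \<bar>t - s\<bar> * \<bar>l t - l0\<bar>"
      by (intro mult_right_mono) (auto simp: abs_minus_commute)
    then have 2: "\<bar>(D - tilted_mean y t l0) * (l t - l0)\<bar> \<le> K * \<bar>t - s\<bar> * \<bar>l t - l0\<bar>"
      by (simp add: abs_mult)
    have "G t = (laplace y t (l t) - laplace y t l0 + (l t - l0) * tilted_mean y t l0)
        + (D - tilted_mean y t l0) * (l t - l0)"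
      by (simp add: G_def algebra_simps)
    then show ?thesis using 1 2 by linarith
  qed
  have Gs: "G s = 0" by (simp add: G_def l0_def)
  have "(G has_real_derivative 0) ?A"
    unfolding has_field_derivative_iff Gs diff_zero
  proof (rule Lim_null_comparison)
    have "((\<lambda>t. (4 / a\<^sup>2 * \<bar>l t - l0\<bar> + K * \<bar>t - s\<bar>) * \<bar>(l t - l0) / (t - s)\<bar>) \<longlongrightarrow>
      (4 / a\<^sup>2 * \<bar>l0 - l0\<bar> + K * \<bar>s - s\<bar>) * \<bar>R l0\<bar>) ?A"
      by (intro tendsto_intros lcont lq)
    then show "((\<lambda>t. (4 / a\<^sup>2 * \<bar>l t - l0\<bar> + K * \<bar>t - s\<bar>) * \<bar>(l t - l0) / (t - s)\<bar>) \<longlongrightarrow> 0) ?A"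
      by simp
    have ev1: "\<forall>\<^sub>F t in ?A. a < l t" by (rule order_tendstoD(1)[OF lcont a(4)])
    have ev2: "\<forall>\<^sub>F t in ?A. t \<in> {0..T} \<and> t \<noteq> s" by (auto simp: eventually_at_filter)
    show "\<forall>\<^sub>F t in ?A. norm (G t / (t - s)) \<le> (4 / a\<^sup>2 * \<bar>l t - l0\<bar> + K * \<bar>t - s\<bar>) * \<bar>(l t - l0) / (t - s)\<bar>"
      using ev1 ev2
    proof eventually_elim
      case (elim t)
      then have "\<bar>G t\<bar> / \<bar>t - s\<bar> \<le> (4 / a\<^sup>2 * (l t - l0)\<^sup>2 + K * \<bar>t - s\<bar> * \<bar>l t - l0\<bar>) / \<bar>t - s\<bar>"
        by (intro divide_right_mono Gb) auto
      also have "\<dots> = (4 / a\<^sup>2 * \<bar>l t - l0\<bar> + K * \<bar>t - s\<bar>) * \<bar>(l t - l0) / (t - s)\<bar>"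
      proof -
        have "(l t - l0)\<^sup>2 = \<bar>l t - l0\<bar> * \<bar>l t - l0\<bar>" by (simp add: power2_eq_square)
        then show ?thesis by (simp add: abs_divide distrib_right add_divide_distrib)
      qed
      finally show ?case by (simp add: abs_divide)
    qed
  qed
  moreover have "((\<lambda>t. laplace y t l0) has_real_derivative R l0 * D - (1 - p\<^sub>A) * l0 * laplace y s l0) ?A"
    unfolding D_def by (rule laplace_time_derivative[OF y a(3) s])
  moreover have "((\<lambda>t. D * (l t - l0)) has_real_derivative D * R l0) ?A"
    using lW by (auto intro!: derivative_eq_intros)
  ultimately have "((\<lambda>t. G t + laplace y t l0 - D * (l t - l0)) has_real_derivative
      0 + (R l0 * D - (1 - p\<^sub>A) * l0 * laplace y s l0) - D * R l0) ?A"
    by (intro DERIV_add DERIV_diff)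
  then show ?thesis by (simp add: G_def l0_def mult.commute)
qed

text \<open>
  Since \<open>Q' l = l / R l\<close>, the factor \<open>exp ((1 - p\<^sub>A) * Q l)\<close> absorbs the decay along a characteristic, and the
  product is constant.
\<close>

lemma laplace_formula:
  assumes y: "0 \<le> y" and t: "0 \<le> t"
    and \<psi>: "\<And>t. 0 < \<psi> t" "\<And>t. (\<psi> has_real_derivative - R (\<psi> t)) (at t)"
  shows "laplace y t (\<psi> 0) = exp (- y * \<psi> t) * exp ((1 - p\<^sub>A) * (Q (\<psi> t) - Q (\<psi> 0)))"
proof -
  define l where "l s = \<psi> (t - s)" for s
  have l: "0 < l s" for s by (simp add: l_def \<psi>(1))
  have l': "(l has_real_derivative R (l s)) (at s)" for s
  proof -
    have "((\<lambda>s. t - s) has_real_derivative - 1) (at s)" by (auto intro!: derivative_eq_intros)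
    from DERIV_chain2[OF \<psi>(2) this] show ?thesis by (simp add: l_def[abs_def])
  qed
  define \<Phi> where "\<Phi> s = laplace y s (l s) * exp ((1 - p\<^sub>A) * Q (l s))" for s
  have "(\<Phi> has_real_derivative 0) (at s within {0..t})" if s: "s \<in> {0..t}" for s
  proof -
    have "((\<lambda>s. Q (l s)) has_real_derivative (l s / R (l s)) * R (l s)) (at s)"
      by (rule DERIV_chain2[OF Q_deriv[OF l] l'])
    then have Ql: "((\<lambda>s. Q (l s)) has_real_derivative l s) (at s)"
      using R_pos[OF l[of s]] by simp
    have "((\<lambda>s. exp ((1 - p\<^sub>A) * Q (l s))) has_real_derivative
        exp ((1 - p\<^sub>A) * Q (l s)) * ((1 - p\<^sub>A) * l s)) (at s within {0..t})"
      by (rule has_field_derivative_at_within) (auto intro!: derivative_eq_intros Ql)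
    from DERIV_mult[OF laplace_along_characteristic[OF y s l l'] this]
    show ?thesis unfolding \<Phi>_def by (simp add: algebra_simps)
  qed
  then obtain k where k: "\<And>s. s \<in> {0..t} \<Longrightarrow> \<Phi> s = k"
    using has_field_derivative_zero_constant[of "{0..t}" \<Phi>] by auto
  have "\<Phi> t = \<Phi> 0" using k[of t] k[of 0] t by simp
  moreover have "laplace y 0 (l 0) = exp (- y * \<psi> t)"
    unfolding laplace_def
    by (subst Y_comp_start[OF y decaying_continuous[OF decaying_exp[OF l]]]) (simp add: l_def mult.commute)
  ultimately have "laplace y t (\<psi> 0) * exp ((1 - p\<^sub>A) * Q (\<psi> 0)) = exp (- y * \<psi> t) * exp ((1 - p\<^sub>A) * Q (\<psi> t))"
    by (simp add: \<Phi>_def l_def)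
  then show ?thesis
    unfolding right_diff_distrib exp_diff by (simp add: nonzero_eq_divide_eq mult.assoc)
qed

end

section \<open>Laplace transforms on the half-line determine laws and limits\<close>

lemma measurable_exp_state_space:
  "sets M = sets state_space \<Longrightarrow> (\<lambda>y. exp (- l * y)) \<in> borel_measurable M" for l :: real
  by (rule borel_imp_measurable_state_space) measurable

lemma integrable_exp_state_space:
  fixes l :: real
  assumes "prob_space M" "sets M = sets state_space" "0 \<le> l"
  shows "integrable M (\<lambda>y. exp (- l * y))"
proof -
  interpret prob_space M by fact
  show ?thesis
  proof (rule integrable_const_bound[where B=1])
    show "AE y in M. norm (exp (- l * y)) \<le> 1"
      using assms(3) by (intro AE_I2) (simp add: space_of_sets_state_space[OF assms(2)])
  qed (rule measurable_exp_state_space[OF assms(2)])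
qed

lemma laplace_determines:
  assumes M: "prob_space M" "sets M = sets state_space" and N: "prob_space N" "sets N = sets state_space"
    and eq: "\<And>l. 0 < l \<Longrightarrow> (\<integral>y. exp (- l * y) \<partial>M) = (\<integral>y. exp (- l * y) \<partial>N)"
  shows "M = N"
proof (rule measure_eqI)
  interpret M: prob_space M by fact
  interpret N: prob_space N by fact
  show "sets M = sets N" using M N by simp
  fix A assume A: "A \<in> sets M"
  then have AN: "A \<in> sets N" and Ab: "A \<in> sets borel" using M N by (auto simp: sets_state_space)
  have "(\<integral>y. indicator A y * 1 \<partial>M) = (\<integral>y. indicator A y * (1::real) \<partial>N)"
  proof (rule signed_laplace_unique[OF M(2) N(2) _ _ _ Ab])
    fix n :: nat
    show "(\<integral>y. exp (- real n * y) * 1 \<partial>M) = (\<integral>y. exp (- real n * y) * 1 \<partial>N)"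
      using eq[of "real n"] by (cases "n = 0") (auto simp: M.prob_space N.prob_space)
  qed auto
  then show "emeasure M A = emeasure N A"
    using A AN by (simp add: M.emeasure_eq_measure N.emeasure_eq_measure)
qed

text \<open>
  Damping \<open>f\<close> by \<open>exp (- l * y)\<close> makes it vanish at infinity, hence approximable. The price of the damping is
  at most \<open>B * (1 - exp (- l * y))\<close>, whose integral is again given by the Laplace transform. The coefficients are
  chosen before \<open>M\<close>, so the estimate is uniform over all laws.
\<close>

lemma exp_poly_truncation:
  fixes f :: "real \<Rightarrow> real"
  assumes f: "continuous_on {0..} f" and B: "\<And>y. 0 \<le> y \<Longrightarrow> \<bar>f y\<bar> \<le> B"
    and l: "0 < l" and e: "0 < e"
  obtains a :: "nat \<Rightarrow> real" and n :: nat where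
    "\<And>M. prob_space M \<Longrightarrow> sets M = sets state_space \<Longrightarrow>
      \<bar>(\<integral>y. f y \<partial>M) - (\<Sum>k\<le>n. a k * (\<integral>y. exp (- real k * y) \<partial>M))\<bar> \<le> e + B * (1 - (\<integral>y. exp (- l * y) \<partial>M))"
proof -
  have "continuous_on {0..} (\<lambda>y. f y * exp (- l * y))"
    by (intro continuous_intros f)
  moreover have "((\<lambda>y. f y * exp (- l * y)) \<longlongrightarrow> 0) at_top"
  proof (rule Lim_null_comparison)
    have "filterlim (\<lambda>y. l * y) at_top at_top"
      by (rule filterlim_tendsto_pos_mult_at_top[OF tendsto_const l filterlim_ident])
    then have "filterlim (\<lambda>y. - l * y) at_bot at_top"
      using filterlim_uminus_at_top by fastforce
    then have "((\<lambda>y. exp (- l * y)) \<longlongrightarrow> 0) at_top"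
      by (rule filterlim_compose[OF exp_at_bot])
    then show "((\<lambda>y. B * exp (- l * y)) \<longlongrightarrow> 0) at_top"
      by (rule tendsto_mult_right_zero)
    show "\<forall>\<^sub>F y in at_top. norm (f y * exp (- l * y)) \<le> B * exp (- l * y)"
      using eventually_ge_at_top[of 0] by eventually_elim (simp add: abs_mult B)
  qed
  ultimately obtain a n where an: "\<And>y. 0 \<le> y \<Longrightarrow> \<bar>f y * exp (- l * y) - (\<Sum>k\<le>n. a k * exp (- real k * y))\<bar> < e"
    using exp_poly_approx[of "\<lambda>y. f y * exp (- l * y)" e] e by blast
  show thesis
  proof (rule that[of a n])
    fix M :: "real measure" assume M: "prob_space M" "sets M = sets state_space"
    interpret prob_space M by fact
    note sp = space_of_sets_state_space[OF M(2)]
    let ?p = "\<lambda>y. \<Sum>k\<le>n. a k * exp (- real k * y)"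
    have ie: "integrable M (\<lambda>y. exp (- z * y))" if "0 \<le> z" for z
      by (rule integrable_exp_state_space[OF M that])
    have if': "integrable M f"
    proof (rule integrable_const_bound[where B=B])
      show "AE y in M. norm (f y) \<le> B" using B by (intro AE_I2) (simp add: sp)
    qed (rule continuous_imp_measurable_state_space[OF M(2) f])
    have ip: "integrable M ?p"
      by (intro Bochner_Integration.integrable_sum integrable_mult_right ie) simp
    have int_p: "(\<integral>y. ?p y \<partial>M) = (\<Sum>k\<le>n. a k * (\<integral>y. exp (- real k * y) \<partial>M))"
      unfolding Bochner_Integration.integral_sum[OF integrable_mult_right[OF ie[OF of_nat_0_le_iff]]] by simp
    have bound: "\<bar>f y - ?p y\<bar> \<le> e + B * (1 - exp (- l * y))" if y: "0 \<le> y" for y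
    proof -
      have "0 \<le> 1 - exp (- l * y)" using y l by simp
      then have "\<bar>f y\<bar> * (1 - exp (- l * y)) \<le> B * (1 - exp (- l * y))"
        by (intro mult_right_mono B y)
      moreover have "\<bar>f y * (1 - exp (- l * y))\<bar> = \<bar>f y\<bar> * (1 - exp (- l * y))"
        using \<open>0 \<le> 1 - exp (- l * y)\<close> by (simp add: abs_mult)
      moreover have "f y * (1 - exp (- l * y)) = f y - f y * exp (- l * y)"
        by (simp add: right_diff_distrib)
      ultimately show ?thesis using an[OF y] by linarith
    qed
    have "norm (\<integral>y. f y - ?p y \<partial>M) \<le> (\<integral>y. norm (f y - ?p y) \<partial>M)"
      by (rule integral_norm_bound)
    also have "\<dots> \<le> (\<integral>y. e + B * (1 - exp (- l * y)) \<partial>M)"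
    proof (rule integral_mono)
      show "integrable M (\<lambda>y. norm (f y - ?p y))" using if' ip by simp
      show "integrable M (\<lambda>y. e + B * (1 - exp (- l * y)))"
        using ie[of l] l by simp
      show "norm (f y - ?p y) \<le> e + B * (1 - exp (- l * y))" if "y \<in> space M" for y
        using bound that by (simp add: sp)
    qed
    also have "\<dots> = e + B * (1 - (\<integral>y. exp (- l * y) \<partial>M))"
      using ie[of l] l by (simp add: prob_space)
    also have "(\<integral>y. f y - ?p y \<partial>M) = (\<integral>y. f y \<partial>M) - (\<Sum>k\<le>n. a k * (\<integral>y. exp (- real k * y) \<partial>M))"
      using Bochner_Integration.integral_diff[OF if' ip] int_p by simp
    finally show "\<bar>(\<integral>y. f y \<partial>M) - (\<Sum>k\<le>n. a k * (\<integral>y. exp (- real k * y) \<partial>M))\<bar>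
        \<le> e + B * (1 - (\<integral>y. exp (- l * y) \<partial>M))" by simp
  qed
qed

section \<open>Existence, uniqueness and attraction of the stationary law\<close>

context bandit_process
begin

text \<open>
  The formula for the Laplace transform in the shape in which the limit \<open>t \<rightarrow> \<infinity>\<close> can be read off: of its three
  factors only \<open>\<Lambda> l\<close> survives.
\<close>

lemma laplace_flow_limit:
  assumes l: "0 < l"
  obtains \<psi> where "\<And>t. 0 < \<psi> t" "(\<psi> \<longlongrightarrow> 0) at_top" "((\<lambda>t. exp ((1 - p\<^sub>A) * Q (\<psi> t))) \<longlongrightarrow> 1) at_top"
    "\<And>y t. 0 \<le> y \<Longrightarrow> 0 \<le> t \<Longrightarrow> laplace y t l = exp (- \<psi> t * y) * (exp ((1 - p\<^sub>A) * Q (\<psi> t)) * \<Lambda> l)"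
proof -
  obtain \<psi> where \<psi>: "\<psi> 0 = l" "\<And>t. 0 < \<psi> t" "\<And>t. (\<psi> has_real_derivative - R (\<psi> t)) (at t)"
    "\<And>t. 0 \<le> t \<Longrightarrow> \<psi> t \<le> l * exp (- (p\<^sub>A - p\<^sub>B) * t)"
    using riccati_flow[OF l] by blast
  have lim: "(\<psi> \<longlongrightarrow> 0) at_top"
  proof (rule Lim_null_comparison)
    have "filterlim (\<lambda>t. (p\<^sub>A - p\<^sub>B) * t) at_top at_top"
      by (rule filterlim_tendsto_pos_mult_at_top[OF tendsto_const _ filterlim_ident]) (use pAB in simp)
    then have "filterlim (\<lambda>t. - ((p\<^sub>A - p\<^sub>B) * t)) at_bot at_top"
      using filterlim_uminus_at_top by fastforce
    then have "((\<lambda>t. exp (- ((p\<^sub>A - p\<^sub>B) * t))) \<longlongrightarrow> 0) at_top"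
      by (rule filterlim_compose[OF exp_at_bot])
    then show "((\<lambda>t. l * exp (- (p\<^sub>A - p\<^sub>B) * t)) \<longlongrightarrow> 0) at_top"
      unfolding mult_minus_left by (rule tendsto_mult_right_zero)
    show "\<forall>\<^sub>F t in at_top. norm (\<psi> t) \<le> l * exp (- (p\<^sub>A - p\<^sub>B) * t)"
      using eventually_ge_at_top[of 0] by eventually_elim (use \<psi>(2,4) in \<open>simp add: less_imp_le\<close>)
  qed
  have "filterlim \<psi> (at_right 0) at_top"
    using lim \<psi>(2) by (auto simp: filterlim_at less_imp_neq[symmetric])
  then have "((\<lambda>t. Q (\<psi> t)) \<longlongrightarrow> 0) at_top"
    by (rule filterlim_compose[OF Q_tendsto_0])
  then have "((\<lambda>t. exp ((1 - p\<^sub>A) * Q (\<psi> t))) \<longlongrightarrow> exp ((1 - p\<^sub>A) * 0)) at_top"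
    by (intro tendsto_intros)
  then have lim2: "((\<lambda>t. exp ((1 - p\<^sub>A) * Q (\<psi> t))) \<longlongrightarrow> 1) at_top" by simp
  have "laplace y t l = exp (- \<psi> t * y) * (exp ((1 - p\<^sub>A) * Q (\<psi> t)) * \<Lambda> l)" if "0 \<le> y" "0 \<le> t" for y t
    using laplace_formula[OF that \<psi>(2,3)] \<psi>(1)
    by (simp add: \<Lambda>_def algebra_simps flip: exp_add)
  with \<psi>(2) lim lim2 show thesis by (rule that)
qed

text \<open>
  The transform is monotone in the starting point, so it suffices to control it at both ends of \<open>{0..b}\<close>.
\<close>

lemma laplace_converges_uniformly:
  assumes l: "0 < l" and b: "0 \<le> b" and e: "0 < e"
  shows "\<forall>\<^sub>F t in at_top. \<forall>y\<in>{0..b}. \<bar>laplace y t l - \<Lambda> l\<bar> < e"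
proof -
  obtain \<psi> where \<psi>: "\<And>t. 0 < \<psi> t" "(\<psi> \<longlongrightarrow> 0) at_top" "((\<lambda>t. exp ((1 - p\<^sub>A) * Q (\<psi> t))) \<longlongrightarrow> 1) at_top"
    "\<And>y t. 0 \<le> y \<Longrightarrow> 0 \<le> t \<Longrightarrow> laplace y t l = exp (- \<psi> t * y) * (exp ((1 - p\<^sub>A) * Q (\<psi> t)) * \<Lambda> l)"
    using laplace_flow_limit[OF l] by blast
  define G where "G t = exp ((1 - p\<^sub>A) * Q (\<psi> t)) * \<Lambda> l" for t
  have G: "(G \<longlongrightarrow> 1 * \<Lambda> l) at_top"
    unfolding G_def by (intro tendsto_intros \<psi>(3))
  have "((\<lambda>t. exp (- \<psi> t * b) * G t) \<longlongrightarrow> exp (- 0 * b) * (1 * \<Lambda> l)) at_top"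
    by (intro tendsto_intros \<psi>(2) G)
  then have lo: "((\<lambda>t. exp (- \<psi> t * b) * G t) \<longlongrightarrow> \<Lambda> l) at_top" by simp
  have "\<forall>\<^sub>F t in at_top. \<Lambda> l - e < exp (- \<psi> t * b) * G t"
    by (rule order_tendstoD(1)[OF lo]) (use e in simp)
  moreover have "\<forall>\<^sub>F t in at_top. G t < \<Lambda> l + e"
    by (rule order_tendstoD(2)[OF G]) (use e in simp)
  ultimately show ?thesis
    using eventually_ge_at_top[of 0]
  proof eventually_elim
    case (elim t)
    show ?case
    proof
      fix y assume y: "y \<in> {0..b}"
      have "0 \<le> G t" using \<Lambda>_bounds[OF l] by (simp add: G_def)
      have "exp (- \<psi> t * b) * G t \<le> exp (- \<psi> t * y) * G t"
        using y \<psi>(1)[of t] \<open>0 \<le> G t\<close> by (intro mult_right_mono) auto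
      moreover have "exp (- \<psi> t * y) * G t \<le> 1 * G t"
        using y \<psi>(1)[of t] \<open>0 \<le> G t\<close> by (intro mult_right_mono) auto
      moreover have "laplace y t l = exp (- \<psi> t * y) * G t"
        unfolding G_def by (rule \<psi>(4)) (use y elim in auto)
      ultimately show "\<bar>laplace y t l - \<Lambda> l\<bar> < e" using elim by linarith
    qed
  qed
qed

lemma transition_prob:
  assumes "0 \<le> y" "0 \<le> t"
  shows "prob_space (transition P Y t y)" "sets (transition P Y t y) = sets state_space"
  unfolding transition_def
  using prob_space.prob_space_distr[OF prob_P[OF assms(1)] Y_measurable[OF assms]] by auto

lemma integral_transition:
  fixes f :: "real \<Rightarrow> real"
  assumes "0 \<le> y" "0 \<le> t" "continuous_on {0..} f"
  shows "(\<integral>x. f x \<partial>transition P Y t y) = (\<integral>\<omega>. f (Y t \<omega>) \<partial>P y)"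
  unfolding transition_def
  by (rule integral_distr[OF Y_measurable[OF assms(1,2)] continuous_imp_measurable_state_space[OF refl assms(3)]])

lemma laplace_transition:
  "0 \<le> y \<Longrightarrow> 0 \<le> t \<Longrightarrow> (\<integral>x. exp (- l * x) \<partial>transition P Y t y) = laplace y t l"
  unfolding laplace_def by (rule integral_transition) (auto intro!: continuous_intros)

text \<open>
  Markov's inequality for \<open>1 - exp (- l * Y t)\<close>, combined with the fact that the transform started at \<open>0\<close> stays above its
  limit. The bound does not depend on \<open>t\<close>, which yields tightness.
\<close>

lemma laplace_tail:
  assumes l: "0 < l" and n: "0 \<le> t"
  shows "(1 - exp (- 1)) * measure (distr (P 0) borel (Y t)) {1 / l<..} \<le> 1 - \<Lambda> l"
proof -
  interpret prob_space "P 0" using prob_P[of 0] by simp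
  have Yb[measurable]: "Y t \<in> borel_measurable (P 0)" by (rule Y_borel) (use n in auto)
  have Y0: "0 \<le> Y t \<omega>" if "\<omega> \<in> space (P 0)" for \<omega>
    using Y_nonneg[OF n] that space_P[of 0] by simp
  let ?A = "Y t -` {1 / l<..} \<inter> space (P 0)"
  have A: "?A \<in> events" by measurable
  have ie: "integrable (P 0) (\<lambda>\<omega>. exp (- l * Y t \<omega>))"
  proof (rule integrable_const_bound[where B=1])
    show "AE \<omega> in P 0. norm (exp (- l * Y t \<omega>)) \<le> 1"
      using mult_nonneg_nonneg[OF less_imp_le[OF l] Y0] by (intro AE_I2) simp
  qed measurable
  have "(\<integral>\<omega>. (1 - exp (- 1)) * indicator ?A \<omega> \<partial>P 0) \<le> (\<integral>\<omega>. 1 - exp (- l * Y t \<omega>) \<partial>P 0)"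
  proof (rule integral_mono)
    have "integrable (P 0) (indicator ?A :: _ \<Rightarrow> real)"
      by (rule integrable_real_indicator[OF A]) (simp add: emeasure_eq_measure)
    then show "integrable (P 0) (\<lambda>\<omega>. (1 - exp (- 1 :: real)) * indicator ?A \<omega>)"
      by (rule integrable_mult_right)
    show "integrable (P 0) (\<lambda>\<omega>. 1 - exp (- l * Y t \<omega>))" using ie by simp
    fix \<omega> assume \<omega>: "\<omega> \<in> space (P 0)"
    show "(1 - exp (- 1)) * indicator ?A \<omega> \<le> 1 - exp (- l * Y t \<omega>)"
    proof (cases "1 / l < Y t \<omega>")
      case True
      then have "1 \<le> l * Y t \<omega>" using l by (simp add: field_simps)
      then show ?thesis using True \<omega> by simp
    next
      case False
      have "0 \<le> l * Y t \<omega>" using mult_nonneg_nonneg[OF less_imp_le[OF l] Y0[OF \<omega>]] .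
      then show ?thesis using False by simp
    qed
  qed
  then have "(1 - exp (- 1)) * prob ?A \<le> 1 - laplace 0 t l"
    using A ie by (simp add: laplace_def prob_space)
  moreover have "\<Lambda> l \<le> laplace 0 t l"
  proof -
    obtain \<psi> where \<psi>: "\<And>t. 0 < \<psi> t" "(\<psi> \<longlongrightarrow> 0) at_top" "((\<lambda>t. exp ((1 - p\<^sub>A) * Q (\<psi> t))) \<longlongrightarrow> 1) at_top"
      "\<And>y t. 0 \<le> y \<Longrightarrow> 0 \<le> t \<Longrightarrow> laplace y t l = exp (- \<psi> t * y) * (exp ((1 - p\<^sub>A) * Q (\<psi> t)) * \<Lambda> l)"
      using laplace_flow_limit[OF l] by blast
    have "0 \<le> (1 - p\<^sub>A) * Q (\<psi> t)"
      using Q_bounds(1)[OF less_imp_le[OF \<psi>(1)]] pA1 by (intro mult_nonneg_nonneg) auto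
    then have "1 * \<Lambda> l \<le> exp ((1 - p\<^sub>A) * Q (\<psi> t)) * \<Lambda> l"
      using \<Lambda>_bounds(1)[OF l] by (intro mult_right_mono) auto
    then show ?thesis using \<psi>(4)[of 0 t] n by simp
  qed
  ultimately show ?thesis
    by (simp add: measure_distr)
qed

text \<open>
  Helly's theorem gives a limit point of the laws of \<open>Y n\<close> started at \<open>0\<close>. It is a law on the whole line, and it is
  pushed to the half-line by \<open>max 0\<close>; this leaves the integrals of the functions
  \<open>exp (- l * max 0 x)\<close> unchanged.
\<close>

lemma limit_law_exists:
  obtains \<nu> where "prob_space \<nu>" "sets \<nu> = sets state_space" "\<And>l. 0 < l \<Longrightarrow> (\<integral>x. exp (- l * x) \<partial>\<nu>) = \<Lambda> l"
proof -
  define \<mu> where "\<mu> n = distr (P 0) borel (Y (real n))" for n :: nat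
  interpret P0: prob_space "P 0" using prob_P[of 0] by simp
  have Yb[measurable]: "Y (real n) \<in> borel_measurable (P 0)" for n by (rule Y_borel) auto
  have Y0: "0 \<le> Y (real n) \<omega>" if "\<omega> \<in> space (P 0)" for n \<omega>
    using Y_nonneg[of "real n"] that space_P[of 0] by simp
  have \<mu>: "real_distribution (\<mu> n)" for n
    unfolding \<mu>_def by (rule P0.real_distribution_distr) (rule Yb)
  have "tight \<mu>"
    unfolding tight_def
  proof (intro conjI allI impI \<mu>)
    fix e :: real assume e: "0 < e"
    have e1: "0 < 1 - exp (- 1 :: real)" by simp
    obtain l where l: "0 < l" "1 - \<Lambda> l < (1 - exp (- 1)) * e"
      using \<Lambda>_near_1[of "(1 - exp (- 1)) * e"] e e1 by (metis mult_pos_pos)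
    have "measure (\<mu> n) {- 1<..1 / l} > 1 - e" for n
    proof -
      interpret \<mu>: real_distribution "\<mu> n" by (rule \<mu>)
      have "(1 - exp (- 1)) * measure (\<mu> n) {1 / l<..} < (1 - exp (- 1)) * e"
        using le_less_trans[OF laplace_tail[OF l(1) of_nat_0_le_iff] l(2)] unfolding \<mu>_def .
      then have 1: "measure (\<mu> n) {1 / l<..} < e"
        using e1 by simp
      have 2: "measure (\<mu> n) {..- 1} = 0"
      proof -
        have "Y (real n) -` {..- 1} \<inter> space (P 0) = {}" using Y0[of _ n] by force
        then show ?thesis unfolding \<mu>_def by (simp add: measure_distr)
      qed
      have "UNIV = {..- 1} \<union> {- 1<..1 / l} \<union> {1 / l<..}" using l by auto
      then have "1 \<le> measure (\<mu> n) ({..- 1} \<union> {- 1<..1 / l} \<union> {1 / l<..})"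
        using \<mu>.prob_space by simp
      also have "\<dots> \<le> measure (\<mu> n) ({..- 1} \<union> {- 1<..1 / l}) + measure (\<mu> n) {1 / l<..}"
        by (rule measure_Un_le) auto
      also have "measure (\<mu> n) ({..- 1} \<union> {- 1<..1 / l}) \<le> measure (\<mu> n) {..- 1} + measure (\<mu> n) {- 1<..1 / l}"
        by (rule measure_Un_le) auto
      finally show ?thesis using 1 2 by simp
    qed
    moreover have "- 1 < 1 / l" using l(1) by (simp add: field_simps)
    ultimately show "\<exists>a b. a < b \<and> (\<forall>n. 1 - e < measure (\<mu> n) {a<..b})" by blast
  qed
  then obtain r M where r: "strict_mono r" and M: "real_distribution M" and conv: "weak_conv_m (\<mu> \<circ> id \<circ> r) M"
    using tight_imp_convergent_subsubsequence[of \<mu> id] by (auto simp: strict_mono_id)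
  interpret M: real_distribution M by fact
  have lapM: "(\<integral>x. exp (- l * max 0 x) \<partial>M) = \<Lambda> l" if l: "0 < l" for l
  proof -
    have "(\<lambda>n. \<integral>x. exp (- l * max 0 x) \<partial>((\<mu> \<circ> id \<circ> r) n)) \<longlonglongrightarrow> (\<integral>x. exp (- l * max 0 x) \<partial>M)"
    proof (rule weak_conv_imp_integral_bdd_continuous_conv[OF _ M conv])
      show "real_distribution ((\<mu> \<circ> id \<circ> r) n)" for n using \<mu> by simp
      show "isCont (\<lambda>x. exp (- l * max 0 x)) x" for x by (intro continuous_intros)
      show "norm (exp (- l * max 0 x)) \<le> 1" for x using l by simp
    qed
    moreover have "(\<integral>x. exp (- l * max 0 x) \<partial>((\<mu> \<circ> id \<circ> r) n)) = laplace 0 (real (r n)) l" for n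
    proof -
      have "(\<integral>x. exp (- l * max 0 x) \<partial>\<mu> (r n)) = (\<integral>\<omega>. exp (- l * max 0 (Y (real (r n)) \<omega>)) \<partial>P 0)"
        unfolding \<mu>_def by (rule integral_distr) (rule Yb, measurable)
      also have "\<dots> = laplace 0 (real (r n)) l"
        unfolding laplace_def by (rule Bochner_Integration.integral_cong[OF refl]) (simp add: Y0)
      finally show ?thesis by simp
    qed
    moreover have "(\<lambda>n. laplace 0 (real (r n)) l) \<longlonglongrightarrow> \<Lambda> l"
    proof -
      have "((\<lambda>t. laplace 0 t l) \<longlongrightarrow> \<Lambda> l) at_top"
      proof (rule tendstoI)
        fix e :: real assume "0 < e"
        from laplace_converges_uniformly[OF l order.refl this]
        show "\<forall>\<^sub>F t in at_top. dist (laplace 0 t l) (\<Lambda> l) < e"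
          by eventually_elim (simp add: dist_real_def)
      qed
      moreover have "filterlim (\<lambda>n. real (r n)) at_top sequentially"
        by (rule filterlim_compose[OF filterlim_real_sequentially filterlim_subseq[OF r]])
      ultimately show ?thesis by (rule filterlim_compose)
    qed
    ultimately show ?thesis using LIMSEQ_unique by simp
  qed
  have pos: "(\<lambda>x. max 0 x) \<in> measurable M state_space"
    unfolding state_space_def by (rule measurable_restrict_space2) auto
  define \<nu> where "\<nu> = distr M state_space (\<lambda>x. max 0 x)"
  have "prob_space \<nu>" unfolding \<nu>_def by (rule M.prob_space_distr[OF pos])
  moreover have "sets \<nu> = sets state_space" by (simp add: \<nu>_def)
  moreover have "(\<integral>x. exp (- l * x) \<partial>\<nu>) = \<Lambda> l" if "0 < l" for l
    unfolding \<nu>_def using lapM[OF that]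
    by (subst integral_distr[OF pos measurable_exp_state_space[OF refl]]) simp
  ultimately show thesis by (rule that)
qed

lemma laplace_bind:
  assumes \<mu>: "prob_space \<mu>" "sets \<mu> = sets state_space" and t: "0 \<le> t" and l: "0 \<le> l"
  shows "(\<integral>x. exp (- l * x) \<partial>(\<mu> \<bind> transition P Y t)) = (\<integral>y. laplace y t l \<partial>\<mu>)"
    and "prob_space (\<mu> \<bind> transition P Y t)" "sets (\<mu> \<bind> transition P Y t) = sets state_space"
proof -
  interpret prob_space \<mu> by fact
  note sp = space_of_sets_state_space[OF \<mu>(2)]
  have "transition P Y t \<in> measurable state_space (prob_algebra state_space)"
    using markov t by (simp add: cadlag_markov_process_def)
  then have k: "transition P Y t \<in> measurable \<mu> (prob_algebra state_space)"
    by (simp only: measurable_cong_sets[OF \<mu>(2) refl])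
  note k' = measurable_prob_algebraD[OF k]
  have "(\<integral>x. exp (- l * x) \<partial>(\<mu> \<bind> transition P Y t)) = (\<integral>y. (\<integral>x. exp (- l * x) \<partial>transition P Y t y) \<partial>\<mu>)"
  proof (rule integral_bind[OF measurable_exp_state_space[OF refl] _ k', where B=1 and B'=1])
    show "\<bar>exp (- l * x)\<bar> \<le> 1" if "x \<in> space state_space" for x
      using that l by (simp add: space_of_sets_state_space[OF refl])
    show "finite_measure \<mu>" by unfold_locales
    show "AE y in \<mu>. emeasure (transition P Y t y) (space (transition P Y t y)) \<le> ennreal 1"
      using prob_space.emeasure_space_1[OF transition_prob(1)[OF _ t]] by (intro AE_I2) (simp add: sp)
  qed
  also have "\<dots> = (\<integral>y. laplace y t l \<partial>\<mu>)"
    by (rule Bochner_Integration.integral_cong[OF refl]) (rule laplace_transition, simp_all add: sp t)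
  finally show "(\<integral>x. exp (- l * x) \<partial>(\<mu> \<bind> transition P Y t)) = (\<integral>y. laplace y t l \<partial>\<mu>)" .
  show "sets (\<mu> \<bind> transition P Y t) = sets state_space"
    by (rule sets_bind) (use transition_prob(2)[OF _ t] sp in auto)
  show "prob_space (\<mu> \<bind> transition P Y t)"
    by (rule prob_space_bind[OF _ k']) (use transition_prob(1)[OF _ t] sp in auto)
qed

text \<open>
  Under a stationary law the formula for the transform holds at every time with the same left-hand side; let the time
  tend to infinity.
\<close>

lemma stationary_laplace:
  assumes \<mu>: "stationary_distribution P Y \<mu>" and l: "0 < l"
  shows "(\<integral>x. exp (- l * x) \<partial>\<mu>) = \<Lambda> l"
proof -
  have m: "prob_space \<mu>" "sets \<mu> = sets state_space" and st: "\<And>t. 0 \<le> t \<Longrightarrow> \<mu> \<bind> transition P Y t = \<mu>"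
    using \<mu> by (auto simp: stationary_distribution_def)
  interpret prob_space \<mu> by fact
  note sp = space_of_sets_state_space[OF m(2)]
  obtain \<psi> where \<psi>: "\<And>t. 0 < \<psi> t" "(\<psi> \<longlongrightarrow> 0) at_top" "((\<lambda>t. exp ((1 - p\<^sub>A) * Q (\<psi> t))) \<longlongrightarrow> 1) at_top"
    "\<And>y t. 0 \<le> y \<Longrightarrow> 0 \<le> t \<Longrightarrow> laplace y t l = exp (- \<psi> t * y) * (exp ((1 - p\<^sub>A) * Q (\<psi> t)) * \<Lambda> l)"
    using laplace_flow_limit[OF l] by blast
  have eq: "(\<integral>x. exp (- l * x) \<partial>\<mu>) = (\<integral>y. exp (- \<psi> t * y) \<partial>\<mu>) * (exp ((1 - p\<^sub>A) * Q (\<psi> t)) * \<Lambda> l)"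
    if t: "0 \<le> t" for t
  proof -
    have "(\<integral>x. exp (- l * x) \<partial>\<mu>) = (\<integral>y. laplace y t l \<partial>\<mu>)"
      using laplace_bind(1)[OF m t, of l] l st[OF t] by simp
    also have "\<dots> = (\<integral>y. exp (- \<psi> t * y) * (exp ((1 - p\<^sub>A) * Q (\<psi> t)) * \<Lambda> l) \<partial>\<mu>)"
      by (rule Bochner_Integration.integral_cong[OF refl]) (simp add: sp \<psi>(4) t)
    finally show ?thesis by simp
  qed
  have \<psi>n: "(\<lambda>n. \<psi> (real n)) \<longlonglongrightarrow> 0" "(\<lambda>n. exp ((1 - p\<^sub>A) * Q (\<psi> (real n)))) \<longlonglongrightarrow> 1"
    using \<psi>(2,3) filterlim_compose[OF _ filterlim_real_sequentially] by blast+
  have "(\<lambda>n. \<integral>y. exp (- \<psi> (real n) * y) \<partial>\<mu>) \<longlonglongrightarrow> (\<integral>y. 1 \<partial>\<mu>)"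
  proof (rule integral_dominated_convergence[where w="\<lambda>_. 1"])
    show "(\<lambda>y. exp (- \<psi> (real n) * y)) \<in> borel_measurable \<mu>" for n
      by (rule measurable_exp_state_space[OF m(2)])
    show "AE y in \<mu>. (\<lambda>n. exp (- \<psi> (real n) * y)) \<longlonglongrightarrow> 1"
    proof (rule AE_I2)
      fix y
      have "(\<lambda>n. exp (- \<psi> (real n) * y)) \<longlonglongrightarrow> exp (- 0 * y)"
        by (intro tendsto_intros \<psi>n)
      then show "(\<lambda>n. exp (- \<psi> (real n) * y)) \<longlonglongrightarrow> 1" by simp
    qed
    show "AE y in \<mu>. norm (exp (- \<psi> (real n) * y)) \<le> 1" for n
      using less_imp_le[OF \<psi>(1)] by (intro AE_I2) (simp add: sp)
  qed auto
  then have "(\<lambda>n. (\<integral>y. exp (- \<psi> (real n) * y) \<partial>\<mu>) * (exp ((1 - p\<^sub>A) * Q (\<psi> (real n))) * \<Lambda> l)) \<longlonglongrightarrow>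
      1 * (1 * \<Lambda> l)"
    by (intro tendsto_mult \<psi>n tendsto_const) (simp add: prob_space)
  then have "(\<lambda>n::nat. (\<integral>x. exp (- l * x) \<partial>\<mu>)) \<longlonglongrightarrow> \<Lambda> l"
    using eq[OF of_nat_0_le_iff] by simp
  then show ?thesis by (simp add: LIMSEQ_const_iff)
qed

text \<open>
  Averaging \<open>exp (- \<psi> t * y)\<close> over \<open>\<nu>\<close> gives \<open>\<Lambda> (\<psi> t)\<close>, which cancels the factor \<open>exp ((1 - p\<^sub>A) * Q (\<psi> t))\<close>.
\<close>

lemma stationary_if_laplace:
  assumes \<nu>: "prob_space \<nu>" "sets \<nu> = sets state_space" and lap: "\<And>l. 0 < l \<Longrightarrow> (\<integral>x. exp (- l * x) \<partial>\<nu>) = \<Lambda> l"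
  shows "stationary_distribution P Y \<nu>"
  unfolding stationary_distribution_def
proof (intro conjI allI impI \<nu>)
  fix t :: real assume t: "0 \<le> t"
  note sp = space_of_sets_state_space[OF \<nu>(2)]
  show "\<nu> \<bind> transition P Y t = \<nu>"
  proof (rule laplace_determines[OF laplace_bind(2,3)[OF \<nu> t order.refl] \<nu>])
    fix l :: real assume l: "0 < l"
    obtain \<psi> where \<psi>: "\<And>t. 0 < \<psi> t" "(\<psi> \<longlongrightarrow> 0) at_top" "((\<lambda>t. exp ((1 - p\<^sub>A) * Q (\<psi> t))) \<longlongrightarrow> 1) at_top"
      "\<And>y t. 0 \<le> y \<Longrightarrow> 0 \<le> t \<Longrightarrow> laplace y t l = exp (- \<psi> t * y) * (exp ((1 - p\<^sub>A) * Q (\<psi> t)) * \<Lambda> l)"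
      using laplace_flow_limit[OF l] by blast
    have "(\<integral>x. exp (- l * x) \<partial>(\<nu> \<bind> transition P Y t)) = (\<integral>y. laplace y t l \<partial>\<nu>)"
      by (rule laplace_bind(1)[OF \<nu> t]) (use l in simp)
    also have "\<dots> = (\<integral>y. exp (- \<psi> t * y) * (exp ((1 - p\<^sub>A) * Q (\<psi> t)) * \<Lambda> l) \<partial>\<nu>)"
      by (rule Bochner_Integration.integral_cong[OF refl]) (simp add: sp \<psi>(4) t)
    also have "\<dots> = \<Lambda> (\<psi> t) * (exp ((1 - p\<^sub>A) * Q (\<psi> t)) * \<Lambda> l)"
      using lap[OF \<psi>(1)[of t]] by simp
    also have "\<dots> = \<Lambda> l"
      by (simp add: \<Lambda>_def algebra_simps flip: exp_add)
    finally show "(\<integral>x. exp (- l * x) \<partial>(\<nu> \<bind> transition P Y t)) = (\<integral>x. exp (- l * x) \<partial>\<nu>)"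
      using lap[OF l] by simp
  qed
qed

text \<open>
  The same exponential polynomial approximates \<open>f\<close> for the law of \<open>Y t\<close> under every \<open>P y\<close> and for \<open>\<nu>\<close>, and the
  finitely many Laplace transforms that occur converge uniformly over \<open>K\<close>.
\<close>

lemma uniform_ergodicity:
  fixes f :: "real \<Rightarrow> real"
  assumes \<nu>: "prob_space \<nu>" "sets \<nu> = sets state_space" and lap: "\<And>l. 0 < l \<Longrightarrow> (\<integral>x. exp (- l * x) \<partial>\<nu>) = \<Lambda> l"
    and K: "compact K" "K \<subseteq> {0..}" and f: "continuous_on {0..} f" "bounded (f ` {0..})" and e: "0 < e"
  shows "\<forall>\<^sub>F t in at_top. \<forall>y\<in>K. \<bar>(\<integral>\<omega>. f (Y t \<omega>) \<partial>P y) - (\<integral>x. f x \<partial>\<nu>)\<bar> < e"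
proof -
  obtain B where B: "0 < B" "\<And>y. 0 \<le> y \<Longrightarrow> \<bar>f y\<bar> \<le> B"
    using f(2) unfolding bounded_pos by auto
  obtain b where "\<And>y. y \<in> K \<Longrightarrow> \<bar>y\<bar> \<le> b"
    using compact_imp_bounded[OF K(1)] unfolding bounded_iff by auto
  then have b: "K \<subseteq> {0..\<bar>b\<bar>}" using K(2) by fastforce
  obtain l where l: "0 < l" "1 - \<Lambda> l < e / (8 * B)"
    using \<Lambda>_near_1[of "e / (8 * B)"] e B(1) by auto
  obtain a n where an: "\<And>M. prob_space M \<Longrightarrow> sets M = sets state_space \<Longrightarrow>
      \<bar>(\<integral>y. f y \<partial>M) - (\<Sum>k\<le>n. a k * (\<integral>y. exp (- real k * y) \<partial>M))\<bar> \<le> e / 8 + B * (1 - (\<integral>y. exp (- l * y) \<partial>M))"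
    using exp_poly_truncation[OF f(1) B(2) l(1), of "e / 8"] e by auto
  \<comment> \<open>The term \<open>1 +\<close> keeps the denominator positive when all coefficients vanish.\<close>
  define \<delta> where "\<delta> = e / 8 / (1 + (\<Sum>k\<le>n. \<bar>a k\<bar>))"
  have S: "0 \<le> (\<Sum>k\<le>n. \<bar>a k\<bar>)" by (simp add: sum_nonneg)
  have \<delta>: "0 < \<delta>" unfolding \<delta>_def using e add_pos_nonneg[OF zero_less_one S] by (intro divide_pos_pos mult_pos_pos) auto
  have "\<forall>\<^sub>F t in at_top. \<forall>k\<in>{1..n}. \<forall>y\<in>{0..\<bar>b\<bar>}. \<bar>laplace y t (real k) - \<Lambda> (real k)\<bar> < \<delta>"
    by (intro eventually_ball_finite ballI laplace_converges_uniformly) (use \<delta> in auto)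
  moreover have "\<forall>\<^sub>F t in at_top. \<forall>y\<in>{0..\<bar>b\<bar>}. \<bar>laplace y t l - \<Lambda> l\<bar> < e / (8 * B)"
    by (rule laplace_converges_uniformly) (use l e B(1) in auto)
  ultimately show ?thesis
    using eventually_ge_at_top[of 0]
  proof eventually_elim
    case (elim t)
    show ?case
    proof
      fix y assume yK: "y \<in> K"
      then have y: "y \<in> {0..\<bar>b\<bar>}" "0 \<le> y" using b by auto
      have t: "0 \<le> t" by fact
      interpret \<nu>: prob_space \<nu> by fact
      interpret Py: prob_space "P y" by (rule prob_P[OF y(2)])
      let ?l\<nu> = "\<lambda>k. \<integral>x. exp (- real k * x) \<partial>\<nu>"
      have "\<bar>a k * laplace y t (real k) - a k * ?l\<nu> k\<bar> \<le> \<bar>a k\<bar> * \<delta>" if k: "k \<le> n" for k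
      proof (cases "k = 0")
        case True
        then show ?thesis using \<delta> by (simp add: laplace_def \<nu>.prob_space Py.prob_space)
      next
        case False
        then have "\<bar>laplace y t (real k) - \<Lambda> (real k)\<bar> < \<delta>" using elim(1) k y by auto
        then have "\<bar>a k\<bar> * \<bar>laplace y t (real k) - \<Lambda> (real k)\<bar> \<le> \<bar>a k\<bar> * \<delta>"
          by (intro mult_left_mono) auto
        then show ?thesis
          using lap[of "real k"] False by (simp flip: abs_mult right_diff_distrib)
      qed
      then have "\<bar>(\<Sum>k\<le>n. a k * laplace y t (real k) - a k * ?l\<nu> k)\<bar> \<le> (\<Sum>k\<le>n. \<bar>a k\<bar> * \<delta>)"
        by (intro order_trans[OF sum_abs sum_mono]) auto
      also have "\<dots> = (\<Sum>k\<le>n. \<bar>a k\<bar>) * \<delta>" by (simp add: sum_distrib_right)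
      also have "\<dots> \<le> (1 + (\<Sum>k\<le>n. \<bar>a k\<bar>)) * \<delta>"
        using \<delta> by (intro mult_right_mono) auto
      also have "\<dots> = e / 8"
        unfolding \<delta>_def times_divide_eq_right[of _ "e / 8"]
        by (rule nonzero_mult_div_cancel_left) (use add_pos_nonneg[OF zero_less_one S] in simp)
      finally have 1: "\<bar>(\<Sum>k\<le>n. a k * laplace y t (real k)) - (\<Sum>k\<le>n. a k * ?l\<nu> k)\<bar> \<le> e / 8"
        by (simp add: sum_subtractf)
      have 2: "\<bar>(\<integral>x. f x \<partial>\<nu>) - (\<Sum>k\<le>n. a k * ?l\<nu> k)\<bar> \<le> e / 8 + B * (1 - \<Lambda> l)"
        using an[OF \<nu>] lap[OF l(1)] by simp
      have 3: "\<bar>(\<integral>\<omega>. f (Y t \<omega>) \<partial>P y) - (\<Sum>k\<le>n. a k * laplace y t (real k))\<bar> \<le> e / 8 + B * (1 - laplace y t l)"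
        using an[OF transition_prob[OF y(2) t]] 
        by (simp only: laplace_transition[OF y(2) t] integral_transition[OF y(2) t f(1)])
      have 4: "B * (1 - \<Lambda> l) \<le> e / 8"
        using mult_left_mono[OF less_imp_le[OF l(2)], of B] B(1) by simp
      have "1 - laplace y t l \<le> 2 * (e / (8 * B))"
        using elim(2) y(1) l(2) by fastforce
      then have 5: "B * (1 - laplace y t l) \<le> e / 4"
        using mult_left_mono[of "1 - laplace y t l" "2 * (e / (8 * B))" B] B(1) by simp
      show "\<bar>(\<integral>\<omega>. f (Y t \<omega>) \<partial>P y) - (\<integral>x. f x \<partial>\<nu>)\<bar> < e"
        using 1 2 3 4 5 e by linarith
    qed
  qed
qed

lemma uniform_ergodicity_SUP:
  fixes f :: "real \<Rightarrow> real"
  assumes \<nu>: "prob_space \<nu>" "sets \<nu> = sets state_space" and lap: "\<And>l. 0 < l \<Longrightarrow> (\<integral>x. exp (- l * x) \<partial>\<nu>) = \<Lambda> l"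
    and K: "compact K" "K \<subseteq> {0..}" and f: "continuous_on {0..} f" "bounded (f ` {0..})"
  shows "((\<lambda>t. SUP y\<in>K. ennreal \<bar>(\<integral>\<omega>. f (Y t \<omega>) \<partial>P y) - (\<integral>x. f x \<partial>\<nu>)\<bar>) \<longlongrightarrow> 0) at_top"
proof (rule tendsto_zero_ennreal)
  fix r :: real assume r: "0 < r"
  have "0 < r / 2" using r by simp
  have "\<forall>\<^sub>F t in at_top. \<forall>y\<in>K. \<bar>(\<integral>\<omega>. f (Y t \<omega>) \<partial>P y) - (\<integral>x. f x \<partial>\<nu>)\<bar> < r / 2"
    by (rule uniform_ergodicity[OF \<nu> _ K f \<open>0 < r / 2\<close>]) (rule lap)
  then
  show "\<forall>\<^sub>F t in at_top. (SUP y\<in>K. ennreal \<bar>(\<integral>\<omega>. f (Y t \<omega>) \<partial>P y) - (\<integral>x. f x \<partial>\<nu>)\<bar>) < ennreal r"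
  proof eventually_elim
    case (elim t)
    have "(SUP y\<in>K. ennreal \<bar>(\<integral>\<omega>. f (Y t \<omega>) \<partial>P y) - (\<integral>x. f x \<partial>\<nu>)\<bar>) \<le> ennreal (r / 2)"
    proof (rule SUP_least, rule ennreal_leI)
      fix y assume "y \<in> K"
      then show "\<bar>(\<integral>\<omega>. f (Y t \<omega>) \<partial>P y) - (\<integral>x. f x \<partial>\<nu>)\<bar> \<le> r / 2"
        using elim less_imp_le by blast
    qed
    also have "\<dots> < ennreal r" using r by (simp add: ennreal_less_iff)
    finally show ?case .
  qed
qed

end

section \<open>The density of the limit law\<close>

locale bandit_limit_law = bandit_parameters +
  fixes \<nu> :: "real measure"
  assumes prob_\<nu>: "prob_space \<nu>" and sets_\<nu>: "sets \<nu> = sets state_space"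
    and laplace_\<nu>: "\<And>l. 0 < l \<Longrightarrow> (\<integral>x. exp (- l * x) \<partial>\<nu>) = \<Lambda> l"
begin

sublocale prob_space \<nu> by (rule prob_\<nu>)

lemma space_\<nu>: "space \<nu> = {0..}"
  by (rule space_of_sets_state_space[OF sets_\<nu>])

lemma borel_\<nu>: "f \<in> measurable borel N \<Longrightarrow> f \<in> measurable \<nu> N"
  by (rule borel_imp_measurable_state_space[OF sets_\<nu>])

lemma sets_\<nu>_iff: "A \<in> sets \<nu> \<longleftrightarrow> A \<in> sets borel \<and> A \<subseteq> {0..}"
  using sets_\<nu> sets_state_space by simp

text \<open>
  The rest point of the drift \<open>1 - p\<^sub>A - p\<^sub>A * y\<close>, towards which the process moves between its jumps.
\<close>

definition r :: real where "r = (1 - p\<^sub>A) / p\<^sub>A"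

lemma r_pos: "0 < r"
  using pA pA1 by (simp add: r_def)

lemma drift_eq: "p\<^sub>A * x - (1 - p\<^sub>A) = p\<^sub>A * (x - r)"
  using pA by (simp add: r_def field_simps)

definition tilted_mean :: "real \<Rightarrow> real" where
  "tilted_mean l = (\<integral>x. x * exp (- l * x) \<partial>\<nu>)"

lemma integrable_exp: "0 \<le> l \<Longrightarrow> integrable \<nu> (\<lambda>x. exp (- l * x))"
  by (rule integrable_exp_state_space[OF prob_\<nu> sets_\<nu>])

lemma integrable_mult_exp:
  assumes "0 < l" shows "integrable \<nu> (\<lambda>x. x * exp (- l * x))"
proof (rule integrable_const_bound[where B="1 / l"])
  show "AE x in \<nu>. norm (x * exp (- l * x)) \<le> 1 / l"
    using mult_exp_bound(1)[OF assms] by (intro AE_I2) (simp add: space_\<nu> abs_mult)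
  show "(\<lambda>x. x * exp (- l * x)) \<in> borel_measurable \<nu>" by (rule borel_\<nu>) measurable
qed

text \<open>
  The differential equation of \<open>\<Lambda>\<close>, with \<open>\<Lambda>'\<close> computed both under the integral sign and from \<open>Q' l = l / R l\<close>.
\<close>

lemma tilted_mean_eq:
  assumes l: "0 < l"
  shows "R l * tilted_mean l = (1 - p\<^sub>A) * l * (\<integral>x. exp (- l * x) \<partial>\<nu>)"
proof -
  let ?F = "\<lambda>l. \<integral>x. exp (- l * x) \<partial>\<nu>"
  have "((\<lambda>z. (?F z - ?F l) / (z - l) + tilted_mean l) \<longlongrightarrow> 0) (at l)"
  proof (rule Lim_null_comparison)
    have "((\<lambda>z. 4 / (l / 2)\<^sup>2 * \<bar>z - l\<bar>) \<longlongrightarrow> 4 / (l / 2)\<^sup>2 * \<bar>l - l\<bar>) (at l)"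
      by (intro tendsto_intros)
    then show "((\<lambda>z. 4 / (l / 2)\<^sup>2 * \<bar>z - l\<bar>) \<longlongrightarrow> 0) (at l)" by simp
    have "\<forall>\<^sub>F z in at l. l / 2 < z"
      by (rule order_tendstoD(1)[OF tendsto_ident_at]) (use l in simp)
    moreover have "\<forall>\<^sub>F z in at l. z \<noteq> l" by (simp add: eventually_at_filter)
    ultimately show "\<forall>\<^sub>F z in at l. norm ((?F z - ?F l) / (z - l) + tilted_mean l) \<le> 4 / (l / 2)\<^sup>2 * \<bar>z - l\<bar>"
    proof eventually_elim
      case (elim z)
      have idm: "(\<lambda>x. x) \<in> borel_measurable \<nu>" by (rule borel_\<nu>) measurable
      have "\<bar>?F z - ?F l + (z - l) * tilted_mean l\<bar> \<le> 4 / (l / 2)\<^sup>2 * (z - l)\<^sup>2"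
        unfolding tilted_mean_def
        by (rule laplace_second_order[OF prob_\<nu> idm]) (use l elim in \<open>auto simp: space_\<nu>\<close>)
      then have "\<bar>?F z - ?F l + (z - l) * tilted_mean l\<bar> / \<bar>z - l\<bar> \<le> 4 / (l / 2)\<^sup>2 * (z - l)\<^sup>2 / \<bar>z - l\<bar>"
        by (intro divide_right_mono) auto
      also have "(z - l)\<^sup>2 = \<bar>z - l\<bar> * \<bar>z - l\<bar>" by (simp add: power2_eq_square)
      also have "4 / (l / 2)\<^sup>2 * (\<bar>z - l\<bar> * \<bar>z - l\<bar>) / \<bar>z - l\<bar> = 4 / (l / 2)\<^sup>2 * \<bar>z - l\<bar>"
      proof -
        have *: "c * (a * a) / a = c * a" if "a \<noteq> 0" for a c :: real using that by simp
        show ?thesis by (rule *) (use elim in simp)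
      qed
      also have "\<bar>?F z - ?F l + (z - l) * tilted_mean l\<bar> / \<bar>z - l\<bar> = \<bar>(?F z - ?F l) / (z - l) + tilted_mean l\<bar>"
        using elim by (simp add: add_divide_distrib flip: abs_divide)
      finally show ?case by simp
    qed
  qed
  then have "((\<lambda>z. ((?F z - ?F l) / (z - l) + tilted_mean l) - tilted_mean l) \<longlongrightarrow> 0 - tilted_mean l) (at l)"
    by (intro tendsto_intros)
  then have DF: "(?F has_real_derivative - tilted_mean l) (at l)"
    by (simp add: has_field_derivative_iff)
  have ev: "\<forall>\<^sub>F z in nhds l. ?F z = \<Lambda> z"
  proof -
    have "\<forall>\<^sub>F z in nhds l. z \<in> {0<..}"
      using l by (intro eventually_nhds_in_open) auto
    then show ?thesis by eventually_elim (rule laplace_\<nu>, simp)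
  qed
  have D1: "(\<Lambda> has_real_derivative - tilted_mean l) (at l)"
    by (rule DERIV_cong_ev[OF refl ev refl, THEN iffD1, OF DF])
  have D2: "(\<Lambda> has_real_derivative \<Lambda> l * (- (1 - p\<^sub>A) * (l / R l))) (at l)"
    unfolding \<Lambda>_def
    by (rule derivative_eq_intros refl Q_deriv[OF l])+ simp
  have "tilted_mean l = \<Lambda> l * ((1 - p\<^sub>A) * (l / R l))"
    using DERIV_unique[OF D1 D2] by (simp only: mult_minus_left mult_minus_right neg_equal_iff_equal)
  then show ?thesis using R_pos[OF l] laplace_\<nu>[OF l] by simp
qed

text \<open>
  The stationary upward flux through \<open>u\<close>: jumps from \<open>z\<close> occur at rate \<open>p\<^sub>B * z / g\<close> and cross \<open>u\<close> when
  \<open>z \<le> u \<le> z + g\<close>.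
\<close>

definition G :: "real \<Rightarrow> real" where
  "G u = p\<^sub>B / g * (\<integral>z. z * indicator {z..z + g} u \<partial>\<nu>)"

lemma jump_kernel_measurable: "(\<lambda>(z, u). z * indicator {z..z + g} u * exp (- l * u))
    \<in> borel_measurable (\<nu> \<Otimes>\<^sub>M lborel)" for l :: real
proof -
  have "(\<lambda>p. fst p * (if fst p \<le> snd p \<and> snd p \<le> fst p + g then 1 else 0) * exp (- l * snd p))
      \<in> borel_measurable (borel \<Otimes>\<^sub>M lborel)"
    by measurable
  moreover have "(\<lambda>p. p) \<in> measurable (\<nu> \<Otimes>\<^sub>M lborel) (borel \<Otimes>\<^sub>M lborel)"
  proof -
    have "(\<lambda>x. x) \<in> measurable \<nu> borel" by (rule borel_\<nu>) measurable
    then have "(\<lambda>p. (fst p, snd p)) \<in> measurable (\<nu> \<Otimes>\<^sub>M lborel) (borel \<Otimes>\<^sub>M lborel)"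
      by (intro measurable_Pair) (auto intro: measurable_compose[OF measurable_fst])
    then show ?thesis by simp
  qed
  ultimately have "(\<lambda>p. fst p * (if fst p \<le> snd p \<and> snd p \<le> fst p + g then 1 else 0) * exp (- l * snd p))
      \<in> borel_measurable (\<nu> \<Otimes>\<^sub>M lborel)"
    by (rule measurable_compose[rotated])
  then show ?thesis
    by (rule measurable_cong[THEN iffD1, rotated]) (auto simp: indicator_def)
qed

lemma integral_exp_Icc:
  fixes l z :: real
  assumes "0 < l"
  shows "integrable lborel (\<lambda>u. indicator {z..z + g} u * exp (- l * u))"
    "(\<integral>u. indicator {z..z + g} u * exp (- l * u) \<partial>lborel) = exp (- l * z) * ((1 - exp (- l * g)) / l)"
proof -
  have "continuous_on {z..z + g} (\<lambda>u. exp (- l * u))" by (intro continuous_intros)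
  from borel_integrable_atLeastAtMost'[OF this]
  show "integrable lborel (\<lambda>u. indicator {z..z + g} u * exp (- l * u))"
    by (simp add: set_integrable_def)
  have "(\<integral>u. indicator {z..z + g} u *\<^sub>R exp (- l * u) \<partial>lborel) = - exp (- l * (z + g)) / l - - exp (- l * z) / l"
  proof (rule integral_FTC_atLeastAtMost)
    show "((\<lambda>u. - exp (- l * u) / l) has_vector_derivative exp (- l * x)) (at x within {z..z + g})" for x
      using assms by (auto intro!: derivative_eq_intros simp flip: has_real_derivative_iff_has_vector_derivative)
  qed (use g in \<open>auto intro!: continuous_intros\<close>)
  also have "\<dots> = exp (- l * z) * ((1 - exp (- l * g)) / l)"
    using assms by (simp add: distrib_left exp_diff exp_minus exp_add field_simps)
  finally show "(\<integral>u. indicator {z..z + g} u * exp (- l * u) \<partial>lborel) = exp (- l * z) * ((1 - exp (- l * g)) / l)"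
    by simp
qed

lemma laplace_G:
  assumes l: "0 < l"
  shows "integrable lborel (\<lambda>u. G u * exp (- l * u))"
    and "(\<integral>u. G u * exp (- l * u) \<partial>lborel) = p\<^sub>B / g * (tilted_mean l * ((1 - exp (- l * g)) / l))"
proof -
  interpret pair_sigma_finite \<nu> lborel ..
  let ?f = "\<lambda>z u. z * indicator {z..z + g} u * exp (- l * u)"
  have inner: "(\<integral>u. ?f z u \<partial>lborel) = z * exp (- l * z) * ((1 - exp (- l * g)) / l)" for z
    using integral_exp_Icc[OF l, of z] by (simp add: mult.assoc)
  have i: "integrable (\<nu> \<Otimes>\<^sub>M lborel) (case_prod ?f)"
  proof (rule Fubini_integrable)
    show "case_prod ?f \<in> borel_measurable (\<nu> \<Otimes>\<^sub>M lborel)" by (rule jump_kernel_measurable)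
    have "(\<integral>u. norm (?f z u) \<partial>lborel) = z * exp (- l * z) * ((1 - exp (- l * g)) / l)" if "z \<in> space \<nu>" for z
      using that inner[of z] by (simp add: space_\<nu> abs_mult)
    then show "integrable \<nu> (\<lambda>z. \<integral>u. norm (case (z, u) of (z, u) \<Rightarrow> ?f z u) \<partial>lborel)"
      using integrable_mult_left[OF integrable_mult_exp[OF l], of "(1 - exp (- l * g)) / l"]
      by (subst Bochner_Integration.integrable_cong[OF refl]) auto
    show "AE z in \<nu>. integrable lborel (\<lambda>u. case (z, u) of (z, u) \<Rightarrow> ?f z u)"
      using integral_exp_Icc(1)[OF l] by (intro AE_I2) (simp add: mult.assoc)
  qed
  have G_exp: "G u * exp (- l * u) = p\<^sub>B / g * (\<integral>z. ?f z u \<partial>\<nu>)" for u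
    by (simp add: G_def)
  show "integrable lborel (\<lambda>u. G u * exp (- l * u))"
    unfolding G_exp using integrable_snd[OF i] by (rule integrable_mult_right)
  have "(\<integral>u. G u * exp (- l * u) \<partial>lborel) = p\<^sub>B / g * (\<integral>u. (\<integral>z. ?f z u \<partial>\<nu>) \<partial>lborel)"
    unfolding G_exp by simp
  also have "(\<integral>u. (\<integral>z. ?f z u \<partial>\<nu>) \<partial>lborel) = (\<integral>z. (\<integral>u. ?f z u \<partial>lborel) \<partial>\<nu>)"
    by (rule Fubini_integral[OF i])
  also have "\<dots> = tilted_mean l * ((1 - exp (- l * g)) / l)"
    unfolding inner tilted_mean_def by simp
  finally show "(\<integral>u. G u * exp (- l * u) \<partial>lborel) = p\<^sub>B / g * (tilted_mean l * ((1 - exp (- l * g)) / l))" .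
qed

lemma G_nonneg: "0 \<le> G u"
  unfolding G_def using pB g by (intro mult_nonneg_nonneg integral_nonneg_AE AE_I2) (auto simp: space_\<nu>)

lemma G_neg: "u < 0 \<Longrightarrow> G u = 0"
  unfolding G_def
  by (subst Bochner_Integration.integral_cong[OF refl, where g="\<lambda>_. 0"]) (auto simp: space_\<nu> indicator_def)

lemma G_measurable: "G \<in> borel_measurable borel"
proof -
  have "(\<lambda>u. G u * exp (- 1 * u)) \<in> borel_measurable borel"
    using borel_measurable_integrable[OF laplace_G(1)[OF zero_less_one]] by simp
  then have "(\<lambda>u. (G u * exp (- 1 * u)) * exp u) \<in> borel_measurable borel"
    by measurable
  then show ?thesis by (simp add: mult.assoc flip: exp_add)
qed

text \<open>
  The factor \<open>exp (- x)\<close> makes both sides finite, and it moves the exponents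
  \<open>0, 1, 2, \<dots>\<close> of the uniqueness lemma to \<open>1, 2, 3, \<dots>\<close>, where \<open>tilted_mean_eq\<close> is available. After division
  by \<open>l\<close> that equation is the equality of the two Laplace transforms.
\<close>

lemma balance:
  assumes A: "A \<in> sets borel"
  shows "(\<integral>x. indicator A x * (p\<^sub>A * (x - r) * exp (- x)) \<partial>\<nu>) = (\<integral>x. indicator A x * (G x * exp (- x)) \<partial>lborel)"
proof -
  let ?L = "restrict_space lborel {0..} :: real measure"
  let ?u = "\<lambda>x. p\<^sub>A * (x - r) * exp (- x)" and ?v = "\<lambda>x. G x * exp (- x)"
  have sets_L: "sets ?L = sets state_space"
    unfolding state_space_def by (rule sets_restrict_space_cong) simp
  have to_lborel: "(\<integral>x. f x * ?v x \<partial>?L) = (\<integral>x. f x * ?v x \<partial>lborel)" for f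
  proof -
    have "(\<integral>x. f x * ?v x \<partial>?L) = (\<integral>x. indicator {0..} x *\<^sub>R (f x * ?v x) \<partial>lborel)"
      by (rule integral_restrict_space) simp
    also have "\<dots> = (\<integral>x. f x * ?v x \<partial>lborel)"
      by (rule Bochner_Integration.integral_cong[OF refl]) (auto simp: indicator_def G_neg)
    finally show ?thesis .
  qed
  have u_eq: "exp (- l * x) * ?u x = p\<^sub>A * (x * exp (- (l + 1) * x)) - (1 - p\<^sub>A) * exp (- (l + 1) * x)" for x l
  proof -
    have "exp (- (l + 1) * x) = exp (- l * x) * exp (- x)"
      by (simp add: algebra_simps flip: exp_add)
    then show ?thesis
      unfolding drift_eq[symmetric] by (simp add: algebra_simps)
  qed
  have int_u: "integrable \<nu> (\<lambda>x. exp (- l * x) * ?u x)" if "0 \<le> l" for l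
    unfolding u_eq using that
    by (intro Bochner_Integration.integrable_diff integrable_mult_right integrable_mult_exp integrable_exp) auto
  have "(\<integral>x. indicator A x * ?u x \<partial>\<nu>) = (\<integral>x. indicator A x * ?v x \<partial>?L)"
  proof (rule signed_laplace_unique[OF sets_\<nu> sets_L _ _ _ A])
    show "integrable \<nu> ?u" using int_u[of 0] by simp
    have "integrable lborel (\<lambda>x. indicator {0..} x *\<^sub>R ?v x)"
    proof (rule Bochner_Integration.integrable_cong[THEN iffD1, OF refl _ laplace_G(1)[OF zero_less_one]])
      show "G x * exp (- 1 * x) = indicator {0..} x *\<^sub>R ?v x" for x
        by (auto simp: indicator_def G_neg)
    qed
    then show "integrable ?L ?v"
      by (subst integrable_restrict_space) auto
    fix n :: nat
    define l where "l = real n + 1"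
    have l: "0 < l" by (simp add: l_def)
    have "(\<integral>x. exp (- real n * x) * ?u x \<partial>\<nu>) = p\<^sub>A * tilted_mean l - (1 - p\<^sub>A) * (\<integral>x. exp (- l * x) \<partial>\<nu>)"
      unfolding u_eq l_def[symmetric] tilted_mean_def
      using integrable_mult_exp[OF l] integrable_exp[of l] l by (subst Bochner_Integration.integral_diff) auto
    also have "\<dots> = p\<^sub>B / g * (tilted_mean l * ((1 - exp (- l * g)) / l))"
    proof -
      have "l * (p\<^sub>A * tilted_mean l - (1 - p\<^sub>A) * (\<integral>x. exp (- l * x) \<partial>\<nu>)) = l * p\<^sub>A * tilted_mean l - R l * tilted_mean l"
        using tilted_mean_eq[OF l] by (simp add: algebra_simps)
      also have "\<dots> = l * (p\<^sub>B / g * (tilted_mean l * ((1 - exp (- l * g)) / l)))"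
        using l g by (simp add: R_def field_simps)
      finally show ?thesis by (metis l less_irrefl mult_left_cancel)
    qed
    also have "\<dots> = (\<integral>x. G x * exp (- l * x) \<partial>lborel)"
      by (rule laplace_G(2)[OF l, symmetric])
    also have "\<dots> = (\<integral>x. exp (- real n * x) * ?v x \<partial>lborel)"
      by (rule Bochner_Integration.integral_cong[OF refl]) (simp add: l_def algebra_simps flip: exp_add)
    also have "\<dots> = (\<integral>x. exp (- real n * x) * ?v x \<partial>?L)" by (rule to_lborel[symmetric])
    finally show "(\<integral>x. exp (- real n * x) * ?u x \<partial>\<nu>) = (\<integral>x. exp (- real n * x) * ?v x \<partial>?L)" .
  qed
  then show ?thesis by (simp add: to_lborel)
qed

lemma integrable_tilted_drift:
  assumes "A \<in> sets borel"
  shows "integrable \<nu> (\<lambda>x. indicator A x * (p\<^sub>A * (x - r) * exp (- x)))"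
proof -
  have i: "integrable \<nu> (\<lambda>x. p\<^sub>A * (x - r) * exp (- x))"
  proof -
    have "integrable \<nu> (\<lambda>x. p\<^sub>A * (x * exp (- 1 * x)) - (p\<^sub>A * r) * exp (- 1 * x))"
      by (intro Bochner_Integration.integrable_diff integrable_mult_right integrable_mult_exp integrable_exp) auto
    then show ?thesis by (simp add: algebra_simps)
  qed
  have ind: "(indicator A :: real \<Rightarrow> real) \<in> borel_measurable \<nu>"
    using assms by (intro borel_\<nu> borel_measurable_indicator)
  show ?thesis by (rule integrable_mult_bounded[OF i ind, of 1]) (simp add: indicator_def)
qed

lemma integrable_tilted_G:
  assumes "A \<in> sets borel"
  shows "integrable lborel (\<lambda>x. indicator A x * (G x * exp (- x)))"
  using integrable_mult_bounded[OF laplace_G(1)[OF zero_less_one], of "indicator A" 1] assms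
  by (simp add: indicator_def)

lemma measure_indicator_integral:
  assumes "A \<in> sets borel" "A \<subseteq> {0..}"
  shows "integrable \<nu> (\<lambda>x. k * indicator A x :: real)" "(\<integral>x. k * indicator A x \<partial>\<nu>) = k * measure \<nu> A"
proof -
  have A: "A \<in> sets \<nu>" using assms by (simp add: sets_\<nu>_iff)
  have "integrable \<nu> (indicator A :: real \<Rightarrow> real)"
    by (rule integrable_real_indicator[OF A]) (simp add: emeasure_eq_measure)
  then show "integrable \<nu> (\<lambda>x. k * indicator A x :: real)" by (rule integrable_mult_right)
  show "(\<integral>x. k * indicator A x \<partial>\<nu>) = k * measure \<nu> A" using A by simp
qed

text \<open>
  To the left of \<open>r\<close> the left side of the balance equation is negative and the right side is not.
\<close>

lemma AE_ge_r: "AE x in \<nu>. r \<le> x"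
proof -
  let ?f = "\<lambda>x. indicator {..<r} x * (p\<^sub>A * (x - r) * exp (- x))"
  have "0 \<le> (\<integral>x. indicator {..<r} x * (G x * exp (- x)) \<partial>lborel)"
    by (intro integral_nonneg_AE AE_I2 mult_nonneg_nonneg G_nonneg) auto
  then have "0 \<le> (\<integral>x. ?f x \<partial>\<nu>)" by (simp add: balance)
  moreover have i: "integrable \<nu> (\<lambda>x. - ?f x)"
    by (intro Bochner_Integration.integrable_minus integrable_tilted_drift) simp
  moreover have nn: "0 \<le> - ?f x" for x
    using pA by (auto simp: indicator_def mult_le_0_iff)
  moreover have "0 \<le> (\<integral>x. - ?f x \<partial>\<nu>)"
    by (rule integral_nonneg_AE) (intro AE_I2 nn)
  ultimately have "(\<integral>x. - ?f x \<partial>\<nu>) = 0" by simp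
  then have "AE x in \<nu>. - ?f x = 0"
    using integral_nonneg_eq_0_iff_AE[OF i AE_I2[OF nn]] by simp
  then show ?thesis
  proof eventually_elim
    case (elim x)
    then show ?case using pA by (auto simp: indicator_def split: if_splits)
  qed
qed

lemma measure_Icc_ge:
  "measure \<nu> {0..b} = measure \<nu> {r..b}"
  by (rule finite_measure_eq_AE) (use AE_ge_r r_pos in \<open>auto simp: sets_\<nu>_iff elim!: eventually_mono\<close>)

lemma atom_free_off_r:
  assumes "0 \<le> y" "y \<noteq> r" shows "measure \<nu> {y} = 0"
proof -
  have "(\<integral>x. indicator {y} x * (p\<^sub>A * (x - r) * exp (- x)) \<partial>\<nu>)
      = (\<integral>x. (p\<^sub>A * (y - r) * exp (- y)) * indicator {y} x \<partial>\<nu>)"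
    by (rule Bochner_Integration.integral_cong[OF refl]) (simp add: indicator_def)
  also have "\<dots> = (p\<^sub>A * (y - r) * exp (- y)) * measure \<nu> {y}"
    by (rule measure_indicator_integral) (use assms in auto)
  finally have "(p\<^sub>A * (y - r) * exp (- y)) * measure \<nu> {y}
      = (\<integral>x. indicator {y} x * (G x * exp (- x)) \<partial>lborel)"
    by (simp only: balance[OF borel_closed[OF closed_singleton]])
  also have "\<dots> = 0"
    by (rule integral_eq_zero_AE) (use AE_lborel_singleton[of y] in \<open>auto elim!: eventually_mono\<close>)
  finally show ?thesis using assms pA by simp
qed

lemma kernel_integrable: "integrable \<nu> (\<lambda>z. z * indicator {z..z + g} u)"
proof (rule integrable_const_bound[where B="\<bar>u\<bar>"])
  show "AE z in \<nu>. norm (z * indicator {z..z + g} u) \<le> \<bar>u\<bar>"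
    by (intro AE_I2) (auto simp: space_\<nu> indicator_def)
  have "(\<lambda>z. z * (if z \<le> u \<and> u \<le> z + g then 1 else 0)) \<in> borel_measurable borel" by measurable
  moreover have "(\<lambda>z. z * (if z \<le> u \<and> u \<le> z + g then 1 else 0)) = (\<lambda>z. z * indicator {z..z + g} u)"
    by (auto simp: indicator_def)
  ultimately show "(\<lambda>z. z * indicator {z..z + g} u) \<in> borel_measurable \<nu>" by (simp add: borel_\<nu>)
qed

lemma G_lower:
  assumes A: "A \<in> sets borel" "A \<subseteq> {0..}" and "\<And>z. z \<in> A \<Longrightarrow> a \<le> z \<and> u - g \<le> z \<and> z \<le> u" and a: "0 \<le> a" 
  shows "p\<^sub>B / g * (a * measure \<nu> A) \<le> G u"
proof -
  have "a * measure \<nu> A = (\<integral>z. a * indicator A z \<partial>\<nu>)"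
    by (rule measure_indicator_integral(2)[OF A, symmetric])
  also have "\<dots> \<le> (\<integral>z. z * indicator {z..z + g} u \<partial>\<nu>)"
  proof (rule integral_mono[OF measure_indicator_integral(1)[OF A] kernel_integrable])
    fix z assume "z \<in> space \<nu>"
    then show "a * indicator A z \<le> z * indicator {z..z + g} u"
      using assms(3)[of z] by (auto simp: indicator_def space_\<nu>)
  qed
  finally show ?thesis unfolding G_def using pB g by (intro mult_left_mono) auto
qed

lemma G_upper:
  assumes "0 \<le> u" "u \<le> b" shows "G u \<le> p\<^sub>B / g * (b * measure \<nu> {0..b})"
proof -
  have "(\<integral>z. z * indicator {z..z + g} u \<partial>\<nu>) \<le> (\<integral>z. b * indicator {0..b} z \<partial>\<nu>)"
  proof (rule integral_mono[OF kernel_integrable measure_indicator_integral(1)])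
    fix z assume "z \<in> space \<nu>"
    then show "z * indicator {z..z + g} u \<le> b * indicator {0..b} z"
      using assms by (auto simp: indicator_def space_\<nu>)
  qed auto
  also have "\<dots> = b * measure \<nu> {0..b}" by (rule measure_indicator_integral(2)) auto
  finally show ?thesis unfolding G_def using pB g by (intro mult_left_mono) auto
qed

lemma integral_const_Ioc:
  fixes a k :: real assumes "0 \<le> e"
  shows "integrable lborel (\<lambda>x. k * indicator {a<..a + e} x)" "(\<integral>x. k * indicator {a<..a + e} x \<partial>lborel) = k * e"
proof -
  have "integrable lborel (indicator {a<..a + e} :: real \<Rightarrow> real)"
    using assms by (intro integrable_real_indicator) auto
  then show "integrable lborel (\<lambda>x. k * indicator {a<..a + e} x)" by (rule integrable_mult_right)
  show "(\<integral>x. k * indicator {a<..a + e} x \<partial>lborel) = k * e" using assms by simp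
qed

text \<open>
  An atom at \<open>r\<close> keeps \<open>G\<close> away from zero on \<open>{r..r + g}\<close>. The balance equation on \<open>{r<..r + e}\<close>, where the drift is at
  most \<open>p\<^sub>A * e\<close>, then gives that interval a mass bounded below as \<open>e \<rightarrow> 0\<close>, which is absurd.
\<close>

lemma atom_free_r: "measure \<nu> {r} = 0"
proof (rule ccontr)
  define a where "a = measure \<nu> {r}"
  assume "measure \<nu> {r} \<noteq> 0"
  then have a: "0 < a" by (simp add: a_def zero_less_measure_iff)
  define d where "d = p\<^sub>B / g * (r * a) * exp (- (r + g))"
  have d: "0 < d" unfolding d_def using pB g r_pos a by (intro mult_pos_pos divide_pos_pos) auto
  have lower: "d \<le> p\<^sub>A * measure \<nu> {r<..r + e}" if e: "0 < e" "e \<le> g" for e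
  proof -
    let ?A = "{r<..r + e}"
    have A: "?A \<in> sets borel" "?A \<subseteq> {0..}" using r_pos by auto
    have "d * e = (\<integral>x. d * indicator ?A x \<partial>lborel)"
      using integral_const_Ioc(2)[of e d r] e by simp
    also have "\<dots> \<le> (\<integral>x. indicator ?A x * (G x * exp (- x)) \<partial>lborel)"
    proof (rule integral_mono[OF _ integrable_tilted_G[OF A(1)]])
      show "integrable lborel (\<lambda>x. d * indicator ?A x)" using e by (intro integral_const_Ioc) auto
      fix x
      have "d \<le> G x * exp (- x)" if x: "x \<in> ?A"
      proof -
        have "p\<^sub>B / g * (r * a) \<le> G x"
          unfolding a_def by (rule G_lower) (use x e r_pos in auto)
        then show ?thesis unfolding d_def using x e G_nonneg[of x] by (intro mult_mono) auto
      qed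
      then show "d * indicator ?A x \<le> indicator ?A x * (G x * exp (- x))"
        by (auto simp: indicator_def)
    qed
    also have "\<dots> = (\<integral>x. indicator ?A x * (p\<^sub>A * (x - r) * exp (- x)) \<partial>\<nu>)"
      by (rule balance[OF A(1), symmetric])
    also have "\<dots> \<le> (\<integral>x. (p\<^sub>A * e) * indicator ?A x \<partial>\<nu>)"
    proof (rule integral_mono[OF integrable_tilted_drift[OF A(1)] measure_indicator_integral(1)[OF A]])
      fix x
      have "p\<^sub>A * (x - r) * exp (- x) \<le> p\<^sub>A * e * 1" if x: "x \<in> ?A"
        using x pA r_pos e by (intro mult_mono) auto
      then show "indicator ?A x * (p\<^sub>A * (x - r) * exp (- x)) \<le> (p\<^sub>A * e) * indicator ?A x"
        by (auto simp: indicator_def)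
    qed
    also have "\<dots> = p\<^sub>A * e * measure \<nu> ?A" by (rule measure_indicator_integral(2)[OF A])
    finally have "e * d \<le> e * (p\<^sub>A * measure \<nu> ?A)" by (simp add: mult_ac)
    then show ?thesis using e by simp
  qed
  define A where "A n = {r<..r + g / real (Suc n)}" for n
  have dec: "decseq A"
  proof (unfold decseq_def, intro allI impI)
    fix m n :: nat assume "m \<le> n"
    then have "g / real (Suc n) \<le> g / real (Suc m)"
      using g by (intro divide_left_mono) auto
    then show "A n \<subseteq> A m" unfolding A_def by auto
  qed
  have "(\<Inter>n. A n) = {}"
  proof -
    have "\<exists>n. x \<notin> A n" for x
    proof (cases "r < x")
      case True
      then obtain n where "g / (x - r) < real n" using reals_Archimedean2 by blast
      then have "g / (x - r) < real (Suc n)" by simp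
      then have "g / real (Suc n) < x - r" using True by (simp add: field_simps)
      then show ?thesis by (intro exI[of _ n]) (auto simp: A_def)
    qed (auto simp: A_def)
    then show ?thesis by blast
  qed
  moreover have "(\<lambda>n. measure \<nu> (A n)) \<longlonglongrightarrow> measure \<nu> (\<Inter>n. A n)"
    by (rule finite_Lim_measure_decseq[OF _ dec]) (use r_pos in \<open>auto simp: A_def sets_\<nu>_iff\<close>)
  ultimately have "(\<lambda>n. p\<^sub>A * measure \<nu> (A n)) \<longlonglongrightarrow> p\<^sub>A * 0"
    by (intro tendsto_mult tendsto_const) simp
  moreover have "d \<le> p\<^sub>A * measure \<nu> (A n)" for n
    unfolding A_def by (rule lower) (use g in \<open>auto simp: divide_le_eq\<close>)
  ultimately have "d \<le> p\<^sub>A * 0"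
    by (intro LIMSEQ_le_const) auto
  then show False using d by simp
qed

lemma atom_free: "0 \<le> y \<Longrightarrow> measure \<nu> {y} = 0"
  using atom_free_off_r atom_free_r by (cases "y = r") auto

lemma AE_neq: "AE x in \<nu>. x \<noteq> y"
proof (cases "0 \<le> y")
  case True
  then have "{y} \<in> null_sets \<nu>"
    using atom_free[OF True] by (auto simp: null_sets_def sets_\<nu>_iff emeasure_eq_measure)
  from AE_not_in[OF this] show ?thesis by simp
qed (auto intro!: AE_I2 simp: space_\<nu>)

text \<open>
  The integrand jumps only at \<open>z = u\<close> and \<open>z = u - g\<close>, and these points carry no mass.
\<close>

lemma G_continuous: "continuous_on S G"
proof (rule continuous_on_sequentiallyI)
  fix U :: "nat \<Rightarrow> real" and u assume U: "U \<longlonglongrightarrow> u"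
  obtain B where B: "\<And>n. \<bar>U n\<bar> \<le> B"
    using convergent_imp_Bseq[of U] U by (auto simp: convergent_def Bseq_def)
  have "(\<lambda>n. \<integral>z. z * indicator {z..z + g} (U n) \<partial>\<nu>) \<longlonglongrightarrow> (\<integral>z. z * indicator {z..z + g} u \<partial>\<nu>)"
  proof (rule integral_dominated_convergence[where w="\<lambda>_. B"])
    show "AE z in \<nu>. norm (z * indicator {z..z + g} (U n)) \<le> B" for n
      using B[of n] by (intro AE_I2) (auto simp: space_\<nu> indicator_def)
    show "AE z in \<nu>. (\<lambda>n. z * indicator {z..z + g} (U n)) \<longlonglongrightarrow> z * indicator {z..z + g} u"
      using AE_neq[of u] AE_neq[of "u - g"]
    proof eventually_elim
      case (elim z)
      consider "u < z" | "z < u" "u < z + g" | "z + g < u" using elim by linarith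
      then have "\<forall>\<^sub>F n in sequentially. z * indicator {z..z + g} (U n) = z * indicator {z..z + g} u"
      proof cases
        case 1
        then show ?thesis using order_tendstoD(2)[OF U 1] by (auto elim!: eventually_mono simp: indicator_def)
      next
        case 2
        show ?thesis using order_tendstoD(1)[OF U 2(1)] order_tendstoD(2)[OF U 2(2)]
          by eventually_elim (use 2 in \<open>simp add: indicator_def\<close>)
      next
        case 3
        then show ?thesis using order_tendstoD(1)[OF U 3] by (auto elim!: eventually_mono simp: indicator_def)
      qed
      then show ?case by (rule tendsto_eventually)
    qed
  qed (use borel_measurable_integrable[OF kernel_integrable] in auto)
  then show "(\<lambda>n. G (U n)) \<longlonglongrightarrow> G u"
    unfolding G_def by (intro tendsto_mult tendsto_const)
qed

text \<open>
  Suppose \<open>{0..m}\<close> is null for some \<open>m > r\<close>. The balance equation on \<open>{m<..m + \<delta>}\<close> bounds the mass there by a multiple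
  of \<open>\<delta>\<close> times itself, because \<open>G\<close> only sees mass in \<open>{m<..m + \<delta>}\<close>. For small \<open>\<delta>\<close> the interval is null as well, and
  finitely many steps contradict the total mass being \<open>1\<close>.
\<close>

lemma mass_near_r:
  assumes e: "0 < e" shows "0 < measure \<nu> {0..r + e}"
proof (rule ccontr)
  define m0 where "m0 = r + e"
  assume "\<not> 0 < measure \<nu> {0..r + e}"
  then have m0: "measure \<nu> {0..m0} = 0" by (simp add: m0_def zero_less_measure_iff)
  obtain N :: nat where N: "0 < measure \<nu> {0..real N}"
  proof -
    have "(\<lambda>n. measure \<nu> {0..real n}) \<longlonglongrightarrow> measure \<nu> (\<Union>n. {0..real n})"
      by (rule finite_Lim_measure_incseq) (auto simp: sets_\<nu>_iff incseq_def)
    moreover have "(\<Union>n. {0..real n}) = space \<nu>"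
      using real_arch_simple by (auto simp: space_\<nu>)
    ultimately have "(\<lambda>n. measure \<nu> {0..real n}) \<longlonglongrightarrow> 1" by (simp add: prob_space)
    then have "\<forall>\<^sub>F n in sequentially. 0 < measure \<nu> {0..real n}"
      by (rule order_tendstoD(1)) simp
    then show thesis using that by (auto simp: eventually_sequentially)
  qed
  define k where "k = p\<^sub>B / g * (real N + 1)"
  have k: "0 < k" unfolding k_def using pB g by simp
  \<comment> \<open>The step is chosen once for all \<open>m \<le> N\<close>; the factor \<open>exp (- 1)\<close> bounds the variation of \<open>exp (- x)\<close> over a step.\<close>
  define \<delta> where "\<delta> = min 1 (p\<^sub>A * e * exp (- 1) / (2 * k))"
  have pe: "0 < p\<^sub>A * e * exp (- 1)" using pA e by simp
  have \<delta>: "0 < \<delta>" "\<delta> \<le> 1" unfolding \<delta>_def using pe k by auto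
  have \<delta>k: "\<delta> * k < p\<^sub>A * e * exp (- 1)"
  proof -
    have "\<delta> * k \<le> p\<^sub>A * e * exp (- 1) / (2 * k) * k"
      unfolding \<delta>_def using k by (intro mult_right_mono) auto
    also have "\<dots> = p\<^sub>A * e * exp (- 1) / 2" using k by simp
    finally show ?thesis using pe by linarith
  qed
  have step: "measure \<nu> {0..m + \<delta>} = 0" if m: "m0 \<le> m" "m \<le> real N" and null: "measure \<nu> {0..m} = 0" for m
  proof (rule ccontr)
    assume "measure \<nu> {0..m + \<delta>} \<noteq> 0"
    let ?A = "{m<..m + \<delta>}" and ?w = "measure \<nu> {0..m + \<delta>}"
    have mr: "r + e \<le> m" using m by (simp add: m0_def)
    have A: "?A \<in> sets borel" "?A \<subseteq> {0..}" using mr r_pos e by auto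
    have w: "0 < ?w" using \<open>?w \<noteq> 0\<close> by (simp add: zero_less_measure_iff)
    have "?w \<le> measure \<nu> {0..m} + measure \<nu> ?A"
    proof -
      have "{0..m + \<delta>} = {0..m} \<union> ?A" using \<delta> mr r_pos e by auto
      then show ?thesis using measure_Un_le[of "{0..m}" \<nu> ?A] A by (simp add: sets_\<nu>_iff)
    qed
    then have wA: "?w \<le> measure \<nu> ?A" using null by simp
    have "p\<^sub>A * e * exp (- (m + \<delta>)) * ?w \<le> p\<^sub>A * e * exp (- (m + \<delta>)) * measure \<nu> ?A"
      using pA e wA by (intro mult_left_mono) auto
    also have "\<dots> = (\<integral>x. (p\<^sub>A * e * exp (- (m + \<delta>))) * indicator ?A x \<partial>\<nu>)"
      by (rule measure_indicator_integral(2)[OF A, symmetric])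
    also have "\<dots> \<le> (\<integral>x. indicator ?A x * (p\<^sub>A * (x - r) * exp (- x)) \<partial>\<nu>)"
    proof (rule integral_mono[OF measure_indicator_integral(1)[OF A] integrable_tilted_drift[OF A(1)]])
      fix x
      have "p\<^sub>A * e * exp (- (m + \<delta>)) \<le> p\<^sub>A * (x - r) * exp (- x)" if "x \<in> ?A"
        using that pA e mr by (intro mult_mono) auto
      then show "(p\<^sub>A * e * exp (- (m + \<delta>))) * indicator ?A x \<le> indicator ?A x * (p\<^sub>A * (x - r) * exp (- x))"
        by (auto simp: indicator_def)
    qed
    also have "\<dots> = (\<integral>x. indicator ?A x * (G x * exp (- x)) \<partial>lborel)" by (rule balance[OF A(1)])
    also have "\<dots> \<le> (\<integral>x. (k * ?w * exp (- m)) * indicator ?A x \<partial>lborel)"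
    proof (rule integral_mono[OF integrable_tilted_G[OF A(1)]])
      show "integrable lborel (\<lambda>x. (k * ?w * exp (- m)) * indicator ?A x)"
        using \<delta> by (intro integral_const_Ioc) auto
      fix x
      have "G x * exp (- x) \<le> k * ?w * exp (- m)" if x: "x \<in> ?A"
      proof (rule mult_mono)
        have "G x \<le> p\<^sub>B / g * ((m + \<delta>) * ?w)"
          by (rule G_upper) (use x mr r_pos e in auto)
        also have "\<dots> = p\<^sub>B / g * (m + \<delta>) * ?w" by simp
        also have "\<dots> \<le> k * ?w"
          unfolding k_def using m \<delta> pB g by (intro mult_right_mono mult_left_mono) auto
        finally show "G x \<le> k * ?w" .
      qed (use x k w in auto)
      then show "indicator ?A x * (G x * exp (- x)) \<le> (k * ?w * exp (- m)) * indicator ?A x"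
        by (auto simp: indicator_def)
    qed
    also have "\<dots> = k * ?w * exp (- m) * \<delta>" using \<delta> by (intro integral_const_Ioc) auto
    finally have "(p\<^sub>A * e * exp (- \<delta>)) * (exp (- m) * ?w) \<le> (\<delta> * k) * (exp (- m) * ?w)"
      by (simp add: exp_add exp_diff mult_ac flip: exp_minus) (simp add: exp_minus exp_diff field_simps)
    then have "p\<^sub>A * e * exp (- \<delta>) \<le> \<delta> * k"
      using w by simp
    moreover have "p\<^sub>A * e * exp (- 1) \<le> p\<^sub>A * e * exp (- \<delta>)"
      using \<delta> pA e by (intro mult_left_mono) auto
    ultimately show False using \<delta>k by linarith
  qed
  have "measure \<nu> {0..min (real N) (m0 + real j * \<delta>)} = 0" for j
  proof (induction j)
    case 0
    have "measure \<nu> {0..min (real N) (m0 + real 0 * \<delta>)} \<le> measure \<nu> {0..m0}"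
      by (rule finite_measure_mono) (auto simp: sets_\<nu>_iff)
    then show ?case using m0 by (simp add: measure_le_0_iff)
  next
    case (Suc j)
    let ?m = "m0 + real j * \<delta>"
    show ?case
    proof (cases "?m \<le> real N")
      case True
      then have "measure \<nu> {0..?m} = 0" using Suc by simp
      from step[OF _ True this] have "measure \<nu> {0..?m + \<delta>} = 0" using \<delta> by simp
      moreover have "measure \<nu> {0..min (real N) (m0 + real (Suc j) * \<delta>)} \<le> measure \<nu> {0..?m + \<delta>}"
        by (rule finite_measure_mono) (auto simp: sets_\<nu>_iff algebra_simps)
      ultimately show ?thesis by (simp add: measure_le_0_iff)
    next
      case False
      have "measure \<nu> {0..min (real N) (m0 + real (Suc j) * \<delta>)} \<le> measure \<nu> {0..min (real N) ?m}"
        by (rule finite_measure_mono) (use False in \<open>auto simp: sets_\<nu>_iff\<close>)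
      then show ?thesis using Suc by (simp add: measure_le_0_iff)
    qed
  qed
  moreover obtain j :: nat where "real N / \<delta> \<le> real j" using real_arch_simple by blast
  then have "real N \<le> m0 + real j * \<delta>"
    using \<delta> r_pos e by (simp add: divide_le_eq m0_def)
  ultimately show False using N by (metis min.absorb1 less_irrefl)
qed

text \<open>
  If \<open>G u = 0\<close> then \<open>{u - g..u}\<close> is null, so \<open>G\<close> vanishes almost everywhere on it, in particular at some point at most
  \<open>u - g / 2\<close>. Descending in steps of \<open>g / 2\<close> one arrives at an interval that starts at \<open>r\<close>, against \<open>mass_near_r\<close>.
\<close>

lemma G_pos_below: "r < u \<Longrightarrow> u \<le> r + real k * (g / 2) \<Longrightarrow> 0 < G u"
proof (induction k arbitrary: u)
  case 0
  then show ?case by simp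
next
  case (Suc k)
  show ?case
  proof (rule ccontr)
    assume "\<not> 0 < G u"
    then have G0: "G u = 0" using G_nonneg[of u] by simp
    have null: "measure \<nu> {max r (u - g)..u} = 0"
    proof -
      have "p\<^sub>B / g * (r * measure \<nu> {max r (u - g)..u}) \<le> G u"
        by (rule G_lower) (use r_pos in auto)
      then have "(p\<^sub>B / g * r) * measure \<nu> {max r (u - g)..u} \<le> (p\<^sub>B / g * r) * 0" using G0 by simp
      moreover have "0 < p\<^sub>B / g * r" using pB g r_pos by simp
      ultimately have "measure \<nu> {max r (u - g)..u} \<le> 0"
        by (simp only: mult_le_cancel_left_pos)
      then show ?thesis by (simp add: measure_le_0_iff)
    qed
    show False
    proof (cases "u - g \<le> r")
      case True
      then have "measure \<nu> {r..u} = 0" using null by simp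
      then show False
        using mass_near_r[of "u - r"] Suc.prems(1) measure_Icc_ge[of u] by simp
    next
      case False
      let ?A = "{u - g<..u - g / 2}"
      have A: "?A \<in> sets borel" "?A \<subseteq> {0..}" using False r_pos by auto
      have "measure \<nu> ?A \<le> measure \<nu> {max r (u - g)..u}"
        by (rule finite_measure_mono) (use False g r_pos in \<open>auto simp: sets_\<nu>_iff\<close>)
      then have "measure \<nu> ?A = 0" using null by (simp add: measure_le_0_iff)
      then have "?A \<in> null_sets \<nu>" using A by (simp add: null_sets_def sets_\<nu>_iff emeasure_eq_measure)
      then have "AE x in \<nu>. x \<notin> ?A" by (rule AE_not_in)
      then have "(\<integral>x. indicator ?A x * (p\<^sub>A * (x - r) * exp (- x)) \<partial>\<nu>) = 0"
        by (intro integral_eq_zero_AE) (auto elim!: eventually_mono)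
      then have "(\<integral>x. indicator ?A x * (G x * exp (- x)) \<partial>lborel) = 0" by (simp add: balance)
      then have null: "AE x in lborel. indicator ?A x * (G x * exp (- x)) = 0"
        using integral_nonneg_eq_0_iff_AE[OF integrable_tilted_G[OF A(1)]] G_nonneg by simp
      have pos: "0 < G x" if "x \<in> ?A" for x
      proof (rule Suc.IH)
        have "real (Suc k) * (g / 2) = real k * (g / 2) + g / 2" by (simp add: algebra_simps)
        then show "x \<le> r + real k * (g / 2)" 
          using that Suc.prems(2) unfolding greaterThanAtMost_iff by linarith
      qed (use that False in auto)
      from null have "AE x in lborel. x \<notin> ?A"
      proof eventually_elim
        case (elim x)
        then show ?case using pos[of x] by (cases "x \<in> ?A") auto
      qed
      then have "?A \<in> null_sets lborel"
        using AE_iff_null_sets[of ?A lborel] by simp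
      then have "emeasure lborel ?A = 0" by (rule null_setsD1)
      then show False using g by simp
    qed
  qed
qed

lemma G_pos:
  assumes "r < u" shows "0 < G u"
proof -
  obtain k :: nat where "(u - r) / (g / 2) \<le> real k" using real_arch_simple by blast
  then have "u \<le> r + real k * (g / 2)" using g by (simp add: divide_le_eq algebra_simps)
  with assms show ?thesis by (rule G_pos_below)
qed

definition h :: "real \<Rightarrow> real" where
  "h y = (if r < y then G y / (p\<^sub>A * (y - r)) else 0)"

lemma h_measurable: "h \<in> borel_measurable borel"
  unfolding h_def using G_measurable by measurable

lemma h_nonneg: "0 \<le> h y"
  using pA G_nonneg by (auto simp: h_def intro!: divide_nonneg_nonneg mult_nonneg_nonneg)

lemma h_pos: "r < y \<Longrightarrow> 0 < h y"
  using pA G_pos by (auto simp: h_def)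

lemma h_continuous: "continuous_on {r<..} h"
proof -
  have "continuous_on {r<..} (\<lambda>y. G y / (p\<^sub>A * (y - r)))"
    using pA by (intro continuous_intros G_continuous) auto
  then show ?thesis by (rule continuous_on_eq) (simp add: h_def)
qed

text \<open>
  The balance equation identifies \<open>\<nu>\<close> and Lebesgue measure after multiplication by \<open>p\<^sub>A * (x - r) * exp (- x)\<close> and
  \<open>G x * exp (- x)\<close> respectively; on \<open>{r<..}\<close> the first weight can be divided out, and the rest is null for \<open>\<nu>\<close>.
\<close>

lemma density_h: "\<nu> = density (restrict_space lborel {0..}) (\<lambda>y. ennreal (h y))"
proof -
  let ?L = "restrict_space lborel {0..} :: real measure"
  have sets_L: "sets ?L = sets state_space"
    unfolding state_space_def by (rule sets_restrict_space_cong) simp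
  define f1 where "f1 x = indicator {r<..} x * (p\<^sub>A * (x - r) * exp (- x))" for x
  define f2 where "f2 x = indicator {r<..} x * (G x * exp (- x))" for x
  define k where "k x = indicator {r<..} x / (p\<^sub>A * (x - r) * exp (- x))" for x
  have [measurable]: "G \<in> borel_measurable borel" by (rule G_measurable)
  have m: "f1 \<in> borel_measurable borel" "f2 \<in> borel_measurable borel" "k \<in> borel_measurable borel"
    unfolding f1_def f2_def k_def by measurable
  note m\<nu> = borel_\<nu>[OF measurable_compose[OF _ measurable_ennreal]]
  note mL = borel_imp_measurable_state_space[OF sets_L measurable_compose[OF _ measurable_ennreal]]
  have f1: "0 \<le> f1 x" for x using pA by (auto simp: f1_def indicator_def)
  have f2: "0 \<le> f2 x" for x using G_nonneg by (auto simp: f2_def indicator_def)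
  have "density \<nu> (\<lambda>x. ennreal (f1 x)) = density ?L (\<lambda>x. ennreal (f2 x))"
  proof (rule measure_eqI)
    show "sets (density \<nu> (\<lambda>x. ennreal (f1 x))) = sets (density ?L (\<lambda>x. ennreal (f2 x)))"
      by (simp add: sets_\<nu> sets_L)
    fix A assume "A \<in> sets (density \<nu> (\<lambda>x. ennreal (f1 x)))"
    then have A\<nu>: "A \<in> sets \<nu>" and AL: "A \<in> sets ?L" and Ab: "A \<in> sets borel" and A0: "A \<subseteq> {0..}"
      by (auto simp: sets_\<nu> sets_L sets_state_space)
    have Ar: "A \<inter> {r<..} \<in> sets borel" using Ab by auto
    have e1: "indicator A x * f1 x = indicator (A \<inter> {r<..}) x * (p\<^sub>A * (x - r) * exp (- x))" for x
      by (simp add: f1_def indicator_def)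
    have e2: "indicator A x * f2 x = indicator (A \<inter> {r<..}) x * (G x * exp (- x))" for x
      by (simp add: f2_def indicator_def)
    have "emeasure (density \<nu> (\<lambda>x. ennreal (f1 x))) A = (\<integral>\<^sup>+x. ennreal (f1 x) * indicator A x \<partial>\<nu>)"
      by (rule emeasure_density[OF m\<nu>[OF m(1)] A\<nu>])
    also have "\<dots> = (\<integral>\<^sup>+x. ennreal (indicator A x * f1 x) \<partial>\<nu>)"
      by (rule nn_integral_cong) (simp add: indicator_def)
    also have "\<dots> = ennreal (\<integral>x. indicator A x * f1 x \<partial>\<nu>)"
      unfolding e1 using integrable_tilted_drift[OF Ar] f1
      by (intro nn_integral_eq_integral AE_I2) (auto simp flip: e1)
    also have "(\<integral>x. indicator A x * f1 x \<partial>\<nu>) = (\<integral>x. indicator A x * f2 x \<partial>lborel)"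
      unfolding e1 e2 by (rule balance[OF Ar])
    also have "ennreal \<dots> = (\<integral>\<^sup>+x. ennreal (indicator A x * f2 x) \<partial>lborel)"
      unfolding e2 using integrable_tilted_G[OF Ar] f2
      by (intro nn_integral_eq_integral[symmetric] AE_I2) (auto simp flip: e2)
    also have "\<dots> = (\<integral>\<^sup>+x. (ennreal (f2 x) * indicator A x) * indicator {0..} x \<partial>lborel)"
      by (rule nn_integral_cong) (use A0 in \<open>auto simp: indicator_def\<close>)
    also have "\<dots> = (\<integral>\<^sup>+x. ennreal (f2 x) * indicator A x \<partial>?L)"
      by (rule nn_integral_restrict_space[symmetric]) simp
    also have "\<dots> = emeasure (density ?L (\<lambda>x. ennreal (f2 x))) A"
      by (rule emeasure_density[OF mL[OF m(2)] AL, symmetric])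
    finally show "emeasure (density \<nu> (\<lambda>x. ennreal (f1 x))) A = emeasure (density ?L (\<lambda>x. ennreal (f2 x))) A" .
  qed
  then have "density (density \<nu> (\<lambda>x. ennreal (f1 x))) (\<lambda>x. ennreal (k x))
      = density (density ?L (\<lambda>x. ennreal (f2 x))) (\<lambda>x. ennreal (k x))" by simp
  then have eq: "density \<nu> (\<lambda>x. ennreal (f1 x) * ennreal (k x)) = density ?L (\<lambda>x. ennreal (f2 x) * ennreal (k x))"
    by (simp add: density_density_eq m\<nu> mL m)
  have f1k: "AE x in \<nu>. ennreal (f1 x) * ennreal (k x) = 1"
    using AE_ge_r AE_neq[of r]
  proof eventually_elim
    case (elim x)
    then have "r < x" by simp
    then show ?case using pA f1[of x] by (simp add: f1_def k_def flip: ennreal_mult)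
  qed
  have f2k: "ennreal (f2 x) * ennreal (k x) = ennreal (h x)" for x
  proof (cases "r < x")
    case True
    have "G x * exp (- x) * (1 / (p\<^sub>A * (x - r) * exp (- x))) = G x / (p\<^sub>A * (x - r))"
      by simp
    then show ?thesis using True pA f2[of x]
      by (simp add: f2_def k_def h_def ennreal_mult[symmetric] del: times_divide_eq_right)
  qed (simp add: f2_def k_def h_def)
  have "\<nu> = density \<nu> (\<lambda>x. 1)" by (simp add: density_1)
  also have "\<dots> = density \<nu> (\<lambda>x. ennreal (f1 x) * ennreal (k x))"
    by (rule density_cong) (use m\<nu> m f1k in \<open>auto elim!: eventually_mono\<close>)
  also have "\<dots> = density ?L (\<lambda>y. ennreal (h y))"
    unfolding eq f2k ..
  finally show ?thesis .
qed

end

section \<open>The stationary law of the penalized bandit\<close>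

theorem theorem6:
  fixes p\<^sub>A p\<^sub>B g :: real
    and \<Omega> :: "'w measure" and P :: "real \<Rightarrow> 'w measure" and Y :: "real \<Rightarrow> 'w \<Rightarrow> real"
  assumes "0 < p\<^sub>B" and "p\<^sub>B < p\<^sub>A" and "p\<^sub>A < 1" and "0 < g"
    and "markov_process_with_generator (gen p\<^sub>A p\<^sub>B g) \<Omega> P Y"
  defines "r\<^sub>A \<equiv> (1 - p\<^sub>A) / p\<^sub>A"
  shows "\<exists>\<nu>. stationary_distribution P Y \<nu> \<and>
      (\<forall>\<mu>. stationary_distribution P Y \<mu> \<longrightarrow> \<mu> = \<nu>) \<and>
      (\<exists>h :: real \<Rightarrow> real. h \<in> borel_measurable borel \<and> (\<forall>y. 0 \<le> h y) \<and>
         \<nu> = density (restrict_space lborel {0..}) (\<lambda>y. ennreal (h y)) \<and>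
         (\<forall>y\<in>{0<..r\<^sub>A}. h y = 0) \<and> (\<forall>y\<in>{r\<^sub>A<..}. 0 < h y) \<and> continuous_on {r\<^sub>A<..} h) \<and>
      (\<forall>K f. compact K \<and> K \<subseteq> {0..} \<and> continuous_on {0..} f \<and> bounded (f ` {0..}) \<longrightarrow>
         ((\<lambda>t. SUP y\<in>K. ennreal \<bar>(\<integral>\<omega>. f (Y t \<omega>) \<partial>P y) - (\<integral>x. f x \<partial>\<nu>)\<bar>) \<longlongrightarrow> 0) at_top)"
proof -
  interpret bandit_process p\<^sub>A p\<^sub>B g \<Omega> P Y
    by (intro bandit_process.intro bandit_process_axioms.intro bandit_parameters.intro assms)
  obtain \<nu> where \<nu>: "prob_space \<nu>" "sets \<nu> = sets state_space"
    and lap: "\<And>l. 0 < l \<Longrightarrow> (\<integral>x. exp (- l * x) \<partial>\<nu>) = \<Lambda> l"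
    by (rule limit_law_exists) (rule that)
  interpret law: bandit_limit_law p\<^sub>A p\<^sub>B g \<nu>
    by (intro bandit_limit_law.intro bandit_limit_law_axioms.intro bandit_parameters_axioms \<nu> lap)
  have r: "law.r = r\<^sub>A" by (simp add: law.r_def r\<^sub>A_def)
  have density: "law.h \<in> borel_measurable borel \<and> (\<forall>y. 0 \<le> law.h y) \<and>
      \<nu> = density (restrict_space lborel {0..}) (\<lambda>y. ennreal (law.h y)) \<and>
      (\<forall>y\<in>{0<..r\<^sub>A}. law.h y = 0) \<and> (\<forall>y\<in>{r\<^sub>A<..}. 0 < law.h y) \<and> continuous_on {r\<^sub>A<..} law.h"
  proof (intro conjI allI ballI)
    show "\<nu> = density (restrict_space lborel {0..}) (\<lambda>y. ennreal (law.h y))"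
      by (rule law.density_h)
    show "law.h y = 0" if "y \<in> {0<..r\<^sub>A}" for y
      using that by (simp add: law.h_def r)
    show "0 < law.h y" if "y \<in> {r\<^sub>A<..}" for y
      using that law.h_pos[of y] by (simp add: r)
    show "continuous_on {r\<^sub>A<..} law.h"
      using law.h_continuous by (simp add: r)
  qed (rule law.h_measurable law.h_nonneg)+
  show ?thesis
  proof (rule exI[of _ \<nu>], intro conjI allI impI)
    show "stationary_distribution P Y \<nu>"
      by (rule stationary_if_laplace[OF \<nu> lap])
    show "\<mu> = \<nu>" if \<mu>: "stationary_distribution P Y \<mu>" for \<mu>
    proof (rule laplace_determines[OF _ _ \<nu>])
      show "prob_space \<mu>" "sets \<mu> = sets state_space"
        using \<mu> by (auto simp: stationary_distribution_def)
      show "(\<integral>x. exp (- l * x) \<partial>\<mu>) = (\<integral>x. exp (- l * x) \<partial>\<nu>)" if "0 < l" for l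
        using stationary_laplace[OF \<mu> that] lap[OF that] by simp
    qed
    show "\<exists>h :: real \<Rightarrow> real. h \<in> borel_measurable borel \<and> (\<forall>y. 0 \<le> h y) \<and>
        \<nu> = density (restrict_space lborel {0..}) (\<lambda>y. ennreal (h y)) \<and>
        (\<forall>y\<in>{0<..r\<^sub>A}. h y = 0) \<and> (\<forall>y\<in>{r\<^sub>A<..}. 0 < h y) \<and> continuous_on {r\<^sub>A<..} h"
      using density by (rule exI[of _ law.h])
    fix K :: "real set" and f :: "real \<Rightarrow> real"
    assume "compact K \<and> K \<subseteq> {0..} \<and> continuous_on {0..} f \<and> bounded (f ` {0..})"
    then show "((\<lambda>t. SUP y\<in>K. ennreal \<bar>(\<integral>\<omega>. f (Y t \<omega>) \<partial>P y) - (\<integral>x. f x \<partial>\<nu>)\<bar>) \<longlongrightarrow> 0) at_top"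
      by (intro uniform_ergodicity_SUP[OF \<nu> lap]) auto
  qed
qed

end
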